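(* Let $n\ge 2$, $G=\mathrm{GL}(n,\mathbb{C})$, $\lambda\in\mathbb{R}$ and $k\in\mathbb{Z}$. Upon restriction to the maximal compact subgroup $K=\mathrm{U}(n)$ the unitary principal series representation $\pi_{i\lambda,k}^G$ of $G$ decomposes as the Hilbert space direct sum $$\pi_{i\lambda,k}^G|_K\;\cong\;\bigoplus_{\substack{\alpha,\beta\ge 0\\ \alpha-\beta=-k}}\mathcal{H}^{\alpha,\beta}(\mathbb{C}^n),$$ where $\alpha,\beta$ range over non-negative integers.
   Context: Let $P=(\mathrm{GL}(1,\mathbb{C})\times\mathrm{GL}(n-1,\mathbb{C}))\ltimes\mathbb{C}^{n-1}$ be the standard (block upper triangular) maximal parabolic subgroup of $G=\mathrm{GL}(n,\mathbb{C})$ for the partition $(1,n-1)$, i.e. the stabilizer of the line $\mathbb{C}e_1$, so $G/P\cong\mathbb{C}\mathbb{P}^{n-1}$. For $t\in\mathbb{C}$, $k\in\mathbb{Z}$ let $\chi_{t,k}$ be the character of $P$ given by $\chi_{t,k}(\mathrm{diag}(w,g))=|w|^t(w/|w|)^k$ for $w\in\mathrm{GL}(1,\mathbb{C})$, $g\in\mathrm{GL}(n-1,\mathbb{C})$, and trivial on the nilpotent radical. Then $\pi_{t,k}^G=\mathrm{Ind}_P^G(\chi_{t,k})$ is the normalized parabolically induced representation: $G$ acts by left translation on functions $f$ on $G$ with $f(gp)=\delta_P(p)^{-1/2}\chi_{t,k}(p)^{-1}f(g)$, where $\delta_P(p)=|\det\mathrm{Ad}(p)|_{\mathfrak{n}}|$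 ($\mathfrak n$ the Lie algebra of the nilradical, as a real vector space). For $t=i\lambda\in i\mathbb{R}$ it is unitary on the natural $L^2$-completion. $\mathcal{H}^{\alpha,\beta}(\mathbb{C}^n)$ denotes the representation of $\mathrm{U}(n)$, by $(u\cdot f)(z)=f(u^{-1}z)$, on the space of harmonic polynomials on $\mathbb{C}^n\cong\mathbb{R}^{2n}$ that are homogeneous of degree $\alpha$ in $z$ and homogeneous of degree $\beta$ in $\overline{z}$. *)

theory Defs
  imports "HOL-Analysis.Analysis" "HOL-Combinatorics.Permutations"
begin

text \<open>
  Matrices of size \<open>n\<close> are elements of \<^typ>\<open>complex^'n^'n\<close> with \<open>n = CARD('n)\<close>; the entry in
  row \<open>i\<close> and column \<open>j\<close> of \<open>g\<close> is \<open>g $ i $ j\<close>. The first basis vector \<open>e\<^sub>1\<close> of \<open>\<complex>\<^sup>n\<close> is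
  \<open>axis i0 1\<close>, where \<open>i0\<close> is a distinguished element of the index type.
\<close>

subsection \<open>The groups\<close>

definition GL :: "(complex^'n^'n) set" where
  "GL = {g. invertible g}"

definition conj_transpose :: "complex^'n^'n \<Rightarrow> complex^'n^'n" where
  "conj_transpose g = (\<chi> i j. cnj (g $ j $ i))"

definition unitary_group :: "(complex^'n^'n) set" where
  "unitary_group = {u. conj_transpose u ** u = mat 1 \<and> u ** conj_transpose u = mat 1}"

definition parabolic :: "'n \<Rightarrow> (complex^'n^'n) set" where
  "parabolic i0 = {p \<in> GL. \<forall>i. i \<noteq> i0 \<longrightarrow> p $ i $ i0 = 0}"

definition nilradical :: "'n \<Rightarrow> (complex^'n^'n) set" where
  "nilradical i0 = {X. \<forall>i j. \<not> (i = i0 \<and> j \<noteq> i0) \<longrightarrow> X $ i $ j = 0}"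

definition Ad :: "complex^'n^'n \<Rightarrow> complex^'n^'n \<Rightarrow> complex^'n^'n" where
  "Ad p X = p ** X ** matrix_inv p"

subsection \<open>The modulus and the character of the parabolic subgroup\<close>

text \<open>
  The determinant of a real linear map \<open>L\<close> that preserves \<open>V\<close>, for a real subspace \<open>V\<close> spanned by
  elements of the standard basis \<^const>\<open>Basis\<close>: the Leibniz formula for the matrix of
  \<open>L\<close> restricted to \<open>V\<close> with respect to the orthonormal basis \<open>Basis \<inter> V\<close>.
\<close>
definition det_on :: "'a::euclidean_space set \<Rightarrow> ('a \<Rightarrow> 'a) \<Rightarrow> real" where
  "det_on V L =
    (\<Sum>\<sigma> | \<sigma> permutes (Basis \<inter> V). of_int (sign \<sigma>) * (\<Prod>b\<in>Basis \<inter> V. L b \<bullet> \<sigma> b))"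

text \<open>
  The standard basis of \<^typ>\<open>complex^'n^'n\<close> consists of the matrix units and \<open>\<i>\<close> times
  the matrix units, so \<^const>\<open>nilradical\<close>, as a real space, is of the form required by \<^const>\<open>det_on\<close>.
\<close>
definition modulus :: "'n \<Rightarrow> complex^'n^'n \<Rightarrow> real" where
  "modulus i0 p = \<bar>det_on (nilradical i0) (Ad p)\<bar>"

text \<open>
  An element \<open>p\<close> of the parabolic subgroup is \<open>diag(w,g)\<close> times an element of the unipotent
  radical, and \<open>w = p $ i0 $ i0\<close>.
\<close>
definition parabolic_char :: "'n \<Rightarrow> complex \<Rightarrow> int \<Rightarrow> complex^'n^'n \<Rightarrow> complex" where
  "parabolic_char i0 t k p =
    (let w = p $ i0 $ i0
     in complex_of_real (cmod w) powr t * (w / complex_of_real (cmod w)) powi k)"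

subsection \<open>The principal series\<close>

text \<open>The normalized Haar measure of the unitary group.\<close>
definition haar_unitary :: "(complex^'n^'n) measure \<Rightarrow> bool" where
  "haar_unitary \<mu> \<longleftrightarrow>
     sets \<mu> = sets (restrict_space borel unitary_group) \<and>
     emeasure \<mu> (space \<mu>) = 1 \<and>
     (\<forall>u\<in>unitary_group. distr \<mu> \<mu> (\<lambda>v. u ** v) = \<mu>)"

text \<open>
  The \<open>L\<^sup>2\<close>-completion of the induced representation: Borel functions on \<open>GL(n,\<complex>)\<close>
  (extended by zero to all matrices) with the equivariance property of the induced representation
  and with square-integrable restriction to \<open>U(n)\<close>. The form \<open>L2_inner \<mu>\<close> is positive semidefinite
  on this space, and its null vectors are the functions that vanish almost everywhere.
\<close>
definition principal_series ::
    "(complex^'n^'n) measure \<Rightarrow> 'n \<Rightarrow> complex \<Rightarrow> int \<Rightarrow> (complex^'n^'n \<Rightarrow> complex) set" where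
  "principal_series \<mu> i0 t k = {f.
     f \<in> borel_measurable (restrict_space borel GL) \<and>
     (\<forall>g. g \<notin> GL \<longrightarrow> f g = 0) \<and>
     (\<forall>g\<in>GL. \<forall>p\<in>parabolic i0.
        f (g ** p) =
          complex_of_real (modulus i0 p powr (-1/2)) * inverse (parabolic_char i0 t k p) * f g) \<and>
     integrable \<mu> (\<lambda>u. (cmod (f u))\<^sup>2)}"

definition L2_inner :: "'x measure \<Rightarrow> ('x \<Rightarrow> complex) \<Rightarrow> ('x \<Rightarrow> complex) \<Rightarrow> complex" where
  "L2_inner M f g = (\<integral>x. f x * cnj (g x) \<partial>M)"

definition left_translate ::
    "complex^'n^'n \<Rightarrow> (complex^'n^'n \<Rightarrow> complex) \<Rightarrow> complex^'n^'n \<Rightarrow> complex" where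
  "left_translate g f = (\<lambda>x. f (matrix_inv g ** x))"

subsection \<open>Bihomogeneous harmonic polynomials\<close>

definition bihomogeneous :: "nat \<Rightarrow> nat \<Rightarrow> (complex^'n \<Rightarrow> complex) set" where
  "bihomogeneous \<alpha> \<beta> = {f. \<exists>c :: ('n \<Rightarrow> nat) \<Rightarrow> ('n \<Rightarrow> nat) \<Rightarrow> complex.
     \<forall>z. f z = (\<Sum>a | (\<Sum>i\<in>UNIV. a i) = \<alpha>. \<Sum>b | (\<Sum>i\<in>UNIV. b i) = \<beta>.
       c a b * (\<Prod>i\<in>UNIV. (z $ i) ^ a i * cnj (z $ i) ^ b i))}"

text \<open>On \<^typ>\<open>complex^'n\<close> this is the Laplacian of the underlying real space \<open>\<real>\<^sup>2\<^sup>n\<close>.\<close>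
definition laplacian :: "('a::euclidean_space \<Rightarrow> complex) \<Rightarrow> 'a \<Rightarrow> complex" where
  "laplacian f z =
    (\<Sum>b\<in>Basis. frechet_derivative (\<lambda>w. frechet_derivative f (at w) b) (at z) b)"

definition harmonics :: "nat \<Rightarrow> nat \<Rightarrow> (complex^'n \<Rightarrow> complex) set" where
  "harmonics \<alpha> \<beta> = {f \<in> bihomogeneous \<alpha> \<beta>. \<forall>z. laplacian f z = 0}"

definition poly_action ::
    "complex^'n^'n \<Rightarrow> (complex^'n \<Rightarrow> complex) \<Rightarrow> complex^'n \<Rightarrow> complex" where
  "poly_action u f = (\<lambda>z. f (matrix_inv u *v z))"

text \<open>
  The normalized rotation-invariant measure on the unit sphere, as the radial projection of the
  normalized Lebesgue measure on the unit ball. It supplies the \<open>U(n)\<close>-invariant inner product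
  on each space of harmonic polynomials.
\<close>
definition sphere_measure :: "'a::euclidean_space measure" where
  "sphere_measure = distr (uniform_measure lborel (ball 0 1)) borel sgn"

subsection \<open>Hilbert space direct sums and unitary equivalence\<close>

text \<open>
  The Hilbert space direct sum of function spaces \<open>V i\<close>, \<open>i \<in> I\<close>, with inner product \<open>ip\<close>:
  families with square-summable norms, extended by zero outside \<open>I\<close>.
\<close>
definition hilbert_sum ::
    "'i set \<Rightarrow> ('i \<Rightarrow> ('z \<Rightarrow> complex) set) \<Rightarrow> (('z \<Rightarrow> complex) \<Rightarrow> ('z \<Rightarrow> complex) \<Rightarrow> complex)
      \<Rightarrow> ('i \<Rightarrow> 'z \<Rightarrow> complex) set" where
  "hilbert_sum I V ip = {v.
     (\<forall>i\<in>I. v i \<in> V i) \<and> (\<forall>i. i \<notin> I \<longrightarrow> v i = (\<lambda>_. 0)) \<and>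
     (\<lambda>i. Re (ip (v i) (v i))) summable_on I}"

definition hilbert_sum_inner ::
    "'i set \<Rightarrow> (('z \<Rightarrow> complex) \<Rightarrow> ('z \<Rightarrow> complex) \<Rightarrow> complex)
      \<Rightarrow> ('i \<Rightarrow> 'z \<Rightarrow> complex) \<Rightarrow> ('i \<Rightarrow> 'z \<Rightarrow> complex) \<Rightarrow> complex" where
  "hilbert_sum_inner I ip v w = (\<Sum>\<^sub>\<infinity>i\<in>I. ip (v i) (w i))"

text \<open>
  The representation of \<open>K\<close> on the Hilbert space obtained from \<open>(H, ipH)\<close> by dividing out the null
  vectors is unitarily equivalent to the Hilbert space direct sum of the representations on the
  spaces \<open>V i\<close>. The map \<open>T\<close> is given on \<open>H\<close> itself: since it is linear and preserves inner products,
  and the inner product of the direct sum is definite, it factors through the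
  quotient, where it is a bijective isometry.
\<close>
definition unitarily_equivalent_to_sum ::
    "'g set
      \<Rightarrow> ('x \<Rightarrow> complex) set \<Rightarrow> (('x \<Rightarrow> complex) \<Rightarrow> ('x \<Rightarrow> complex) \<Rightarrow> complex)
      \<Rightarrow> ('g \<Rightarrow> ('x \<Rightarrow> complex) \<Rightarrow> 'x \<Rightarrow> complex)
      \<Rightarrow> 'i set \<Rightarrow> ('i \<Rightarrow> ('z \<Rightarrow> complex) set) \<Rightarrow> (('z \<Rightarrow> complex) \<Rightarrow> ('z \<Rightarrow> complex) \<Rightarrow> complex)
      \<Rightarrow> ('g \<Rightarrow> ('z \<Rightarrow> complex) \<Rightarrow> 'z \<Rightarrow> complex) \<Rightarrow> bool" where
  "unitarily_equivalent_to_sum K H ipH actH I V ipV actV \<longleftrightarrow>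
    (\<exists>T :: ('x \<Rightarrow> complex) \<Rightarrow> 'i \<Rightarrow> 'z \<Rightarrow> complex.
      T ` H = hilbert_sum I V ipV \<and>
      (\<forall>a b. \<forall>f\<in>H. \<forall>h\<in>H.
         T (\<lambda>x. a * f x + b * h x) = (\<lambda>i z. a * T f i z + b * T h i z)) \<and>
      (\<forall>f\<in>H. \<forall>h\<in>H. hilbert_sum_inner I ipV (T f) (T h) = ipH f h) \<and>
      (\<forall>u\<in>K. \<forall>f\<in>H. actH u f \<in> H \<and> T (actH u f) = (\<lambda>i. actV u (T f i))))"

end

theory Submission
  imports Defs
begin

text \<open>
  Let \<open>e\<close> be the base vector \<open>axis i0 1\<close>. A function in the induced
  representation is determined by its restriction to \<open>U(n)\<close>. The equivariance under the
  unitary matrices that fix the line of \<open>e\<close> says that this restriction is of the form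
  \<open>f(u) = F(u e)\<close>, for a function \<open>F\<close> on the unit sphere with \<open>F(w z) = w\<^sup>-\<^sup>k F(z)\<close> for
  \<open>|w| = 1\<close>. Conversely every such square-integrable \<open>F\<close> arises, through the
  Iwasawa decomposition \<open>g = u p\<close>; the parameter \<open>\<lambda>\<close> and the modulus only enter in
  this extension from \<open>U(n)\<close> to \<open>GL(n, \<complex>)\<close>, as they are trivial on the unitary part of the parabolic
  subgroup. The Haar measure is carried by \<open>u \<mapsto> u e\<close> to the rotation invariant measure of the sphere
  (\<open>distr_haar_sphere\<close>), so this is a unitary identification, and left translation becomes the
  action of \<open>U(n)\<close> on functions on the sphere.

  It remains to decompose the functions on the sphere. The operator that does this is the
  spherical Laplacian, the sum of the squares of the infinitesimal rotations. Every infinitesimal rotation is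
  skew-symmetric because the measure is invariant, so the spherical Laplacian is symmetric. On
  homogeneous polynomials of degree \<open>d\<close> in \<open>N = 2 n\<close> real variables it is
  \<open>|z|\<^sup>2 \<Delta> - d (d + N - 2)\<close>. These two facts form \<open>Green_sphere\<close>, from which everything
  else about harmonic polynomials follows:
    \<^item> harmonic polynomials of different degrees are orthogonal on the sphere, as their
      eigenvalues differ (\<open>harmonics_orthogonal\<close>);
    \<^item> a polynomial of bidegree \<open>(a + 1, b + 1)\<close> that is orthogonal to the bidegree \<open>(a, b)\<close> is harmonic
      (\<open>orthogonal_imp_harmonic\<close>), whence every polynomial agrees on the sphere with a sum of
      harmonic ones.
  By the theorem of Stone and Weierstrass the harmonic polynomials are therefore complete
  (\<open>harmonics_complete\<close>). Multiplication of the argument by \<open>w\<close> with \<open>|w| = 1\<close> separates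
  the differences \<open>\<alpha> - \<beta>\<close>, so a function with \<open>F(w z) = w\<^sup>-\<^sup>k F(z)\<close> only meets the
  bidegrees with \<open>\<alpha> - \<beta> = - k\<close>, which have pairwise different total degrees. The intertwining
  operator maps \<open>f\<close> to the family of orthogonal projections of \<open>F\<close>; Bessel's inequality, the
  Riesz--Fischer theorem and completeness show that it is onto and isometric.
\<close>

section \<open>Square-integrable functions\<close>

definition L2 :: "'x measure \<Rightarrow> ('x \<Rightarrow> complex) set" where
  "L2 M = {f \<in> borel_measurable M. integrable M (\<lambda>x. (cmod (f x))\<^sup>2)}"

definition sqnorm :: "'x measure \<Rightarrow> ('x \<Rightarrow> complex) \<Rightarrow> real" where
  "sqnorm M f = (\<integral>x. (cmod (f x))\<^sup>2 \<partial>M)"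

lemma L2_measurable [measurable_dest]: "f \<in> L2 M \<Longrightarrow> f \<in> borel_measurable M"
  and L2_integrable: "f \<in> L2 M \<Longrightarrow> integrable M (\<lambda>x. (cmod (f x))\<^sup>2)"
  by (auto simp: L2_def)

lemma borel_measurable_cnj [measurable (raw)]:
  "f \<in> borel_measurable M \<Longrightarrow> (\<lambda>x. cnj (f x)) \<in> borel_measurable M"
  by (rule borel_measurable_continuous_on[OF _ ]) (auto intro: continuous_on_cnj)

lemma L2_prod_integrable:
  assumes "f \<in> L2 M" "g \<in> L2 M"
  shows "integrable M (\<lambda>x. f x * cnj (g x))"
proof (rule Bochner_Integration.integrable_bound)
  show "integrable M (\<lambda>x. (cmod (f x))\<^sup>2 + (cmod (g x))\<^sup>2)"
    using assms by (simp add: L2_integrable)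
  show "(\<lambda>x. f x * cnj (g x)) \<in> borel_measurable M"
    using L2_measurable[OF assms(1)] L2_measurable[OF assms(2)] by measurable
  show "AE x in M. norm (f x * cnj (g x)) \<le> norm ((cmod (f x))\<^sup>2 + (cmod (g x))\<^sup>2)"
  proof (intro always_eventually allI)
    fix x
    have "2 * cmod (f x) * cmod (g x) \<le> (cmod (f x))\<^sup>2 + (cmod (g x))\<^sup>2"
      by (rule sum_squares_bound)
    moreover have "0 \<le> cmod (f x) * cmod (g x)" by simp
    ultimately show "norm (f x * cnj (g x)) \<le> norm ((cmod (f x))\<^sup>2 + (cmod (g x))\<^sup>2)"
      unfolding norm_mult complex_mod_cnj real_norm_def by linarith
  qed
qed

lemma L2_lincomb:
  assumes "f \<in> L2 M" "g \<in> L2 M"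
  shows "(\<lambda>x. a * f x + b * g x) \<in> L2 M"
proof -
  have m[measurable]: "f \<in> borel_measurable M" "g \<in> borel_measurable M" using assms by (auto simp: L2_def)
  have "integrable M (\<lambda>x. (cmod (a * f x + b * g x))\<^sup>2)"
  proof (rule Bochner_Integration.integrable_bound)
    show "integrable M (\<lambda>x. 2 * (cmod a)\<^sup>2 * (cmod (f x))\<^sup>2 + 2 * (cmod b)\<^sup>2 * (cmod (g x))\<^sup>2)"
      using assms by (simp add: L2_integrable)
    show "AE x in M. norm ((cmod (a * f x + b * g x))\<^sup>2)
        \<le> norm (2 * (cmod a)\<^sup>2 * (cmod (f x))\<^sup>2 + 2 * (cmod b)\<^sup>2 * (cmod (g x))\<^sup>2)"
    proof (intro always_eventually allI)
      fix x
      let ?A = "cmod (a * f x)" and ?B = "cmod (b * g x)"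
      have "(cmod (a * f x + b * g x))\<^sup>2 \<le> (?A + ?B)\<^sup>2"
        by (intro power_mono norm_triangle_ineq) simp
      also have "\<dots> \<le> 2 * ?A\<^sup>2 + 2 * ?B\<^sup>2"
        using sum_squares_bound[of ?A ?B] by (simp add: power2_sum)
      finally show "norm ((cmod (a * f x + b * g x))\<^sup>2)
        \<le> norm (2 * (cmod a)\<^sup>2 * (cmod (f x))\<^sup>2 + 2 * (cmod b)\<^sup>2 * (cmod (g x))\<^sup>2)"
        by (simp add: norm_mult power_mult_distrib)
    qed
  qed measurable
  then show ?thesis by (simp add: L2_def)
qed

lemma L2_zero [simp]: "(\<lambda>x. 0) \<in> L2 M"
  by (simp add: L2_def)

lemma L2_scale: "f \<in> L2 M \<Longrightarrow> (\<lambda>x. a * f x) \<in> L2 M"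
  using L2_lincomb[of f M f a 0] by simp

lemma L2_add: "f \<in> L2 M \<Longrightarrow> g \<in> L2 M \<Longrightarrow> (\<lambda>x. f x + g x) \<in> L2 M"
  using L2_lincomb[of f M g 1 1] by simp

lemma L2_diff: "f \<in> L2 M \<Longrightarrow> g \<in> L2 M \<Longrightarrow> (\<lambda>x. f x - g x) \<in> L2 M"
  using L2_lincomb[of f M g 1 "-1"] by simp

lemma L2_sum: "(\<And>j. j \<in> J \<Longrightarrow> v j \<in> L2 M) \<Longrightarrow> (\<lambda>x. \<Sum>j\<in>J. v j x) \<in> L2 M"
  by (induction J rule: infinite_finite_induct) (auto intro: L2_add)

lemma L2_inner_commute: "L2_inner M g f = cnj (L2_inner M f g)"
  unfolding L2_inner_def Bochner_Integration.integral_cnj[symmetric]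
  by (simp add: mult.commute)

lemma L2_inner_lincomb:
  assumes "f \<in> L2 M" "g \<in> L2 M" "h \<in> L2 M"
  shows "L2_inner M (\<lambda>x. a * f x + b * g x) h = a * L2_inner M f h + b * L2_inner M g h"
proof -
  have "L2_inner M (\<lambda>x. a * f x + b * g x) h
      = (\<integral>x. a * (f x * cnj (h x)) + b * (g x * cnj (h x)) \<partial>M)"
    unfolding L2_inner_def by (simp add: algebra_simps)
  also have "\<dots> = a * L2_inner M f h + b * L2_inner M g h"
    unfolding L2_inner_def using assms
    by (subst Bochner_Integration.integral_add) (auto intro: L2_prod_integrable)
  finally show ?thesis .
qed

lemma L2_inner_lincomb_right:
  assumes "f \<in> L2 M" "g \<in> L2 M" "h \<in> L2 M"
  shows "L2_inner M h (\<lambda>x. a * f x + b * g x) = cnj a * L2_inner M h f + cnj b * L2_inner M h g"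
  using L2_inner_lincomb[OF assms, of a b] L2_inner_commute[of M h]
  by (metis complex_cnj_add complex_cnj_mult)

lemma L2_inner_diff:
  assumes "f \<in> L2 M" "g \<in> L2 M" "h \<in> L2 M"
  shows "L2_inner M (\<lambda>x. f x - g x) h = L2_inner M f h - L2_inner M g h"
    and "L2_inner M h (\<lambda>x. f x - g x) = L2_inner M h f - L2_inner M h g"
  using L2_inner_lincomb[OF assms, of 1 "-1"] L2_inner_lincomb_right[OF assms, of 1 "-1"] by auto

lemma L2_inner_add:
  assumes "f \<in> L2 M" "g \<in> L2 M" "h \<in> L2 M"
  shows "L2_inner M (\<lambda>x. f x + g x) h = L2_inner M f h + L2_inner M g h"
    and "L2_inner M h (\<lambda>x. f x + g x) = L2_inner M h f + L2_inner M h g"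
  using L2_inner_lincomb[OF assms, of 1 "1"] L2_inner_lincomb_right[OF assms, of 1 "1"] by auto

lemma L2_inner_zero [simp]: "L2_inner M (\<lambda>x. 0) h = 0" "L2_inner M h (\<lambda>x. 0) = 0"
  by (auto simp: L2_inner_def)

lemma L2_inner_scale:
  shows "L2_inner M (\<lambda>x. a * f x) h = a * L2_inner M f h"
    and "L2_inner M h (\<lambda>x. a * f x) = cnj a * L2_inner M h f"
  by (simp_all add: L2_inner_def mult.assoc mult.left_commute[of _ "cnj a"])

lemma L2_inner_sum:
  assumes "\<And>j. j \<in> J \<Longrightarrow> v j \<in> L2 M" "h \<in> L2 M"
  shows "L2_inner M (\<lambda>x. \<Sum>j\<in>J. v j x) h = (\<Sum>j\<in>J. L2_inner M (v j) h)"
    and "L2_inner M h (\<lambda>x. \<Sum>j\<in>J. v j x) = (\<Sum>j\<in>J. L2_inner M h (v j))"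
  using assms(1)
  by (induction J rule: infinite_finite_induct) (auto simp: L2_inner_add L2_sum assms(2))

lemma L2_inner_cong_AE:
  assumes "f \<in> borel_measurable M" "f' \<in> borel_measurable M" "g \<in> borel_measurable M" "g' \<in> borel_measurable M"
    and "AE x in M. f x = f' x" "AE x in M. g x = g' x"
  shows "L2_inner M f g = L2_inner M f' g'"
  unfolding L2_inner_def
proof (rule integral_cong_AE)
  show "AE x in M. f x * cnj (g x) = f' x * cnj (g' x)" using assms(5,6) by eventually_elim simp
next
  have [measurable]: "f \<in> borel_measurable M" "f' \<in> borel_measurable M" "g \<in> borel_measurable M"
    "g' \<in> borel_measurable M" by fact+
  show "(\<lambda>x. f x * cnj (g x)) \<in> borel_measurable M" by measurable
  show "(\<lambda>x. f' x * cnj (g' x)) \<in> borel_measurable M" by measurable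
qed

lemma L2_inner_self: "L2_inner M f f = complex_of_real (sqnorm M f)"
  unfolding L2_inner_def sqnorm_def complex_norm_square[symmetric] of_real_power[symmetric]
  by (rule integral_complex_of_real)

lemma sqnorm_nonneg [simp]: "0 \<le> sqnorm M f"
  by (simp add: sqnorm_def)

lemma sqnorm_scale: "sqnorm M (\<lambda>x. a * f x) = (cmod a)\<^sup>2 * sqnorm M f"
  by (simp add: sqnorm_def norm_mult power_mult_distrib)

lemma sqnorm_minus_commute: "sqnorm M (\<lambda>x. f x - g x) = sqnorm M (\<lambda>x. g x - f x)"
  by (simp add: sqnorm_def norm_minus_commute)

lemma sqnorm_eq_0_iff: "f \<in> L2 M \<Longrightarrow> sqnorm M f = 0 \<longleftrightarrow> (AE x in M. f x = 0)"
  unfolding sqnorm_def by (subst integral_nonneg_eq_0_iff_AE) (auto simp: L2_integrable)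

lemma sqnorm_add:
  assumes "f \<in> L2 M" "g \<in> L2 M"
  shows "sqnorm M (\<lambda>x. f x + g x) = sqnorm M f + 2 * Re (L2_inner M f g) + sqnorm M g"
proof -
  have "complex_of_real (sqnorm M (\<lambda>x. f x + g x))
      = L2_inner M f f + (L2_inner M f g + cnj (L2_inner M f g)) + L2_inner M g g"
    unfolding L2_inner_self[symmetric]
    using assms by (simp add: L2_inner_add L2_add flip: L2_inner_commute)
  then have "Re (complex_of_real (sqnorm M (\<lambda>x. f x + g x)))
      = Re (L2_inner M f f + (L2_inner M f g + cnj (L2_inner M f g)) + L2_inner M g g)"
    by simp
  then show ?thesis by (simp add: L2_inner_self)
qed

lemma sqnorm_diff:
  assumes "f \<in> L2 M" "g \<in> L2 M"
  shows "sqnorm M (\<lambda>x. f x - g x) = sqnorm M f - 2 * Re (L2_inner M f g) + sqnorm M g"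
  using sqnorm_add[OF assms(1) L2_scale[OF assms(2), of "-1"]]
    sqnorm_scale[of M "-1" g] L2_inner_scale(2)[of M f "-1" g] by simp

lemma Cauchy_Schwarz_L2:
  assumes f: "f \<in> L2 M" and g: "g \<in> L2 M"
  shows "(cmod (L2_inner M f g))\<^sup>2 \<le> sqnorm M f * sqnorm M g"
proof (cases "sqnorm M g = 0")
  case True
  then have "AE x in M. g x = 0" using g by (simp add: sqnorm_eq_0_iff)
  then have "L2_inner M f g = L2_inner M f (\<lambda>x. 0)"
    using f g by (intro L2_inner_cong_AE) (auto simp: L2_measurable)
  then show ?thesis by (simp add: True)
next
  case False
  then have pos: "sqnorm M g > 0" using sqnorm_nonneg[of M g] by linarith
  define a where "a = L2_inner M f g / sqnorm M g"
  have "0 \<le> sqnorm M (\<lambda>x. f x - a * g x)" by simp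
  also have "\<dots> = sqnorm M f - 2 * Re (cnj a * L2_inner M f g) + (cmod a)\<^sup>2 * sqnorm M g"
    using f g by (simp add: sqnorm_diff L2_scale L2_inner_scale sqnorm_scale)
  also have "cnj a * L2_inner M f g = complex_of_real ((cmod (L2_inner M f g))\<^sup>2 / sqnorm M g)"
    by (simp add: a_def complex_norm_square mult.commute del: of_real_power)
  also have "(cmod a)\<^sup>2 * sqnorm M g = (cmod (L2_inner M f g))\<^sup>2 / sqnorm M g"
    using pos by (simp add: a_def norm_divide power_divide power2_eq_square)
  finally have "(cmod (L2_inner M f g))\<^sup>2 / sqnorm M g \<le> sqnorm M f" by simp
  then show ?thesis using pos by (simp add: pos_divide_le_eq)
qed

text \<open>Gram--Schmidt: the induction adjoins one vector at a time.\<close>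
lemma orthogonal_projection_finite_span:
  assumes "finite J" "\<And>j. j \<in> J \<Longrightarrow> v j \<in> L2 M"
  shows "F \<in> L2 M \<Longrightarrow> \<exists>c. \<forall>i\<in>J. L2_inner M (\<lambda>x. F x - (\<Sum>j\<in>J. c j * v j x)) (v i) = 0"
  using assms
proof (induction J arbitrary: F rule: finite_induct)
  case empty
  then show ?case by simp
next
  case (insert k J)
  have vJ: "\<And>j. j \<in> J \<Longrightarrow> v j \<in> L2 M" and vk: "v k \<in> L2 M" using insert.prems by auto
  obtain c where c: "\<forall>i\<in>J. L2_inner M (\<lambda>x. F x - (\<Sum>j\<in>J. c j * v j x)) (v i) = 0"
    using insert.IH[OF insert.prems(1) vJ] by blast
  obtain d where d: "\<forall>i\<in>J. L2_inner M (\<lambda>x. v k x - (\<Sum>j\<in>J. d j * v j x)) (v i) = 0"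
    using insert.IH[OF vk vJ] by blast
  define G where "G = (\<lambda>x. F x - (\<Sum>j\<in>J. c j * v j x))"
  define w where "w = (\<lambda>x. v k x - (\<Sum>j\<in>J. d j * v j x))"
  define a where "a = L2_inner M G w / L2_inner M w w"
  have G: "G \<in> L2 M" and w: "w \<in> L2 M"
    unfolding G_def w_def using vJ vk insert.prems(1) by (auto intro!: L2_diff L2_sum L2_scale)
  \<comment> \<open>If \<open>w\<close> is null, then \<open>a = 0\<close> by division by zero, and Cauchy--Schwarz takes over.\<close>
  have aw: "a * L2_inner M w w = L2_inner M G w"
    using Cauchy_Schwarz_L2[OF G w] by (cases "sqnorm M w = 0") (auto simp: a_def L2_inner_self)
  define G' where "G' = (\<lambda>x. G x - a * w x)"
  have G': "G' \<in> L2 M" unfolding G'_def using G w by (intro L2_diff L2_scale)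
  have GJ: "L2_inner M G' (v i) = 0" if "i \<in> J" for i
    using c d that G w vJ unfolding G'_def
    by (simp add: L2_inner_diff L2_scale L2_inner_scale flip: G_def w_def)
  have "L2_inner M G' w = 0"
    unfolding G'_def using aw G w by (simp add: L2_inner_diff L2_scale L2_inner_scale)
  then have "L2_inner M G' (v k) = L2_inner M G' (\<lambda>x. \<Sum>j\<in>J. d j * v j x)"
    unfolding w_def using G' vk vJ by (subst (asm) L2_inner_diff) (auto intro!: L2_sum L2_scale)
  also have "\<dots> = 0"
    using G' vJ GJ by (subst L2_inner_sum) (auto simp: L2_scale L2_inner_scale)
  finally have Gk: "L2_inner M G' (v k) = 0" .
  define e where "e = (\<lambda>j. if j = k then a else c j - a * d j)"
  have "(\<Sum>j\<in>insert k J. e j * v j x) = a * v k x + (\<Sum>j\<in>J. (c j - a * d j) * v j x)" for x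
    using insert.hyps by (auto simp: e_def intro!: sum.cong)
  then have "(\<lambda>x. F x - (\<Sum>j\<in>insert k J. e j * v j x)) = G'"
    by (auto simp: G'_def G_def w_def fun_eq_iff algebra_simps sum_subtractf sum_distrib_left)
  then show ?case using GJ Gk by (intro exI[of _ e]) auto
qed

text \<open>
  Riesz--Fischer. Along a rapidly Cauchy subsequence the increments \<open>g\<^sub>j\<close> satisfy
  \<open>\<integral> \<Sum>\<^sub>j 2\<^sup>j g\<^sub>j\<^sup>2 < \<infinity>\<close>, and \<open>2 g\<^sub>j \<le> 2\<^sup>-\<^sup>j + 2\<^sup>j g\<^sub>j\<^sup>2\<close>, hence the subsequence converges almost
  everywhere; Fatou's lemma turns this into convergence in the mean. The limit is given by an
  explicit formula, so that it inherits symmetries that hold at every point.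
\<close>
lemma Riesz_Fischer:
  assumes S: "\<And>n. S n \<in> L2 M"
    and Cau: "\<And>e. e > 0 \<Longrightarrow> \<exists>N. \<forall>m\<ge>N. \<forall>n\<ge>N. sqnorm M (\<lambda>x. S m x - S n x) < e"
  obtains r :: "nat \<Rightarrow> nat" where
    "(\<lambda>x. if Cauchy (\<lambda>j. S (r j) x) then lim (\<lambda>j. S (r j) x) else 0) \<in> L2 M"
    "(\<lambda>n. sqnorm M (\<lambda>x. (if Cauchy (\<lambda>j. S (r j) x) then lim (\<lambda>j. S (r j) x) else 0) - S n x)) \<longlonglongrightarrow> 0"
proof -
  have "\<forall>j. \<exists>N. \<forall>m\<ge>N. \<forall>n\<ge>N. sqnorm M (\<lambda>x. S m x - S n x) < (1/4) ^ j"
    using Cau by simp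
  then obtain N where N: "\<And>j m n. m \<ge> N j \<Longrightarrow> n \<ge> N j \<Longrightarrow> sqnorm M (\<lambda>x. S m x - S n x) < (1/4) ^ j"
    by metis
  \<comment> \<open>Taking sums makes \<open>r j\<close> a bound for all the \<open>N i\<close> with \<open>i \<le> j\<close>.\<close>
  define r where "r j = (\<Sum>i\<le>j. N i)" for j
  have rN: "r j \<ge> N i" if "i \<le> j" for i j
    unfolding r_def using that by (intro member_le_sum) auto
  define F where "F = (\<lambda>x. if Cauchy (\<lambda>j. S (r j) x) then lim (\<lambda>j. S (r j) x) else 0)"
  define g where "g j x = cmod (S (r (Suc j)) x - S (r j) x)" for j x
  have [measurable]: "S n \<in> borel_measurable M" for n using S by (auto simp: L2_def)
  have [measurable]: "g j \<in> borel_measurable M" for j unfolding g_def by measurable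
  have [measurable]: "F \<in> borel_measurable M" unfolding F_def by measurable
  have gint: "(\<integral>\<^sup>+x. ennreal (2 ^ j * (g j x)\<^sup>2) \<partial>M) \<le> ennreal ((1/2) ^ j)" for j
  proof -
    have "integrable M (\<lambda>x. (g j x)\<^sup>2)" unfolding g_def
      using L2_integrable[OF L2_diff[OF S S]] by simp
    then have "(\<integral>\<^sup>+x. ennreal (2 ^ j * (g j x)\<^sup>2) \<partial>M) = ennreal (2 ^ j * (\<integral>x. (g j x)\<^sup>2 \<partial>M))"
      by (subst nn_integral_eq_integral) auto
    also have "(\<integral>x. (g j x)\<^sup>2 \<partial>M) \<le> (1/4) ^ j"
      using N[OF rN[of j "Suc j"] rN[of j j]] by (simp add: g_def sqnorm_def)
    then have "2 ^ j * (\<integral>x. (g j x)\<^sup>2 \<partial>M) \<le> 2 ^ j * (1/4) ^ j" by simp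
    also have "2 ^ j * (1/4) ^ j = (1/2 :: real) ^ j" by (simp flip: power_mult_distrib)
    finally show ?thesis by (simp add: ennreal_leI)
  qed
  have "(\<integral>\<^sup>+x. (\<Sum>j. ennreal (2 ^ j * (g j x)\<^sup>2)) \<partial>M) = (\<Sum>j. \<integral>\<^sup>+x. ennreal (2 ^ j * (g j x)\<^sup>2) \<partial>M)"
    by (rule nn_integral_suminf) measurable
  also have "\<dots> \<le> (\<Sum>j. ennreal ((1/2) ^ j))"
    by (intro suminf_le gint) auto
  also have "\<dots> = ennreal 2"
    using power_half_series geometric_sums[of "1/2::real"] by (intro suminf_ennreal_eq) auto
  finally have "(\<integral>\<^sup>+x. (\<Sum>j. ennreal (2 ^ j * (g j x)\<^sup>2)) \<partial>M) \<noteq> \<infinity>"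
    by (auto simp: top_unique)
  then have "AE x in M. (\<Sum>j. ennreal (2 ^ j * (g j x)\<^sup>2)) \<noteq> \<infinity>"
    by (intro nn_integral_PInf_AE) measurable
  then have AEc: "AE x in M. (\<lambda>i. S (r i) x) \<longlonglongrightarrow> F x"
  proof eventually_elim
    case (elim x)
    have s: "summable (\<lambda>j. 2 ^ j * (g j x)\<^sup>2)"
      using elim by (intro summable_suminf_not_top) auto
    have "summable (\<lambda>j. (1/2) ^ j + 2 ^ j * (g j x)\<^sup>2)"
      by (intro summable_add s summable_geometric) simp
    moreover have "norm (g j x) \<le> (1/2) ^ j + 2 ^ j * (g j x)\<^sup>2" for j
    proof -
      have "2 * g j x = 2 * 1 * (2 ^ j * g j x) / 2 ^ j" by simp
      also have "\<dots> \<le> (1\<^sup>2 + (2 ^ j * g j x)\<^sup>2) / 2 ^ j"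
        by (intro divide_right_mono sum_squares_bound) simp
      also have "\<dots> = (1/2) ^ j + 2 ^ j * (g j x)\<^sup>2"
        by (simp add: field_simps power2_eq_square)
      finally have "2 * g j x \<le> (1/2) ^ j + 2 ^ j * (g j x)\<^sup>2" .
      moreover have "0 \<le> g j x" by (simp add: g_def)
      ultimately show ?thesis by simp
    qed
    ultimately have "summable (\<lambda>j. g j x)"
      by (intro summable_comparison_test[of "\<lambda>j. g j x"]) auto
    then have "summable (\<lambda>j. S (r (Suc j)) x - S (r j) x)"
      unfolding g_def by (rule summable_norm_cancel)
    then have "convergent (\<lambda>n. \<Sum>j<n. S (r (Suc j)) x - S (r j) x)"
      by (simp add: summable_iff_convergent)
    then have "convergent (\<lambda>n. (S (r n) x - S (r 0) x) + S (r 0) x)"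
      unfolding sum_lessThan_telescope[of "\<lambda>n. S (r n) x"] by (intro convergent_add convergent_const)
    then have "convergent (\<lambda>n. S (r n) x)" by simp
    then show ?case
      by (simp add: F_def Cauchy_convergent_iff convergent_LIMSEQ_iff)
  qed
  have Fatou: "(\<integral>\<^sup>+x. ennreal ((cmod (F x - S n x))\<^sup>2) \<partial>M) \<le> ennreal ((1/4) ^ j)" if n: "n \<ge> r j" for n j
  proof -
    have "(\<integral>\<^sup>+x. ennreal ((cmod (F x - S n x))\<^sup>2) \<partial>M)
        = (\<integral>\<^sup>+x. liminf (\<lambda>i. ennreal ((cmod (S (r i) x - S n x))\<^sup>2)) \<partial>M)"
    proof (rule nn_integral_cong_AE)
      show "AE x in M. ennreal ((cmod (F x - S n x))\<^sup>2) = liminf (\<lambda>i. ennreal ((cmod (S (r i) x - S n x))\<^sup>2))"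
        using AEc
      proof eventually_elim
        case (elim x)
        have "(\<lambda>i. ennreal ((cmod (S (r i) x - S n x))\<^sup>2)) \<longlonglongrightarrow> ennreal ((cmod (F x - S n x))\<^sup>2)"
          by (intro tendsto_ennrealI tendsto_power tendsto_norm tendsto_diff elim tendsto_const)
        then show ?case by (intro lim_imp_Liminf[symmetric]) auto
      qed
    qed
    also have "\<dots> \<le> liminf (\<lambda>i. \<integral>\<^sup>+x. ennreal ((cmod (S (r i) x - S n x))\<^sup>2) \<partial>M)"
      by (rule nn_integral_liminf) measurable
    also have "\<dots> \<le> limsup (\<lambda>i. \<integral>\<^sup>+x. ennreal ((cmod (S (r i) x - S n x))\<^sup>2) \<partial>M)"
      by (rule Liminf_le_Limsup) simp
    also have "\<dots> \<le> ennreal ((1/4) ^ j)"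
    proof (rule Limsup_bounded)
      show "\<forall>\<^sub>F i in sequentially. (\<integral>\<^sup>+x. ennreal ((cmod (S (r i) x - S n x))\<^sup>2) \<partial>M) \<le> ennreal ((1/4) ^ j)"
        using eventually_ge_at_top[of j]
      proof eventually_elim
        case (elim i)
        have "sqnorm M (\<lambda>x. S (r i) x - S n x) \<le> (1/4) ^ j"
          using N[OF rN[OF elim] order_trans[OF rN[of j j] n]] by simp
        then show ?case
          using L2_integrable[OF L2_diff[OF S S]]
          by (subst nn_integral_eq_integral) (auto simp: sqnorm_def intro!: ennreal_leI)
      qed
    qed
    finally show ?thesis .
  qed
  have d: "(\<lambda>x. F x - S n x) \<in> L2 M \<and> sqnorm M (\<lambda>x. F x - S n x) \<le> (1/4) ^ j" if n: "n \<ge> r j" for n j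
  proof -
    have "integrable M (\<lambda>x. (cmod (F x - S n x))\<^sup>2)"
      using Fatou[OF n] by (intro integrableI_bounded) (auto simp: top_unique less_top[symmetric] le_less_trans)
    moreover from this have "sqnorm M (\<lambda>x. F x - S n x) \<le> (1/4) ^ j"
      using Fatou[OF n] by (subst (asm) nn_integral_eq_integral) (auto simp: sqnorm_def)
    ultimately show ?thesis by (auto simp: L2_def)
  qed
  have "F \<in> L2 M"
    using L2_add[OF conjunct1[OF d[of 0 "r 0"]] S[of "r 0"]] by simp
  moreover have "(\<lambda>n. sqnorm M (\<lambda>x. F x - S n x)) \<longlonglongrightarrow> 0"
  proof (rule LIMSEQ_I)
    fix e :: real assume "e > 0"
    then obtain j where j: "(1/4) ^ j < e"
      using real_arch_pow_inv[of e "1/4"] by auto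
    then show "\<exists>n0. \<forall>n\<ge>n0. norm (sqnorm M (\<lambda>x. F x - S n x) - 0) < e"
      using d[of j] by (intro exI[of _ "r j"]) force
  qed
  ultimately show thesis using that[of r] unfolding F_def by blast
qed

text \<open>
  The inner product is continuous in the mean, by the Cauchy--Schwarz inequality.
\<close>
lemma L2_inner_tendsto:
  assumes S: "\<And>n. S n \<in> L2 M" and F: "F \<in> L2 M" and q: "q \<in> L2 M"
    and lim: "(\<lambda>n. sqnorm M (\<lambda>x. F x - S n x)) \<longlonglongrightarrow> 0"
  shows "(\<lambda>n. L2_inner M (S n) q) \<longlonglongrightarrow> L2_inner M F q"
proof -
  have "(\<lambda>n. (cmod (L2_inner M F q - L2_inner M (S n) q))\<^sup>2) \<longlonglongrightarrow> 0"
  proof (rule tendsto_sandwich[of "\<lambda>_. 0"])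
    show "(\<lambda>n. sqnorm M (\<lambda>x. F x - S n x) * sqnorm M q) \<longlonglongrightarrow> 0"
      using tendsto_mult_right[OF lim, of "sqnorm M q"] by simp
    show "\<forall>\<^sub>F n in sequentially. (cmod (L2_inner M F q - L2_inner M (S n) q))\<^sup>2
        \<le> sqnorm M (\<lambda>x. F x - S n x) * sqnorm M q"
      using Cauchy_Schwarz_L2[OF L2_diff[OF F S] q] by (simp add: L2_inner_diff F S q)
  qed auto
  then have "(\<lambda>n. L2_inner M F q - L2_inner M (S n) q) \<longlonglongrightarrow> 0"
    using tendsto_norm_zero_iff[of "\<lambda>n. L2_inner M F q - L2_inner M (S n) q"]
      tendsto_real_sqrt[of "\<lambda>n. (cmod (L2_inner M F q - L2_inner M (S n) q))\<^sup>2" 0] by simp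
  from tendsto_diff[OF tendsto_const[of "L2_inner M F q"] this] show ?thesis by simp
qed

lemma sqnorm_tendsto:
  assumes S: "\<And>n. S n \<in> L2 M" and F: "F \<in> L2 M"
    and lim: "(\<lambda>n. sqnorm M (\<lambda>x. F x - S n x)) \<longlonglongrightarrow> 0"
  shows "(\<lambda>n. sqnorm M (S n)) \<longlonglongrightarrow> sqnorm M F"
proof -
  have "sqnorm M (S n) = sqnorm M (\<lambda>x. F x - S n x) + 2 * Re (L2_inner M (S n) F) - sqnorm M F" for n
    using sqnorm_diff[OF F S[of n]] L2_inner_commute[of M "S n" F] by simp
  moreover have "(\<lambda>n. sqnorm M (\<lambda>x. F x - S n x) + 2 * Re (L2_inner M (S n) F) - sqnorm M F)
      \<longlonglongrightarrow> 0 + 2 * Re (L2_inner M F F) - sqnorm M F"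
    by (intro tendsto_intros lim L2_inner_tendsto S F)
  ultimately show ?thesis by (simp add: L2_inner_self)
qed

lemma sqnorm_orthogonal_sum:
  assumes "finite J" "\<And>j. j \<in> J \<Longrightarrow> v j \<in> L2 M"
    and "\<And>i j. i \<in> J \<Longrightarrow> j \<in> J \<Longrightarrow> i \<noteq> j \<Longrightarrow> L2_inner M (v i) (v j) = 0"
  shows "sqnorm M (\<lambda>x. \<Sum>j\<in>J. v j x) = (\<Sum>j\<in>J. sqnorm M (v j))"
  using assms
proof (induction J rule: finite_induct)
  case empty
  then show ?case by (simp add: sqnorm_def)
next
  case (insert k J)
  have "L2_inner M (v k) (\<lambda>x. \<Sum>j\<in>J. v j x) = (\<Sum>j\<in>J. L2_inner M (v k) (v j))"
    using insert.prems by (intro L2_inner_sum) auto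
  also have "\<dots> = 0" using insert by (intro sum.neutral) auto
  finally show ?case using insert
    by (simp add: sqnorm_add L2_sum)
qed

text \<open>
  The partial sums are Cauchy by Pythagoras, so the Riesz--Fischer theorem applies to them.
\<close>
lemma orthogonal_series_converges:
  assumes v: "\<And>m. v m \<in> L2 M" and orth: "\<And>i j. i \<noteq> j \<Longrightarrow> L2_inner M (v i) (v j) = 0"
    and sm: "summable (\<lambda>m. sqnorm M (v m))"
  defines "S \<equiv> \<lambda>n x. \<Sum>m<n. v m x"
  obtains r :: "nat \<Rightarrow> nat" where
    "(\<lambda>x. if Cauchy (\<lambda>j. S (r j) x) then lim (\<lambda>j. S (r j) x) else 0) \<in> L2 M"
    "(\<lambda>n. sqnorm M (\<lambda>x. (if Cauchy (\<lambda>j. S (r j) x) then lim (\<lambda>j. S (r j) x) else 0) - S n x)) \<longlonglongrightarrow> 0"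
proof (rule Riesz_Fischer[of S M])
  show "S n \<in> L2 M" for n unfolding S_def using v by (intro L2_sum)
  fix e :: real assume "e > 0"
  then obtain N where N: "\<And>m n. m \<ge> N \<Longrightarrow> norm (\<Sum>i\<in>{m..<n}. sqnorm M (v i)) < e"
    using sm unfolding summable_Cauchy by blast
  have *: "sqnorm M (\<lambda>x. S m x - S n x) < e" if "N \<le> n" "n \<le> m" for m n
  proof -
    have "S m x - S n x = (\<Sum>i\<in>{n..<m}. v i x)" for x
      unfolding S_def using sum_diff_nat_ivl[of 0 n m "\<lambda>i. v i x"] that by (simp add: atLeast0LessThan)
    then have "sqnorm M (\<lambda>x. S m x - S n x) = (\<Sum>i\<in>{n..<m}. sqnorm M (v i))"
      using v orth by (simp add: sqnorm_orthogonal_sum)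
    then show ?thesis using N[OF that(1), of m] by simp
  qed
  show "\<exists>N. \<forall>m\<ge>N. \<forall>n\<ge>N. sqnorm M (\<lambda>x. S m x - S n x) < e"
  proof (intro exI[of _ N] allI impI)
    fix m n assume "N \<le> m" "N \<le> n"
    then show "sqnorm M (\<lambda>x. S m x - S n x) < e"
      using *[of n m] *[of m n] sqnorm_minus_commute[of M "S m" "S n"] by (cases "n \<le> m") auto
  qed
qed

section \<open>The rotation invariant measure on the sphere\<close>

lemma open_emeasure_lborel_pos:
  assumes "open U" "U \<noteq> {}"
  shows "emeasure lborel U > 0"
proof (rule ccontr)
  assume "\<not> ?thesis"
  then have "U \<in> null_sets lborel" using assms by (auto simp: null_sets_def)
  then show False using open_not_negligible[OF assms] by (auto simp: negligible_iff_null_sets null_sets_completionI)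
qed

text \<open>
  For a translation invariant measure \<open>\<nu>\<close> and the unit ball \<open>B\<close>, evaluating
  \<open>\<integral>\<integral> 1\<^sub>A(x) 1\<^sub>B(x - y)\<close> in both orders gives \<open>\<nu>(A) |B| = \<nu>(B) |A|\<close>.
\<close>
lemma translation_invariant_eq_lborel:
  fixes \<nu> :: "'a::euclidean_space measure"
  assumes sets: "sets \<nu> = sets borel" and sf: "sigma_finite_measure \<nu>"
    and inv: "\<And>c. distr \<nu> borel ((+) c) = \<nu>"
    and ball: "emeasure \<nu> (ball 0 1) = emeasure lborel (ball (0::'a) 1)"
  shows "\<nu> = lborel"
proof (rule measure_eqI)
  fix A assume "A \<in> sets \<nu>"
  then have A[measurable]: "A \<in> sets borel" by (simp add: sets)
  note sets[measurable_cong]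
  have sp: "space \<nu> = UNIV" using sets_eq_imp_space_eq[OF sets] by simp
  interpret \<nu>: sigma_finite_measure \<nu> by fact
  interpret P: pair_sigma_finite \<nu> lborel ..
  interpret Q: pair_sigma_finite lborel \<nu> ..
  define B where "B = ball (0::'a) 1"
  have B[measurable]: "B \<in> sets borel" by (simp add: B_def)
  have "emeasure \<nu> A * emeasure lborel B
      = (\<integral>\<^sup>+x. \<integral>\<^sup>+y. indicator A x * indicator B (x - y) \<partial>lborel \<partial>\<nu>)"
  proof -
    have "(\<integral>\<^sup>+y. indicator A x * indicator B (x - y) \<partial>lborel)
        = indicator A x * emeasure lborel B" for x
    proof -
      have "(\<lambda>y. indicator A x * indicator B (x - y) :: ennreal) = (\<lambda>y. indicator A x * indicator (ball x 1) y)"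
        by (auto simp: fun_eq_iff dist_norm indicator_def norm_minus_commute B_def)
      then have "(\<integral>\<^sup>+y. indicator A x * indicator B (x - y) \<partial>lborel) = indicator A x * emeasure lborel (ball x 1)"
        by (simp add: nn_integral_cmult_indicator)
      also have "emeasure lborel (ball x 1) = emeasure lborel ((+) x -` ball x 1 \<inter> space lborel)"
        by (subst lborel_distr_plus[of x, symmetric]) (subst emeasure_distr, auto)
      also have "(+) x -` ball x 1 \<inter> space lborel = B"
        by (auto simp: dist_norm B_def)
      finally show ?thesis .
    qed
    then show ?thesis by (simp add: nn_integral_multc sets mult.commute)
  qed
  also have "\<dots> = (\<integral>\<^sup>+y. \<integral>\<^sup>+x. indicator A x * indicator B (x - y) \<partial>\<nu> \<partial>lborel)"
    by (rule P.Fubini'[symmetric]) measurable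
  also have "\<dots> = (\<integral>\<^sup>+y. \<integral>\<^sup>+x. indicator A (y + x) * indicator B x \<partial>\<nu> \<partial>lborel)"
  proof (rule nn_integral_cong)
    fix y
    have "(\<integral>\<^sup>+x. indicator A x * indicator B (x - y) \<partial>\<nu>)
        = (\<integral>\<^sup>+x. indicator A x * indicator B (x - y) \<partial>distr \<nu> borel ((+) y))"
      by (simp add: inv)
    also have "\<dots> = (\<integral>\<^sup>+x. indicator A (y + x) * indicator B x \<partial>\<nu>)"
      by (subst nn_integral_distr) auto
    finally show "(\<integral>\<^sup>+x. indicator A x * indicator B (x - y) \<partial>\<nu>)
        = (\<integral>\<^sup>+x. indicator A (y + x) * indicator B x \<partial>\<nu>)" .
  qed
  also have "\<dots> = (\<integral>\<^sup>+x. \<integral>\<^sup>+y. indicator A (y + x) * indicator B x \<partial>lborel \<partial>\<nu>)"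
    by (rule P.Fubini') measurable
  also have "\<dots> = (\<integral>\<^sup>+x. emeasure lborel A * indicator B x \<partial>\<nu>)"
  proof (rule nn_integral_cong)
    fix x
    have "(\<integral>\<^sup>+y. indicator A (y + x) \<partial>lborel) = (\<integral>\<^sup>+y. indicator A y \<partial>distr lborel borel ((+) x))"
      by (subst nn_integral_distr) (auto simp: add.commute)
    then have "(\<integral>\<^sup>+y. indicator A (y + x) \<partial>lborel) = emeasure lborel A"
      by (simp add: lborel_distr_plus)
    then show "(\<integral>\<^sup>+y. indicator A (y + x) * indicator B x \<partial>lborel) = emeasure lborel A * indicator B x"
      by (subst nn_integral_multc) auto
  qed
  also have "\<dots> = emeasure lborel A * emeasure \<nu> B"
    by (subst nn_integral_cmult) (auto simp: sets)
  finally have eq: "emeasure \<nu> A * emeasure lborel B = emeasure lborel A * emeasure lborel B"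
    using ball by (simp add: B_def)
  have "emeasure lborel B \<noteq> \<infinity>"
    using emeasure_lborel_ball_finite[of 0 1] by (auto simp: B_def less_top)
  moreover have "emeasure lborel B \<noteq> 0"
    using open_emeasure_lborel_pos[of B] by (auto simp: B_def)
  ultimately show "emeasure \<nu> A = emeasure lborel A" using eq
    by (simp add: mult.commute[of _ "emeasure lborel B"] ennreal_mult_cancel_left)
qed (simp add: sets)

lemma lborel_orthogonal_invariant:
  fixes g :: "'a::euclidean_space \<Rightarrow> 'a"
  assumes g: "orthogonal_transformation g"
  shows "distr lborel borel g = lborel"
proof (rule translation_invariant_eq_lborel)
  have lin: "linear g" and ng: "\<And>x. norm (g x) = norm x" and surj: "surj g"
    using g by (auto simp: orthogonal_transformation orthogonal_transformation_surj)
  have [measurable]: "g \<in> borel_measurable borel"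
    using linear_continuous_on[of g UNIV] lin by (intro borel_measurable_continuous_onI) (auto simp: linear_linear)
  have ball: "emeasure (distr lborel borel g) (ball 0 r) = emeasure lborel (ball (0::'a) r)" for r
  proof -
    have "g -` ball 0 r = ball 0 r" by (auto simp: dist_norm ng)
    then show ?thesis by (subst emeasure_distr) auto
  qed
  show "emeasure (distr lborel borel g) (ball 0 1) = emeasure lborel (ball (0::'a) 1)" by (rule ball)
  show "sigma_finite_measure (distr lborel borel g)"
  proof
    have "(\<Union>n. ball 0 (real n)) = (UNIV :: 'a set)"
      using reals_Archimedean2 by (auto simp: dist_norm)
    then show "\<exists>A. countable A \<and> A \<subseteq> sets (distr lborel borel g) \<and> \<Union>A = space (distr lborel borel g)
        \<and> (\<forall>a\<in>A. emeasure (distr lborel borel g) a \<noteq> \<infinity>)"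
      using emeasure_lborel_ball_finite
      by (intro exI[of _ "range (\<lambda>n. ball 0 (real n))"]) (auto simp: ball less_top[symmetric])
  qed
  fix c
  obtain d where d: "c = g d" using surj by (metis surj_def)
  have "distr (distr lborel borel g) borel ((+) c) = distr lborel borel (\<lambda>x. g (d + x))"
    using lin by (subst distr_distr) (auto simp: o_def d linear_add)
  also have "\<dots> = distr (distr lborel borel ((+) d)) borel g"
    by (subst distr_distr) (auto simp: o_def)
  finally show "distr (distr lborel borel g) borel ((+) c) = distr lborel borel g"
    by (simp add: lborel_distr_plus)
qed simp

lemma sgn_measurable [measurable]: "(sgn :: 'a::euclidean_space \<Rightarrow> 'a) \<in> borel_measurable borel"
  unfolding sgn_div_norm[abs_def] by measurable

lemma sets_sphere_measure [simp, measurable_cong]: "sets sphere_measure = sets borel"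
  and space_sphere_measure [simp]: "space sphere_measure = UNIV"
  by (auto simp: sphere_measure_def)

lemma emeasure_unit_ball:
  "emeasure lborel (ball (0::'a::euclidean_space) 1) \<noteq> 0" "emeasure lborel (ball (0::'a) 1) \<noteq> \<infinity>"
  using open_emeasure_lborel_pos[of "ball (0::'a) 1"] emeasure_lborel_ball_finite[of "0::'a" 1]
  by (auto simp: less_top)

lemma emeasure_sphere_measure:
  fixes A :: "'a::euclidean_space set"
  assumes [measurable]: "A \<in> sets borel"
  shows "emeasure sphere_measure A
    = emeasure lborel (ball 0 1 \<inter> sgn -` A) / emeasure lborel (ball (0::'a::euclidean_space) 1)"
  unfolding sphere_measure_def
  by (subst emeasure_distr) (auto simp: emeasure_uniform_measure measurable_sets_borel[OF sgn_measurable])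

interpretation sphere_measure: finite_measure "sphere_measure :: 'a::euclidean_space measure"
  by standard (use emeasure_unit_ball in \<open>simp add: emeasure_sphere_measure ennreal_divide_eq_top_iff\<close>)

lemma AE_sphere_measure: "AE z in (sphere_measure :: 'a::euclidean_space measure). norm z = 1"
proof (rule AE_I)
  show "{z \<in> space sphere_measure. norm z \<noteq> 1} \<subseteq> - sphere (0::'a) 1" by auto
  have "ball 0 1 \<inter> sgn -` (- sphere (0::'a) 1) \<subseteq> {0}"
    by (auto simp: norm_sgn split: if_splits)
  then have "emeasure lborel (ball 0 1 \<inter> sgn -` (- sphere (0::'a) 1)) \<le> emeasure lborel {0::'a}"
    by (intro emeasure_mono) auto
  then show "emeasure sphere_measure (- sphere (0::'a) 1) = 0"
    by (simp add: emeasure_sphere_measure)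
qed auto

text \<open>
  Orthogonal maps preserve Lebesgue measure and the ball, and commute with the radial projection.
\<close>
lemma sphere_measure_orthogonal_invariant:
  fixes g :: "'a::euclidean_space \<Rightarrow> 'a"
  assumes g: "orthogonal_transformation g"
  shows "distr sphere_measure borel g = sphere_measure"
proof (rule measure_eqI)
  have lin: "linear g" and ng: "\<And>x. norm (g x) = norm x"
    using g by (auto simp: orthogonal_transformation)
  have [measurable]: "g \<in> borel_measurable borel"
    using linear_continuous_on[of g UNIV] lin by (intro borel_measurable_continuous_onI) (auto simp: linear_linear)
  fix A assume "A \<in> sets (distr sphere_measure borel g)"
  then have A[measurable]: "A \<in> sets borel" by simp
  have gA[measurable]: "g -` A \<in> sets borel" by (rule measurable_sets_borel[of _ borel]) auto
  have "emeasure lborel (ball 0 1 \<inter> sgn -` A) = emeasure lborel (g -` (ball 0 1 \<inter> sgn -` A) \<inter> space lborel)"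
    by (subst lborel_orthogonal_invariant[OF g, symmetric], subst emeasure_distr)
       (auto simp: measurable_sets_borel[OF sgn_measurable])
  also have "g -` (ball 0 1 \<inter> sgn -` A) \<inter> space lborel = ball 0 1 \<inter> sgn -` (g -` A)"
    by (auto simp: ng sgn_div_norm linear_cmul[OF lin])
  finally show "emeasure (distr sphere_measure borel g) A = emeasure sphere_measure A"
    by (subst emeasure_distr) (auto simp: emeasure_sphere_measure)
qed simp

text \<open>
  The cone over a relatively open part of the sphere is open, hence not a null set.
\<close>
lemma sphere_measure_open_pos:
  fixes U :: "'a::euclidean_space set"
  assumes "open U" "z \<in> U" "norm z = 1"
  shows "emeasure sphere_measure U > 0"
proof -
  let ?V = "ball 0 1 \<inter> (sgn -` U \<inter> - {0}) :: 'a set"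
  have "continuous_on (- {0}) (sgn :: 'a \<Rightarrow> 'a)"
    by (intro continuous_intros) auto
  then have "open (sgn -` U \<inter> - {0})"
    using assms(1) by (subst (asm) continuous_on_open_vimage) auto
  then have "open ?V" by blast
  moreover have "(1/2) *\<^sub>R z \<in> ?V"
    using assms by (auto simp: sgn_div_norm)
  ultimately have "0 < emeasure lborel ?V" by (intro open_emeasure_lborel_pos) blast+
  also have "\<dots> \<le> emeasure lborel (ball 0 1 \<inter> sgn -` U)"
    using assms by (intro emeasure_mono) (auto simp: measurable_sets_borel[OF sgn_measurable])
  finally show ?thesis using emeasure_unit_ball[where 'a='a] assms
    by (auto simp: emeasure_sphere_measure ennreal_zero_less_divide less_top)
qed

abbreviation "L2_sphere \<equiv> L2 sphere_measure"
abbreviation "sphere_inner \<equiv> L2_inner sphere_measure"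
abbreviation "sphere_sqnorm \<equiv> sqnorm sphere_measure"

lemma continuous_L2_sphere:
  fixes f :: "'a::euclidean_space \<Rightarrow> complex"
  assumes f: "continuous_on UNIV f"
  shows "f \<in> L2_sphere"
proof -
  have [measurable]: "f \<in> borel_measurable borel" using f by (rule borel_measurable_continuous_onI)
  have "compact (f ` sphere 0 1)"
    by (intro compact_continuous_image continuous_on_subset[OF f]) auto
  from compact_imp_bounded[OF this] obtain B where "\<forall>w\<in>f ` sphere 0 1. cmod w \<le> B"
    unfolding bounded_iff by blast
  then have B: "\<And>z. norm z = 1 \<Longrightarrow> cmod (f z) \<le> B" by auto
  have "integrable sphere_measure (\<lambda>x. (cmod (f x))\<^sup>2)"
  proof (rule sphere_measure.integrable_const_bound)
    show "AE x in sphere_measure. norm ((cmod (f x))\<^sup>2) \<le> B\<^sup>2"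
      using AE_sphere_measure by eventually_elim (auto intro!: power_mono B)
  qed measurable
  then show ?thesis by (simp add: L2_def)
qed

lemma continuous_sqnorm_sphere_zeroD:
  fixes f :: "'a::euclidean_space \<Rightarrow> complex"
  assumes f: "continuous_on UNIV f" and "sphere_sqnorm f = 0" and z: "norm z = 1"
  shows "f z = 0"
proof (rule ccontr)
  assume nz: "f z \<noteq> 0"
  have op: "open {w. f w \<noteq> 0}"
    using f by (intro open_Collect_neq) auto
  have "AE x in sphere_measure. f x = 0"
    using assms continuous_L2_sphere[OF f] by (simp add: sqnorm_eq_0_iff)
  then have "emeasure sphere_measure {w. f w \<noteq> 0} = 0"
    using op by (subst (asm) AE_iff_measurable[of "{w. f w \<noteq> 0}"]) auto
  then show False using sphere_measure_open_pos[OF op _ z] nz by auto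
qed

lemma L2_inner_sphere_cong:
  fixes f g f' g' :: "'a::euclidean_space \<Rightarrow> complex"
  assumes "f \<in> borel_measurable borel" "f' \<in> borel_measurable borel"
    "g \<in> borel_measurable borel" "g' \<in> borel_measurable borel"
    and "\<And>z. norm z = 1 \<Longrightarrow> f z = f' z" "\<And>z. norm z = 1 \<Longrightarrow> g z = g' z"
  shows "sphere_inner f g = sphere_inner f' g'"
  using assms AE_sphere_measure by (intro L2_inner_cong_AE) (auto elim!: eventually_mono)

section \<open>Bihomogeneous polynomials\<close>

text \<open>
  An inductive description of the polynomials of bidegree \<open>(a, b)\<close>. Products, linear substitutions and
  derivatives are then treated by induction, without a calculation with coefficients; the
  comparison with the coefficient description is \<open>bihomogeneous_eq\<close>.
\<close>
inductive bihom :: "nat \<Rightarrow> nat \<Rightarrow> (complex^'n \<Rightarrow> complex) \<Rightarrow> bool" where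
  bihom_const: "bihom 0 0 (\<lambda>z. c)"
| bihom_zmul: "bihom a b f \<Longrightarrow> bihom (Suc a) b (\<lambda>z. z $ i * f z)"
| bihom_cmul: "bihom a b f \<Longrightarrow> bihom a (Suc b) (\<lambda>z. cnj (z $ i) * f z)"
| bihom_add: "bihom a b f \<Longrightarrow> bihom a b g \<Longrightarrow> bihom a b (\<lambda>z. f z + g z)"

text \<open>
  Polynomials in the coordinates and their conjugates, of no particular bidegree.
\<close>
inductive polyf :: "(complex^'n \<Rightarrow> complex) \<Rightarrow> bool" where
  polyf_const: "polyf (\<lambda>z. c)"
| polyf_zmul: "polyf f \<Longrightarrow> polyf (\<lambda>z. z $ i * f z)"
| polyf_cmul: "polyf f \<Longrightarrow> polyf (\<lambda>z. cnj (z $ i) * f z)"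
| polyf_add: "polyf f \<Longrightarrow> polyf g \<Longrightarrow> polyf (\<lambda>z. f z + g z)"

lemma bihom_imp_polyf: "bihom a b f \<Longrightarrow> polyf f"
  by (induction rule: bihom.induct) (auto intro: polyf.intros)

lemma bihom_scale: "bihom a b f \<Longrightarrow> bihom a b (\<lambda>z. c * f z)"
proof (induction rule: bihom.induct)
  case (bihom_zmul a b f i)
  from bihom.bihom_zmul[OF bihom_zmul.IH, of i] show ?case by (simp add: mult.left_commute)
next
  case (bihom_cmul a b f i)
  from bihom.bihom_cmul[OF bihom_cmul.IH, of i] show ?case by (simp add: mult.left_commute)
next
  case (bihom_add a b f g)
  from bihom.bihom_add[OF bihom_add.IH] show ?case by (simp add: distrib_left)
qed (rule bihom_const)

lemma bihom_zero: "bihom a b (\<lambda>z :: complex^'n. 0)"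
proof -
  have "bihom a 0 (\<lambda>z :: complex^'n. 0)"
  proof (induction a)
    case (Suc a)
    from bihom_zmul[OF Suc] show ?case by simp
  qed (rule bihom_const)
  then show ?thesis
  proof (induction b)
    case (Suc b)
    from bihom_cmul[OF Suc.IH[OF Suc.prems]] show ?case by simp
  qed simp
qed

lemma bihom_sum: "(\<And>j. j \<in> J \<Longrightarrow> bihom a b (f j)) \<Longrightarrow> bihom a b (\<lambda>z. \<Sum>j\<in>J. f j z)"
  by (induction J rule: infinite_finite_induct) (auto intro: bihom_zero bihom_add)

lemma bihom_diff: "bihom a b f \<Longrightarrow> bihom a b g \<Longrightarrow> bihom a b (\<lambda>z. f z - g z)"
  using bihom_add[of a b f "\<lambda>z. -1 * g z"] bihom_scale[of a b g "-1"] by simp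

lemma bihom_mult:
  assumes g: "bihom c d g"
  shows "bihom a b f \<Longrightarrow> bihom (a + c) (b + d) (\<lambda>z. f z * g z)"
proof (induction rule: bihom.induct)
  case (bihom_const k)
  then show ?case using bihom_scale[OF g, of k] by simp
next
  case (bihom_zmul a b f i)
  from bihom.bihom_zmul[OF bihom_zmul.IH, of i] show ?case by (simp add: mult.assoc)
next
  case (bihom_cmul a b f i)
  from bihom.bihom_cmul[OF bihom_cmul.IH, of i] show ?case by (simp add: mult.assoc)
next
  case (bihom_add a b f h)
  from bihom.bihom_add[OF bihom_add.IH] show ?case by (simp add: distrib_right)
qed

lemma bihom_cnj: "bihom a b f \<Longrightarrow> bihom b a (\<lambda>z. cnj (f z))"
  by (induction rule: bihom.induct) (auto intro: bihom.intros)

lemma bihom_homogeneous: "bihom a b f \<Longrightarrow> f (w *s z) = w ^ a * cnj w ^ b * f z"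
  by (induction rule: bihom.induct) (auto simp: algebra_simps)

lemma bihom_linear_substitution: "bihom a b f \<Longrightarrow> bihom a b (\<lambda>z. f (A *v z))"
proof (induction rule: bihom.induct)
  case (bihom_zmul a b f i)
  have "bihom (Suc a) b (\<lambda>z. \<Sum>j\<in>UNIV. A $ i $ j * (z $ j * f (A *v z)))"
    by (intro bihom_sum bihom_scale bihom.bihom_zmul bihom_zmul.IH)
  then show ?case by (simp add: matrix_vector_mult_def sum_distrib_right mult.assoc)
next
  case (bihom_cmul a b f i)
  have "bihom a (Suc b) (\<lambda>z. \<Sum>j\<in>UNIV. cnj (A $ i $ j) * (cnj (z $ j) * f (A *v z)))"
    by (intro bihom_sum bihom_scale bihom.bihom_cmul bihom_cmul.IH)
  then show ?case by (simp add: matrix_vector_mult_def sum_distrib_right mult.assoc)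
qed (auto intro: bihom.intros)

definition zmono :: "('n \<Rightarrow> nat) \<Rightarrow> ('n \<Rightarrow> nat) \<Rightarrow> complex^'n \<Rightarrow> complex" where
  "zmono a b z = (\<Prod>i\<in>UNIV. (z $ i) ^ a i * cnj (z $ i) ^ b i)"

definition multi_indices :: "nat \<Rightarrow> ('n::finite \<Rightarrow> nat) set" where
  "multi_indices d = {a. (\<Sum>i\<in>UNIV. a i) = d}"

lemma finite_multi_indices [simp]: "finite (multi_indices d :: ('n::finite \<Rightarrow> nat) set)"
proof (rule finite_subset)
  have "a i \<le> d" if "sum a UNIV = d" for a :: "'n \<Rightarrow> nat" and i
    using member_le_sum[of i UNIV a] that by simp
  then show "multi_indices d \<subseteq> (UNIV \<rightarrow>\<^sub>E {..d} :: ('n \<Rightarrow> nat) set)"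
    by (auto simp: multi_indices_def)
qed (auto intro!: finite_PiE)

text \<open>
  The double sum over exponents is written as one sum over a finite set of pairs, which is the form
  that the projection onto a finite span requires.
\<close>
lemma bihomogeneous_altdef:
  "bihomogeneous \<alpha> \<beta> = {f. \<exists>c. \<forall>z. f z = (\<Sum>p\<in>multi_indices \<alpha> \<times> multi_indices \<beta>. c p * zmono (fst p) (snd p) z)}"
proof -
  have iff: "(\<exists>c. \<forall>z. f z = (\<Sum>a\<in>multi_indices \<alpha>. \<Sum>b\<in>multi_indices \<beta>. c a b * zmono a b z)) \<longleftrightarrow>
      (\<exists>c. \<forall>z. f z = (\<Sum>p\<in>multi_indices \<alpha> \<times> multi_indices \<beta>. c p * zmono (fst p) (snd p) z))"
    (is "?L \<longleftrightarrow> ?R") for f :: "complex^'n \<Rightarrow> complex"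
  proof
    assume ?L
    then obtain c where "\<forall>z. f z = (\<Sum>a\<in>multi_indices \<alpha>. \<Sum>b\<in>multi_indices \<beta>. c a b * zmono a b z)" by blast
    then show ?R by (intro exI[of _ "\<lambda>p. c (fst p) (snd p)"]) (simp add: sum.cartesian_product case_prod_beta)
  next
    assume ?R
    then obtain c where "\<forall>z. f z = (\<Sum>p\<in>multi_indices \<alpha> \<times> multi_indices \<beta>. c p * zmono (fst p) (snd p) z)" by blast
    then show ?L by (intro exI[of _ "\<lambda>a b. c (a, b)"]) (simp add: sum.cartesian_product case_prod_beta)
  qed
  have "bihomogeneous \<alpha> \<beta> = {f. \<exists>c. \<forall>z. f z = (\<Sum>a\<in>multi_indices \<alpha>. \<Sum>b\<in>multi_indices \<beta>. c a b * zmono a b z)}"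
    by (simp add: bihomogeneous_def zmono_def multi_indices_def)
  then show ?thesis by (simp only: iff)
qed

lemma zmono_zmul: "z $ i * zmono a b z = zmono (a(i := Suc (a i))) b z"
proof -
  have "zmono (a(i := Suc (a i))) b z
      = (\<Prod>j\<in>UNIV. (if j = i then z $ i else 1) * ((z $ j) ^ a j * cnj (z $ j) ^ b j))"
    unfolding zmono_def by (intro prod.cong) auto
  then show ?thesis by (subst (asm) prod.distrib) (simp add: zmono_def[of a b])
qed

lemma zmono_cmul: "cnj (z $ i) * zmono a b z = zmono a (b(i := Suc (b i))) z"
proof -
  have "zmono a (b(i := Suc (b i))) z
      = (\<Prod>j\<in>UNIV. (if j = i then cnj (z $ i) else 1) * ((z $ j) ^ a j * cnj (z $ j) ^ b j))"
    unfolding zmono_def by (intro prod.cong) auto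
  then show ?thesis by (subst (asm) prod.distrib) (simp add: zmono_def[of a b])
qed

lemma sum_fun_upd_Suc: "(\<Sum>j\<in>UNIV. (a(i := Suc (a i))) j) = Suc (\<Sum>j\<in>(UNIV :: 'n::finite set). a j)"
proof -
  have "(\<Sum>j\<in>UNIV. (a(i := Suc (a i))) j) = (\<Sum>j\<in>UNIV. (if j = i then 1 else 0) + a j)"
    by (intro sum.cong) auto
  then show ?thesis by (simp add: sum.distrib)
qed

lemma bihomogeneous_add:
  assumes "f \<in> bihomogeneous \<alpha> \<beta>" "g \<in> bihomogeneous \<alpha> \<beta>"
  shows "(\<lambda>z. f z + g z) \<in> bihomogeneous \<alpha> \<beta>"
proof -
  obtain c d where
    "\<forall>z. f z = (\<Sum>p\<in>multi_indices \<alpha> \<times> multi_indices \<beta>. c p * zmono (fst p) (snd p) z)"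
    "\<forall>z. g z = (\<Sum>p\<in>multi_indices \<alpha> \<times> multi_indices \<beta>. d p * zmono (fst p) (snd p) z)"
    using assms unfolding bihomogeneous_altdef by blast
  then have "\<forall>z. f z + g z = (\<Sum>p\<in>multi_indices \<alpha> \<times> multi_indices \<beta>. (c p + d p) * zmono (fst p) (snd p) z)"
    by (simp add: sum.distrib[symmetric] distrib_right)
  then show ?thesis unfolding bihomogeneous_altdef by (intro CollectI exI[of _ "\<lambda>p. c p + d p"])
qed

lemma bihomogeneous_monomial:
  assumes "a \<in> multi_indices \<alpha>" "b \<in> multi_indices \<beta>"
  shows "(\<lambda>z. c * zmono a b z) \<in> bihomogeneous \<alpha> \<beta>"
proof -
  have "c * zmono a b z = (\<Sum>p\<in>multi_indices \<alpha> \<times> multi_indices \<beta>.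
      if p = (a, b) then c * zmono a b z else 0)" for z
    using assms by (subst sum.delta) auto
  also have "\<dots> z = (\<Sum>p\<in>multi_indices \<alpha> \<times> multi_indices \<beta>.
      (if p = (a, b) then c else 0) * zmono (fst p) (snd p) z)" for z
    by (intro sum.cong) auto
  finally show ?thesis unfolding bihomogeneous_altdef
    by (intro CollectI exI[of _ "\<lambda>p. if p = (a, b) then c else 0"] allI)
qed

lemma bihomogeneous_zero: "(\<lambda>z. 0) \<in> bihomogeneous \<alpha> \<beta>"
  unfolding bihomogeneous_altdef by (intro CollectI exI[of _ "\<lambda>p. 0"]) simp

lemma bihomogeneous_sum:
  "(\<And>j. j \<in> J \<Longrightarrow> f j \<in> bihomogeneous \<alpha> \<beta>) \<Longrightarrow> (\<lambda>z. \<Sum>j\<in>J. f j z) \<in> bihomogeneous \<alpha> \<beta>"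
  by (induction J rule: infinite_finite_induct) (auto intro: bihomogeneous_zero bihomogeneous_add)

lemma bihom_zmono:
  assumes "a \<in> multi_indices \<alpha>" "b \<in> multi_indices \<beta>"
  shows "bihom \<alpha> \<beta> (zmono a b)"
proof -
  have zp: "bihom k 0 (\<lambda>z. (z $ i) ^ k)" for k and i :: 'a
    by (induction k) (auto intro: bihom_const[of 1, simplified] bihom_zmul)
  have cp: "bihom 0 k (\<lambda>z. cnj (z $ i) ^ k)" for k and i :: 'a
    by (induction k) (auto intro: bihom_const[of 1, simplified] bihom_cmul)
  have "bihom (\<Sum>i\<in>J. a i) (\<Sum>i\<in>J. b i) (\<lambda>z. \<Prod>i\<in>J. (z $ i) ^ a i * cnj (z $ i) ^ b i)" for J
  proof (induction J rule: infinite_finite_induct)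
    case (insert i J)
    from bihom_mult[OF insert.IH bihom_mult[OF cp[of "b i" i] zp[of "a i" i]]] insert.hyps
    show ?case by simp
  qed (auto intro: bihom_const)
  from this[of UNIV] assms show ?thesis by (simp add: multi_indices_def zmono_def[abs_def])
qed

lemma bihomogeneous_eq: "bihomogeneous \<alpha> \<beta> = {f. bihom \<alpha> \<beta> f}"
proof (intro equalityI subsetI CollectI; (drule CollectD)?)
  fix f :: "complex^'a \<Rightarrow> complex" assume "f \<in> bihomogeneous \<alpha> \<beta>"
  then obtain c where c: "\<And>z. f z = (\<Sum>p\<in>multi_indices \<alpha> \<times> multi_indices \<beta>. c p * zmono (fst p) (snd p) z)"
    unfolding bihomogeneous_altdef by blast
  have "bihom \<alpha> \<beta> (\<lambda>z. \<Sum>p\<in>multi_indices \<alpha> \<times> multi_indices \<beta>. c p * zmono (fst p) (snd p) z)"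
    by (intro bihom_sum bihom_scale bihom_zmono) auto
  moreover have "f = (\<lambda>z. \<Sum>p\<in>multi_indices \<alpha> \<times> multi_indices \<beta>. c p * zmono (fst p) (snd p) z)"
    using c by auto
  ultimately show "bihom \<alpha> \<beta> f" by simp
next
  fix f :: "complex^'a \<Rightarrow> complex" assume "bihom \<alpha> \<beta> f"
  then show "f \<in> bihomogeneous \<alpha> \<beta>"
  proof (induction rule: bihom.induct)
    case (bihom_const c)
    show ?case using bihomogeneous_monomial[of "\<lambda>_. 0" 0 "\<lambda>_. 0" 0 c]
      by (simp add: multi_indices_def zmono_def)
  next
    case (bihom_zmul \<alpha> \<beta> f i)
    obtain c where c: "\<And>z. f z = (\<Sum>p\<in>multi_indices \<alpha> \<times> multi_indices \<beta>. c p * zmono (fst p) (snd p) z)"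
      using bihom_zmul.IH unfolding bihomogeneous_altdef by blast
    have "(\<lambda>z. \<Sum>p\<in>multi_indices \<alpha> \<times> multi_indices \<beta>.
        c p * zmono ((fst p)(i := Suc (fst p i))) (snd p) z) \<in> bihomogeneous (Suc \<alpha>) \<beta>"
      by (intro bihomogeneous_sum bihomogeneous_monomial)
         (auto simp: multi_indices_def sum_fun_upd_Suc simp del: fun_upd_apply)
    then show ?case
      by (simp add: c sum_distrib_left mult.left_commute[of "_ $ i"] zmono_zmul)
  next
    case (bihom_cmul \<alpha> \<beta> f i)
    obtain c where c: "\<And>z. f z = (\<Sum>p\<in>multi_indices \<alpha> \<times> multi_indices \<beta>. c p * zmono (fst p) (snd p) z)"
      using bihom_cmul.IH unfolding bihomogeneous_altdef by blast
    have "(\<lambda>z. \<Sum>p\<in>multi_indices \<alpha> \<times> multi_indices \<beta>.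
        c p * zmono (fst p) ((snd p)(i := Suc (snd p i))) z) \<in> bihomogeneous \<alpha> (Suc \<beta>)"
      by (intro bihomogeneous_sum bihomogeneous_monomial)
         (auto simp: multi_indices_def sum_fun_upd_Suc simp del: fun_upd_apply)
    then show ?case
      by (simp add: c sum_distrib_left mult.left_commute[of "cnj (_ $ i)"] zmono_cmul)
  qed (rule bihomogeneous_add)
qed

section \<open>Derivatives of polynomials\<close>

text \<open>
  The directional derivative. Besides the standard basis it is also used in the direction \<open>v = z\<close>,
  where it becomes the Euler operator.
\<close>
definition pderv :: "complex^'n \<Rightarrow> (complex^'n \<Rightarrow> complex) \<Rightarrow> complex^'n \<Rightarrow> complex" where
  "pderv v f z = frechet_derivative f (at z) v"

lemma laplacian_eq_pderv: "laplacian f z = (\<Sum>b\<in>Basis. pderv b (pderv b f) z)"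
  by (simp add: laplacian_def pderv_def[abs_def])

lemma pderv_eqI: "(f has_derivative f') (at z) \<Longrightarrow> pderv v f z = f' v"
  unfolding pderv_def by (simp add: frechet_derivative_at[symmetric])

lemma has_derivative_pderv:
  "f differentiable (at z) \<Longrightarrow> (f has_derivative (\<lambda>v. pderv v f z)) (at z)"
  unfolding pderv_def by (simp add: frechet_derivative_works)

lemma pderv_linear:
  assumes "f differentiable (at z)"
  shows "linear (\<lambda>v. pderv v f z)"
  using has_derivative_linear[OF has_derivative_pderv[OF assms]] .

lemma polyf_differentiable: "polyf f \<Longrightarrow> f differentiable (at z)"
proof (induction rule: polyf.induct)
  case (polyf_zmul f i)
  have "(\<lambda>z. z $ i) differentiable (at z)"
    by (rule bounded_linear_imp_differentiable[OF bounded_linear_vec_nth])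
  then show ?case using polyf_zmul.IH by (rule differentiable_mult)
next
  case (polyf_cmul f i)
  have "(\<lambda>z. cnj (z $ i)) differentiable (at z)"
    by (rule bounded_linear_imp_differentiable)
       (rule bounded_linear_compose[OF bounded_linear_cnj bounded_linear_vec_nth])
  then show ?case using polyf_cmul.IH by (rule differentiable_mult)
qed auto

lemma polyf_continuous: "polyf f \<Longrightarrow> continuous_on UNIV f"
  by (simp add: continuous_at_imp_continuous_on differentiable_imp_continuous_within polyf_differentiable)

lemma pderv_const [simp]: "pderv v (\<lambda>z. c) = (\<lambda>z. 0)"
  by (simp add: pderv_def fun_eq_iff)

lemma pderv_coord: "pderv v (\<lambda>z. z $ i) = (\<lambda>z. v $ i)"
  by (auto intro!: pderv_eqI bounded_linear_imp_has_derivative bounded_linear_vec_nth)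

lemma pderv_cnj_coord: "pderv v (\<lambda>z. cnj (z $ i)) = (\<lambda>z. cnj (v $ i))"
  by (auto intro!: pderv_eqI bounded_linear_imp_has_derivative
      bounded_linear_compose[OF bounded_linear_cnj bounded_linear_vec_nth])

lemma pderv_add:
  assumes "polyf f" "polyf g"
  shows "pderv v (\<lambda>z. f z + g z) = (\<lambda>z. pderv v f z + pderv v g z)"
  by (intro ext pderv_eqI[OF has_derivative_add[OF has_derivative_pderv has_derivative_pderv]]
      polyf_differentiable assms)

lemma pderv_mult_differentiable:
  assumes "f differentiable (at z)" "g differentiable (at z)"
  shows "pderv v (\<lambda>z. f z * g z) z = f z * pderv v g z + pderv v f z * g z"
  using has_derivative_mult[OF has_derivative_pderv has_derivative_pderv, OF assms]
  by (rule pderv_eqI)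

lemma polyf_mult: "polyf f \<Longrightarrow> polyf g \<Longrightarrow> polyf (\<lambda>z. f z * g z)"
proof (induction rule: polyf.induct)
  case (polyf_const c)
  then show ?case
  proof (induction rule: polyf.induct)
    case (polyf_zmul f i)
    from polyf.polyf_zmul[OF polyf_zmul.IH, of i] show ?case by (simp add: mult.left_commute)
  next
    case (polyf_cmul f i)
    from polyf.polyf_cmul[OF polyf_cmul.IH, of i] show ?case by (simp add: mult.left_commute)
  qed (auto intro: polyf.intros simp: distrib_left)
next
  case (polyf_zmul f i)
  from polyf.polyf_zmul[OF polyf_zmul.IH[OF polyf_zmul.prems], of i] show ?case by (simp add: mult.assoc)
next
  case (polyf_cmul f i)
  from polyf.polyf_cmul[OF polyf_cmul.IH[OF polyf_cmul.prems], of i] show ?case by (simp add: mult.assoc)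
next
  case (polyf_add f h)
  then show ?case by (auto intro: polyf.intros simp: distrib_right)
qed

lemma polyf_scale: "polyf f \<Longrightarrow> polyf (\<lambda>z. c * f z)"
  by (intro polyf_mult polyf_const)

lemma polyf_diff: "polyf f \<Longrightarrow> polyf g \<Longrightarrow> polyf (\<lambda>z. f z - g z)"
  using polyf_add[OF _ polyf_scale[of g "-1"], of f] by simp

lemma polyf_sum: "(\<And>j. j \<in> J \<Longrightarrow> polyf (f j)) \<Longrightarrow> polyf (\<lambda>z. \<Sum>j\<in>J. f j z)"
  by (induction J rule: infinite_finite_induct) (auto intro: polyf_const polyf_add)

lemma polyf_coord: "polyf (\<lambda>z. z $ i)" and polyf_cnj_coord: "polyf (\<lambda>z. cnj (z $ i))"
  using polyf_zmul[OF polyf_const[of 1], of i] polyf_cmul[OF polyf_const[of 1], of i] by auto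

lemma polyf_cnj: "polyf f \<Longrightarrow> polyf (\<lambda>z. cnj (f z))"
  by (induction rule: polyf.induct) (auto intro: polyf.intros)

lemma pderv_mult:
  assumes "polyf f" "polyf g"
  shows "pderv v (\<lambda>z. f z * g z) = (\<lambda>z. f z * pderv v g z + pderv v f z * g z)"
  by (intro ext pderv_mult_differentiable polyf_differentiable assms)

lemma pderv_scale: "polyf f \<Longrightarrow> pderv v (\<lambda>z. c * f z) = (\<lambda>z. c * pderv v f z)"
  using pderv_mult[OF polyf_const] by simp

lemma pderv_diff:
  assumes "polyf f" "polyf g"
  shows "pderv v (\<lambda>z. f z - g z) = (\<lambda>z. pderv v f z - pderv v g z)"
  using pderv_add[OF assms(1) polyf_scale[OF assms(2), of "-1"]] pderv_scale[OF assms(2), of v "-1"] by simp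

lemma pderv_sum:
  assumes "\<And>j. j \<in> J \<Longrightarrow> polyf (f j)"
  shows "pderv v (\<lambda>z. \<Sum>j\<in>J. f j z) = (\<lambda>z. \<Sum>j\<in>J. pderv v (f j) z)"
  using assms
proof (induction J rule: infinite_finite_induct)
  case (insert j J)
  then show ?case by (simp add: pderv_add polyf_sum)
qed auto

lemma pderv_zmul: "polyf f \<Longrightarrow> pderv v (\<lambda>z. z $ i * f z) = (\<lambda>z. z $ i * pderv v f z + v $ i * f z)"
  using pderv_mult[OF polyf_coord] by (simp add: pderv_coord)

lemma pderv_cmul:
  "polyf f \<Longrightarrow> pderv v (\<lambda>z. cnj (z $ i) * f z) = (\<lambda>z. cnj (z $ i) * pderv v f z + cnj (v $ i) * f z)"
  using pderv_mult[OF polyf_cnj_coord] by (simp add: pderv_cnj_coord)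

lemma pderv_cnj: "polyf f \<Longrightarrow> pderv v (\<lambda>z. cnj (f z)) = (\<lambda>z. cnj (pderv v f z))"
  by (intro ext pderv_eqI has_derivative_cnj has_derivative_pderv polyf_differentiable)

lemma polyf_pderv: "polyf f \<Longrightarrow> polyf (pderv v f)"
proof (induction rule: polyf.induct)
  case (polyf_zmul f i)
  then show ?case by (simp add: pderv_zmul polyf.polyf_zmul polyf_add polyf_scale)
next
  case (polyf_cmul f i)
  then show ?case by (simp add: pderv_cmul polyf.polyf_cmul polyf_add polyf_scale)
qed (auto simp: pderv_add intro: polyf.intros)

text \<open>
  Symmetry of the second derivative; for polynomials it follows by induction from the product rule.
\<close>
lemma pderv_commute: "polyf f \<Longrightarrow> pderv u (pderv v f) = pderv v (pderv u f)"
proof (induction rule: polyf.induct)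
  case (polyf_zmul f i)
  then show ?case
    by (simp add: pderv_zmul pderv_add polyf_pderv polyf.polyf_zmul polyf_scale pderv_scale)
       (simp add: algebra_simps)
next
  case (polyf_cmul f i)
  then show ?case
    by (simp add: pderv_cmul pderv_add polyf_pderv polyf.polyf_cmul polyf_scale pderv_scale)
       (simp add: algebra_simps)
qed (auto simp: pderv_add polyf_pderv)

lemma polyf_laplacian: "polyf f \<Longrightarrow> polyf (laplacian f)"
  unfolding laplacian_eq_pderv[abs_def] by (intro polyf_sum polyf_pderv)

lemma laplacian_cnj: "polyf f \<Longrightarrow> laplacian (\<lambda>z. cnj (f z)) = (\<lambda>z. cnj (laplacian f z))"
  by (simp add: laplacian_eq_pderv fun_eq_iff pderv_cnj polyf_pderv)

lemma laplacian_lincomb: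
  "polyf f \<Longrightarrow> polyf g \<Longrightarrow> laplacian (\<lambda>z. a * f z + b * g z) z = a * laplacian f z + b * laplacian g z"
  by (simp add: laplacian_eq_pderv pderv_add pderv_scale polyf_pderv polyf_scale sum.distrib sum_distrib_left)

definition dz :: "'n \<Rightarrow> (complex^'n \<Rightarrow> complex) \<Rightarrow> complex^'n \<Rightarrow> complex" where
  "dz i f = (\<lambda>z. (pderv (axis i 1) f z - \<i> * pderv (axis i \<i>) f z) / 2)"

definition dzbar :: "'n \<Rightarrow> (complex^'n \<Rightarrow> complex) \<Rightarrow> complex^'n \<Rightarrow> complex" where
  "dzbar i f = (\<lambda>z. (pderv (axis i 1) f z + \<i> * pderv (axis i \<i>) f z) / 2)"

lemma axis_component: "axis i x $ j = (if i = j then x else 0)"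
  by (simp add: axis_def)

lemma dz_const: "dz i (\<lambda>z. c) = (\<lambda>z. 0)" and dzbar_const: "dzbar i (\<lambda>z. c) = (\<lambda>z. 0)"
  by (auto simp: dz_def dzbar_def)

lemma dz_mult_rules:
  assumes "polyf f"
  shows "dz i (\<lambda>z. z $ j * f z) = (\<lambda>z. z $ j * dz i f z + (if i = j then 1 else 0) * f z)"
    and "dz i (\<lambda>z. cnj (z $ j) * f z) = (\<lambda>z. cnj (z $ j) * dz i f z)"
  unfolding dz_def pderv_zmul[OF assms] pderv_cmul[OF assms] axis_component
  by (auto simp: fun_eq_iff field_simps)

lemma dzbar_mult_rules:
  assumes "polyf f"
  shows "dzbar i (\<lambda>z. cnj (z $ j) * f z) = (\<lambda>z. cnj (z $ j) * dzbar i f z + (if i = j then 1 else 0) * f z)"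
    and "dzbar i (\<lambda>z. z $ j * f z) = (\<lambda>z. z $ j * dzbar i f z)"
  unfolding dzbar_def pderv_zmul[OF assms] pderv_cmul[OF assms] axis_component
  by (auto simp: fun_eq_iff field_simps)

lemma dz_dzbar_add:
  assumes "polyf f" "polyf g"
  shows "dz i (\<lambda>z. f z + g z) = (\<lambda>z. dz i f z + dz i g z)"
    and "dzbar i (\<lambda>z. f z + g z) = (\<lambda>z. dzbar i f z + dzbar i g z)"
  unfolding dz_def dzbar_def pderv_add[OF assms] by (auto simp: fun_eq_iff field_simps)

lemma bihom_dz:
  "bihom a b f \<Longrightarrow> (a = 0 \<longrightarrow> dz i f = (\<lambda>z. 0)) \<and> (\<forall>a'. a = Suc a' \<longrightarrow> bihom a' b (dz i f))"
proof (induction rule: bihom.induct)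
  case (bihom_zmul a b f j)
  have "bihom a b (\<lambda>z. z $ j * dz i f z)"
  proof (cases a)
    case 0
    then show ?thesis using bihom_zmul.IH by (simp add: bihom_zero)
  next
    case (Suc a')
    then show ?thesis using bihom_zmul.IH bihom.bihom_zmul by simp
  qed
  then have "bihom a b (\<lambda>z. z $ j * dz i f z + (if i = j then 1 else 0) * f z)"
    by (intro bihom.bihom_add bihom_scale bihom_zmul.hyps)
  then show ?case using bihom_imp_polyf[OF bihom_zmul.hyps] by (simp add: dz_mult_rules dz_dzbar_add)
next
  case (bihom_cmul a b f j)
  then show ?case
    by (auto simp: dz_mult_rules dz_dzbar_add bihom_imp_polyf[OF bihom_cmul.hyps] intro: bihom.bihom_cmul)
next
  case (bihom_add a b f g)
  then show ?case
    using bihom_imp_polyf[OF bihom_add.hyps(1)] bihom_imp_polyf[OF bihom_add.hyps(2)]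
    by (auto simp: dz_mult_rules dz_dzbar_add intro: bihom.bihom_add)
qed (auto simp: dz_const)

lemma bihom_dzbar:
  "bihom a b f \<Longrightarrow> (b = 0 \<longrightarrow> dzbar i f = (\<lambda>z. 0)) \<and> (\<forall>b'. b = Suc b' \<longrightarrow> bihom a b' (dzbar i f))"
proof (induction rule: bihom.induct)
  case (bihom_cmul a b f j)
  have "bihom a b (\<lambda>z. cnj (z $ j) * dzbar i f z)"
  proof (cases b)
    case 0
    then show ?thesis using bihom_cmul.IH by (simp add: bihom_zero)
  next
    case (Suc a')
    then show ?thesis using bihom_cmul.IH bihom.bihom_cmul by simp
  qed
  then have "bihom a b (\<lambda>z. cnj (z $ j) * dzbar i f z + (if i = j then 1 else 0) * f z)"
    by (intro bihom.bihom_add bihom_scale bihom_cmul.hyps)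
  then show ?case using bihom_imp_polyf[OF bihom_cmul.hyps] by (simp add: dzbar_mult_rules dz_dzbar_add)
next
  case (bihom_zmul a b f j)
  then show ?case
    by (auto simp: dzbar_mult_rules dz_dzbar_add bihom_imp_polyf[OF bihom_zmul.hyps] intro: bihom.bihom_zmul)
next
  case (bihom_add a b f g)
  then show ?case
    using bihom_imp_polyf[OF bihom_add.hyps(1)] bihom_imp_polyf[OF bihom_add.hyps(2)]
    by (auto simp: dzbar_mult_rules dz_dzbar_add intro: bihom.bihom_add)
qed (auto simp: dzbar_const)

lemma sum_Basis_complex_vec:
  fixes F :: "complex^'n \<Rightarrow> 'b::comm_monoid_add"
  shows "(\<Sum>b\<in>Basis. F b) = (\<Sum>i\<in>UNIV. F (axis i 1) + F (axis i \<i>))"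
proof -
  have "(\<Sum>b\<in>Basis. F b) = (\<Sum>p\<in>(UNIV :: 'n set) \<times> {1, \<i>}. F (axis (fst p) (snd p)))"
  proof (rule sum.reindex_cong[of "\<lambda>p. axis (fst p) (snd p)"])
    show "inj_on (\<lambda>p. axis (fst p) (snd p)) ((UNIV :: 'n set) \<times> {1, \<i>})"
      by (auto simp: inj_on_def axis_eq_axis)
    show "(Basis :: (complex^'n) set) = (\<lambda>p. axis (fst p) (snd p)) ` (UNIV \<times> {1, \<i>})"
      by (force simp: Basis_vec_def Basis_complex_def)
  qed auto
  also have "\<dots> = (\<Sum>i\<in>UNIV. \<Sum>u\<in>{1, \<i>}. F (axis i u))"
    by (simp only: sum.cartesian_product split_def)
  finally show ?thesis by simp
qed

text \<open>
  The factorization \<open>\<Delta> = 4 \<Sum>\<^sub>i \<partial>\<^sub>i \<partial>\<^sub>i\<^sup>-\<close> shows how the Laplacian changes the bidegree: it removes one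
  holomorphic and one antiholomorphic factor.
\<close>
lemma laplacian_eq_dz_dzbar:
  assumes "polyf f"
  shows "laplacian f z = 4 * (\<Sum>i\<in>UNIV. dz i (dzbar i f) z)"
proof -
  have "4 * dz i (dzbar i f) z
      = pderv (axis i 1) (pderv (axis i 1) f) z + pderv (axis i \<i>) (pderv (axis i \<i>) f) z" for i
  proof -
    have eq: "dzbar i f = (\<lambda>z. (1/2) * pderv (axis i 1) f z + (\<i>/2) * pderv (axis i \<i>) f z)"
      by (simp add: dzbar_def fun_eq_iff add_divide_distrib)
    have "pderv v (dzbar i f)
        = (\<lambda>z. (1/2) * pderv v (pderv (axis i 1) f) z + (\<i>/2) * pderv v (pderv (axis i \<i>) f) z)" for v
      unfolding eq pderv_add[OF polyf_scale[OF polyf_pderv[OF assms]] polyf_scale[OF polyf_pderv[OF assms]]]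
        pderv_scale[OF polyf_pderv[OF assms]] ..
    then show ?thesis using pderv_commute[OF assms, of "axis i 1" "axis i \<i>"]
      by (simp add: dz_def algebra_simps)
  qed
  then show ?thesis
    by (simp add: laplacian_eq_pderv sum_Basis_complex_vec sum_distrib_left)
qed

lemma bihom_laplacian:
  assumes "bihom (Suc a) (Suc b) f"
  shows "bihom a b (laplacian f)"
proof -
  have "bihom a b (dz i (dzbar i f))" for i
    using bihom_dzbar[OF assms, of i] bihom_dz[of "Suc a" b "dzbar i f" i] by simp
  then have "bihom a b (\<lambda>z. 4 * (\<Sum>i\<in>UNIV. dz i (dzbar i f) z))"
    by (intro bihom_scale bihom_sum)
  moreover have "laplacian f = (\<lambda>z. 4 * (\<Sum>i\<in>UNIV. dz i (dzbar i f) z))"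
    using laplacian_eq_dz_dzbar[OF bihom_imp_polyf[OF assms]] by auto
  ultimately show ?thesis by simp
qed

lemma bihom_laplacian_zero:
  assumes f: "bihom a b f" and "a = 0 \<or> b = 0"
  shows "laplacian f z = 0"
proof -
  have "dz i (dzbar i f) = (\<lambda>z. 0)" for i
  proof (cases b)
    case 0
    then show ?thesis using bihom_dzbar[OF f, of i] dz_const by simp
  next
    case (Suc b')
    then show ?thesis
      using assms(2) bihom_dzbar[OF f, of i] bihom_dz[of 0 b' "dzbar i f" i] by auto
  qed
  then show ?thesis using laplacian_eq_dz_dzbar[OF bihom_imp_polyf[OF f]] by simp
qed

section \<open>Infinitesimal rotations and Green's formula on the sphere\<close>

lemma polyf_inner: "polyf (\<lambda>z. complex_of_real (z \<bullet> v))"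
proof -
  have "complex_of_real (z \<bullet> v) = (\<Sum>i\<in>UNIV. (cnj (v $ i) / 2) * z $ i + (v $ i / 2) * cnj (z $ i))" for z
  proof -
    have "complex_of_real (x \<bullet> y) = (cnj y / 2) * x + (y / 2) * cnj x" for x y :: complex
      by (simp add: complex_eq_iff inner_complex_def field_simps)
    then show ?thesis by (simp add: inner_vec_def)
  qed
  moreover have "polyf (\<lambda>z. \<Sum>i\<in>UNIV. (cnj (v $ i) / 2) * z $ i + (v $ i / 2) * cnj (z $ i))"
    by (intro polyf_sum polyf_add polyf_scale polyf_coord polyf_cnj_coord)
  ultimately show ?thesis by simp
qed

lemma pderv_inner: "pderv w (\<lambda>z. complex_of_real (z \<bullet> v)) = (\<lambda>z. complex_of_real (w \<bullet> v))"
proof (intro ext pderv_eqI bounded_linear_imp_has_derivative)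
  show "bounded_linear (\<lambda>z. complex_of_real (z \<bullet> v))"
    by (rule bounded_linear_compose[OF bounded_linear_of_real bounded_linear_inner_left])
qed

lemma polyf_L2: "polyf f \<Longrightarrow> f \<in> L2_sphere"
  by (intro continuous_L2_sphere polyf_continuous)

lemma polyf_integrable: "polyf f \<Longrightarrow> integrable sphere_measure f"
  using L2_prod_integrable[OF polyf_L2 polyf_L2[OF polyf_const[of 1]]] by simp

lemma polyf_measurable: "polyf f \<Longrightarrow> f \<in> borel_measurable borel"
  by (intro borel_measurable_continuous_onI polyf_continuous)

text \<open>
  The rotation by the angle \<open>t\<close> in the plane of two orthonormal vectors \<open>b\<close> and \<open>c\<close>, which
  fixes the orthogonal complement of the plane.
\<close>
definition rot :: "'a::real_inner \<Rightarrow> 'a \<Rightarrow> real \<Rightarrow> 'a \<Rightarrow> 'a" where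
  "rot b c t z = z + ((cos t - 1) * (z \<bullet> b) - sin t * (z \<bullet> c)) *\<^sub>R b
                   + (sin t * (z \<bullet> b) + (cos t - 1) * (z \<bullet> c)) *\<^sub>R c"

text \<open>
  The derivative at \<open>t = 0\<close> of \<open>f\<close> along the rotations in the plane of \<open>b\<close> and \<open>c\<close>.
\<close>
definition lie :: "complex^'n \<Rightarrow> complex^'n \<Rightarrow> (complex^'n \<Rightarrow> complex) \<Rightarrow> complex^'n \<Rightarrow> complex" where
  "lie b c f = (\<lambda>z. complex_of_real (z \<bullet> b) * pderv c f z - complex_of_real (z \<bullet> c) * pderv b f z)"

lemma rot_orthogonal:
  assumes bc: "b \<in> Basis" "c \<in> Basis" "b \<noteq> (c :: 'a::euclidean_space)"
  shows "orthogonal_transformation (rot b c t)"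
  unfolding orthogonal_transformation
proof (intro conjI allI)
  show "linear (rot b c t)"
    by (rule linearI) (auto simp: rot_def inner_simps algebra_simps)
  fix z :: 'a
  have bb: "b \<bullet> b = 1" "c \<bullet> c = 1" "b \<bullet> c = 0" "c \<bullet> b = 0" using bc by (auto simp: inner_Basis)
  have cs: "cos t * cos t = 1 - sin t * sin t" using sin_cos_squared_add[of t] by (simp add: power2_eq_square)
  define p q where "p = (cos t - 1) * (z \<bullet> b) - sin t * (z \<bullet> c)"
    and "q = sin t * (z \<bullet> b) + (cos t - 1) * (z \<bullet> c)"
  have "rot b c t z \<bullet> rot b c t z = z \<bullet> z + 2 * p * (z \<bullet> b) + 2 * q * (z \<bullet> c) + p * p + q * q"
    by (simp add: rot_def p_def[symmetric] q_def[symmetric] inner_simps bb inner_commute[of b z] inner_commute[of c z])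
       (simp add: algebra_simps)
  also have "\<dots> = z \<bullet> z"
    unfolding p_def q_def using cs by algebra
  finally show "norm (rot b c t z) = norm z" by (simp add: norm_eq_sqrt_inner)
qed

lemma rot_derivative:
  fixes b c :: "complex^'n"
  assumes bc: "b \<in> Basis" "c \<in> Basis" "b \<noteq> c" and f: "polyf f"
  shows "((\<lambda>t. f (rot b c t z)) has_vector_derivative lie b c f (rot b c t z)) (at t)"
proof -
  have bb: "b \<bullet> b = 1" "c \<bullet> c = 1" "b \<bullet> c = 0" "c \<bullet> b = 0" using bc by (auto simp: inner_Basis)
  let ?w = "rot b c t z"
  have wb: "?w \<bullet> b = cos t * (z \<bullet> b) - sin t * (z \<bullet> c)" and wc: "?w \<bullet> c = sin t * (z \<bullet> b) + cos t * (z \<bullet> c)"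
    by (auto simp: rot_def inner_simps bb algebra_simps)
  have p: "((\<lambda>t. (cos t - 1) * (z \<bullet> b) - sin t * (z \<bullet> c)) has_real_derivative - (?w \<bullet> c)) (at t)"
    unfolding wc by (auto intro!: derivative_eq_intros)
  have q: "((\<lambda>t. sin t * (z \<bullet> b) + (cos t - 1) * (z \<bullet> c)) has_real_derivative (?w \<bullet> b)) (at t)"
    unfolding wb by (auto intro!: derivative_eq_intros)
  have "((\<lambda>t. rot b c t z) has_vector_derivative (0 + (((cos t - 1) * (z \<bullet> b) - sin t * (z \<bullet> c)) *\<^sub>R 0 + (- (?w \<bullet> c)) *\<^sub>R b)
      + ((sin t * (z \<bullet> b) + (cos t - 1) * (z \<bullet> c)) *\<^sub>R 0 + (?w \<bullet> b) *\<^sub>R c))) (at t)"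
    unfolding rot_def[abs_def]
    by (intro has_vector_derivative_add has_vector_derivative_const has_vector_derivative_scaleR
        p[unfolded rot_def] q[unfolded rot_def])
  then have "((\<lambda>t. rot b c t z) has_vector_derivative ((?w \<bullet> b) *\<^sub>R c - (?w \<bullet> c) *\<^sub>R b)) (at t)"
    by (simp add: algebra_simps)
  moreover have df: "f differentiable (at ?w)" using f by (rule polyf_differentiable)
  ultimately have "((f \<circ> (\<lambda>t. rot b c t z)) has_vector_derivative
      pderv ((?w \<bullet> b) *\<^sub>R c - (?w \<bullet> c) *\<^sub>R b) f ?w) (at t)"
    using has_derivative_at_withinI[OF has_derivative_pderv[OF df]]
    by (intro vector_derivative_diff_chain_within) auto
  then show ?thesis
    using linear_diff[OF pderv_linear[OF df]] linear_scale[OF pderv_linear[OF df]]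
    by (simp add: o_def lie_def scaleR_conv_of_real[where 'a=complex])
qed

lemma polyf_lie: "polyf f \<Longrightarrow> polyf (lie b c f)"
  unfolding lie_def by (intro polyf_diff polyf_mult polyf_inner polyf_pderv)

text \<open>
  The derivative at \<open>t = 0\<close> of the constant function \<open>t \<mapsto> \<integral> f (R\<^sub>t z)\<close>, where \<open>R\<^sub>t\<close> rotates the
  plane of two coordinates. Differentiation under the integral is justified by
  dominated convergence of the difference quotients, bounded by the mean value theorem.
\<close>
lemma integral_lie_zero:
  fixes b c :: "complex^'n"
  assumes b: "b \<in> Basis" and c: "c \<in> Basis" and f: "polyf f"
  shows "(\<integral>z. lie b c f z \<partial>sphere_measure) = 0"
proof (cases "b = c")
  case True
  then show ?thesis by (simp add: lie_def)
next
  case False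
  note orth = rot_orthogonal[OF b c False]
  have norm_rot: "norm (rot b c t z) = norm z" for t z
    using orth by (simp add: orthogonal_transformation)
  have rot0: "rot b c 0 z = z" for z by (simp add: rot_def)
  have [measurable]: "rot b c t \<in> borel_measurable borel" for t
    using linear_continuous_on[of "rot b c t" UNIV] orth
    by (intro borel_measurable_continuous_onI) (auto simp: orthogonal_transformation linear_linear)
  have [measurable]: "f \<in> borel_measurable borel" "lie b c f \<in> borel_measurable borel"
    using f by (auto intro: polyf_measurable polyf_lie)
  have "compact (lie b c f ` sphere 0 1)"
    by (intro compact_continuous_image continuous_on_subset[OF polyf_continuous[OF polyf_lie[OF f]]]) auto
  from compact_imp_bounded[OF this] obtain B where "\<forall>w\<in>lie b c f ` sphere 0 1. cmod w \<le> B"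
    unfolding bounded_iff by blast
  then have B: "\<And>z. norm z = 1 \<Longrightarrow> cmod (lie b c f z) \<le> B" by auto
  have main: "(\<integral>z. u (lie b c f z) \<partial>sphere_measure) = 0"
    if u: "bounded_linear u" and u1: "\<And>w. \<bar>u w\<bar> \<le> cmod w" for u :: "complex \<Rightarrow> real"
  proof -
    have [measurable]: "u \<in> borel_measurable borel"
      using u by (intro borel_measurable_continuous_onI linear_continuous_on)
    have D: "((\<lambda>t. u (f (rot b c t z))) has_real_derivative u (lie b c f (rot b c t z))) (at t)" for t z
      using bounded_linear.has_vector_derivative[OF u rot_derivative[OF b c False f]]
      by (simp add: has_real_derivative_iff_has_vector_derivative)
    define \<tau> where "\<tau> n = inverse (real (Suc n))" for n
    have \<tau>: "\<tau> n > 0" for n by (simp add: \<tau>_def)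
    define s where "s n z = (u (f (rot b c (\<tau> n) z)) - u (f z)) / \<tau> n" for n z
    have "(\<lambda>n. \<integral>z. s n z \<partial>sphere_measure) \<longlonglongrightarrow> (\<integral>z. u (lie b c f z) \<partial>sphere_measure)"
    proof (rule integral_dominated_convergence[where w = "\<lambda>_. B"])
      show "AE z in sphere_measure. (\<lambda>n. s n z) \<longlonglongrightarrow> u (lie b c f z)"
      proof (intro always_eventually allI)
        fix z
        have "((\<lambda>h. (u (f (rot b c (0 + h) z)) - u (f (rot b c 0 z))) / h) \<longlongrightarrow> u (lie b c f (rot b c 0 z))) (at 0)"
          using D[of z 0] by (simp add: DERIV_def)
        moreover have "filterlim \<tau> (at 0) sequentially"
          unfolding \<tau>_def by (intro filterlim_atI LIMSEQ_inverse_real_of_nat) auto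
        ultimately have "(\<lambda>n. (u (f (rot b c (0 + \<tau> n) z)) - u (f (rot b c 0 z))) / \<tau> n) \<longlonglongrightarrow> u (lie b c f (rot b c 0 z))"
          by (rule filterlim_compose)
        then show "(\<lambda>n. s n z) \<longlonglongrightarrow> u (lie b c f z)" by (simp add: s_def rot0)
      qed
      show "AE z in sphere_measure. norm (s n z) \<le> B" for n
        using AE_sphere_measure
      proof eventually_elim
        case (elim z)
        obtain \<xi> where "u (f (rot b c (\<tau> n) z)) - u (f (rot b c 0 z)) = (\<tau> n - 0) * u (lie b c f (rot b c \<xi> z))"
          using MVT2[OF \<tau>[of n], of "\<lambda>t. u (f (rot b c t z))" "\<lambda>t. u (lie b c f (rot b c t z))"] D by blast
        then have "s n z = u (lie b c f (rot b c \<xi> z))" using \<tau>[of n] by (simp add: s_def rot0)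
        then show ?case using u1[of "lie b c f (rot b c \<xi> z)"] B[of "rot b c \<xi> z"] norm_rot elim by simp
      qed
      show "integrable sphere_measure (\<lambda>_. B)" by simp
      show "s n \<in> borel_measurable sphere_measure" for n unfolding s_def by measurable
    qed measurable
    moreover have "(\<integral>z. s n z \<partial>sphere_measure) = 0" for n
    proof -
      have int: "integrable sphere_measure (\<lambda>z. u (f z))"
        by (rule integrable_bounded_linear[OF u polyf_integrable[OF f]])
      have inv: "distr sphere_measure borel (rot b c (\<tau> n)) = sphere_measure"
        by (rule sphere_measure_orthogonal_invariant[OF orth])
      have int': "integrable sphere_measure (\<lambda>z. u (f (rot b c (\<tau> n) z)))"
        using int by (subst (asm) inv[symmetric], subst (asm) integrable_distr_eq) auto
      have "(\<integral>z. u (f z) \<partial>sphere_measure) = (\<integral>z. u (f (rot b c (\<tau> n) z)) \<partial>sphere_measure)"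
        by (subst inv[symmetric], subst integral_distr) auto
      then show ?thesis unfolding s_def using int int' by simp
    qed
    ultimately show ?thesis by (simp add: LIMSEQ_const_iff)
  qed
  have int: "integrable sphere_measure (lie b c f)"
    by (intro polyf_integrable polyf_lie f)
  show ?thesis
  proof (rule complex_eqI)
    show "Re (\<integral>z. lie b c f z \<partial>sphere_measure) = Re 0"
      using main[of Re] abs_Re_le_cmod int by (simp add: bounded_linear_Re integral_Re)
    show "Im (\<integral>z. lie b c f z \<partial>sphere_measure) = Im 0"
      using main[of Im] abs_Im_le_cmod int by (simp add: bounded_linear_Im integral_Im)
  qed
qed

text \<open>
  A derivation whose integrals vanish is skew-symmetric: apply it to the product.
\<close>
lemma lie_skew:
  assumes "b \<in> Basis" "c \<in> Basis" "polyf f" "polyf g"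
  shows "(\<integral>z. lie b c f z * g z \<partial>sphere_measure) = - (\<integral>z. f z * lie b c g z \<partial>sphere_measure)"
proof -
  have "lie b c (\<lambda>z. f z * g z) = (\<lambda>z. lie b c f z * g z + f z * lie b c g z)"
    using assms by (auto simp: lie_def pderv_mult fun_eq_iff algebra_simps)
  then have "(\<integral>z. lie b c f z * g z + f z * lie b c g z \<partial>sphere_measure) = 0"
    using integral_lie_zero[OF assms(1,2) polyf_mult[OF assms(3,4)]] by simp
  then show ?thesis
    using assms
    by (subst (asm) Bochner_Integration.integral_add)
       (auto intro!: polyf_integrable polyf_mult polyf_lie simp: eq_neg_iff_add_eq_0)
qed

text \<open>
  Twice the spherical Laplacian, since each plane is counted in both orientations; the
  planes with \<open>b = c\<close> contribute nothing.
\<close>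
definition casimir :: "(complex^'n \<Rightarrow> complex) \<Rightarrow> complex^'n \<Rightarrow> complex" where
  "casimir f = (\<lambda>z. \<Sum>b\<in>Basis. \<Sum>c\<in>Basis. lie b c (lie b c f) z)"

lemma casimir_symmetric:
  assumes f: "polyf f" and g: "polyf g"
  shows "(\<integral>z. casimir f z * g z \<partial>sphere_measure) = (\<integral>z. f z * casimir g z \<partial>sphere_measure)"
proof -
  have *: "(\<integral>z. lie b c (lie b c f) z * g z \<partial>sphere_measure) = (\<integral>z. f z * lie b c (lie b c g) z \<partial>sphere_measure)"
    if "b \<in> Basis" "c \<in> Basis" for b c
    using that f g by (simp add: lie_skew polyf_lie)
  have "(\<integral>z. casimir f z * g z \<partial>sphere_measure)
      = (\<Sum>b\<in>Basis. \<Sum>c\<in>Basis. \<integral>z. lie b c (lie b c f) z * g z \<partial>sphere_measure)"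
    unfolding casimir_def sum_distrib_right
    using f g by (simp add: integral_sum polyf_integrable polyf_mult polyf_lie polyf_sum)
  also have "\<dots> = (\<Sum>b\<in>Basis. \<Sum>c\<in>Basis. \<integral>z. f z * lie b c (lie b c g) z \<partial>sphere_measure)"
    by (intro sum.cong refl *)
  also have "\<dots> = (\<integral>z. f z * casimir g z \<partial>sphere_measure)"
    unfolding casimir_def sum_distrib_left
    using f g by (simp add: integral_sum polyf_integrable polyf_mult polyf_lie polyf_sum)
  finally show ?thesis .
qed

lemma lie_lie:
  assumes b: "b \<in> Basis" and c: "c \<in> Basis" and f: "polyf f"
  shows "lie b c (lie b c f) z =
    (if b = c then complex_of_real (z \<bullet> b) * pderv c f z + complex_of_real (z \<bullet> c) * pderv b f z else 0)
    + (complex_of_real (z \<bullet> b))\<^sup>2 * pderv c (pderv c f) z + (complex_of_real (z \<bullet> c))\<^sup>2 * pderv b (pderv b f) z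
    - complex_of_real (z \<bullet> b) * pderv b f z - complex_of_real (z \<bullet> c) * pderv c f z
    - 2 * complex_of_real (z \<bullet> b) * complex_of_real (z \<bullet> c) * pderv b (pderv c f) z"
proof -
  have D: "pderv v (lie b c f) z = complex_of_real (z \<bullet> b) * pderv v (pderv c f) z + complex_of_real (v \<bullet> b) * pderv c f z
      - complex_of_real (z \<bullet> c) * pderv v (pderv b f) z - complex_of_real (v \<bullet> c) * pderv b f z" for v
    unfolding lie_def using f
    by (simp add: pderv_diff pderv_mult pderv_inner polyf_mult polyf_inner polyf_pderv)
  have bb: "b \<bullet> b = 1" "c \<bullet> c = 1" "b \<bullet> c = (if b = c then 1 else 0)" "c \<bullet> b = (if b = c then 1 else 0)"
    using b c by (auto simp: inner_Basis)
  have "lie b c (lie b c f) z = complex_of_real (z \<bullet> b) * pderv c (lie b c f) z - complex_of_real (z \<bullet> c) * pderv b (lie b c f) z"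
    by (simp add: lie_def)
  then show ?thesis
    unfolding D bb using pderv_commute[OF f, of b c] by (simp add: algebra_simps power2_eq_square)
qed

lemma norm_sq_Basis: "(\<Sum>b\<in>Basis. (complex_of_real (z \<bullet> b))\<^sup>2) = complex_of_real ((norm z)\<^sup>2)"
proof -
  have "(norm z)\<^sup>2 = (\<Sum>b\<in>Basis. (z \<bullet> b)\<^sup>2)"
    unfolding power2_norm_eq_inner by (subst euclidean_inner) (simp add: power2_eq_square)
  then show ?thesis by simp
qed

text \<open>
  Expanding the squares and summing over all ordered pairs. The pairs with \<open>b = c\<close> turn the factor
  \<open>N\<close> of the Euler operator into \<open>N - 1\<close>.
\<close>
lemma casimir_eq:
  fixes z :: "complex^'n"
  assumes f: "polyf f"
  shows "casimir f z = 2 * (complex_of_real ((norm z)\<^sup>2) * laplacian f z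
      - (\<Sum>b\<in>Basis. \<Sum>c\<in>Basis. complex_of_real (z \<bullet> b) * complex_of_real (z \<bullet> c) * pderv b (pderv c f) z)
      - (of_nat DIM(complex^'n) - 1) * (\<Sum>b\<in>Basis. complex_of_real (z \<bullet> b) * pderv b f z))"
proof -
  let ?x = "\<lambda>b. complex_of_real (z \<bullet> b)" and ?B = "Basis :: (complex^'n) set"
  let ?E = "\<Sum>b\<in>?B. ?x b * pderv b f z"
  have 1: "(\<Sum>b\<in>?B. \<Sum>c\<in>?B. if b = c then ?x b * pderv c f z + ?x c * pderv b f z else 0) = 2 * ?E"
  proof -
    have "(\<Sum>b\<in>?B. \<Sum>c\<in>?B. if b = c then ?x b * pderv c f z + ?x c * pderv b f z else 0)
        = (\<Sum>b\<in>?B. 2 * (?x b * pderv b f z))"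
      by (intro sum.cong refl) (simp add: sum.delta)
    then show ?thesis by (simp add: sum_distrib_left)
  qed
  have 2: "(\<Sum>b\<in>?B. \<Sum>c\<in>?B. (?x b)\<^sup>2 * pderv c (pderv c f) z) = complex_of_real ((norm z)\<^sup>2) * laplacian f z"
    unfolding laplacian_eq_pderv norm_sq_Basis[symmetric] sum_product ..
  have 3: "(\<Sum>b\<in>?B. \<Sum>c\<in>?B. (?x c)\<^sup>2 * pderv b (pderv b f) z) = complex_of_real ((norm z)\<^sup>2) * laplacian f z"
    by (subst sum.swap) (rule 2)
  have 4: "(\<Sum>b\<in>?B. \<Sum>c\<in>?B. ?x b * pderv b f z) = of_nat DIM(complex^'n) * ?E"
    by (simp add: sum_distrib_left)
  have 5: "(\<Sum>b\<in>?B. \<Sum>c\<in>?B. ?x c * pderv c f z) = of_nat DIM(complex^'n) * ?E"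
    by simp
  have 6: "(\<Sum>b\<in>?B. \<Sum>c\<in>?B. 2 * ?x b * ?x c * pderv b (pderv c f) z)
      = 2 * (\<Sum>b\<in>?B. \<Sum>c\<in>?B. ?x b * ?x c * pderv b (pderv c f) z)"
    by (simp add: sum_distrib_left mult.assoc)
  have "casimir f z = (\<Sum>b\<in>?B. \<Sum>c\<in>?B. (if b = c then ?x b * pderv c f z + ?x c * pderv b f z else 0)
    + (?x b)\<^sup>2 * pderv c (pderv c f) z + (?x c)\<^sup>2 * pderv b (pderv b f) z
    - ?x b * pderv b f z - ?x c * pderv c f z - 2 * ?x b * ?x c * pderv b (pderv c f) z)"
    unfolding casimir_def by (intro sum.cong refl lie_lie f)
  then show ?thesis
    unfolding sum.distrib sum_subtractf 1 2 3 4 5 6 by (simp add: algebra_simps)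
qed

text \<open>
  The sum is the derivative in the direction \<open>z\<close> itself, which multiplies a homogeneous polynomial by its
  degree.
\<close>
lemma Euler_radial:
  fixes f :: "complex^'n \<Rightarrow> complex"
  assumes f: "bihom a b f"
  shows "(\<Sum>v\<in>Basis. complex_of_real (z \<bullet> v) * pderv v f z) = of_nat (a + b) * f z"
proof -
  have degree: "pderv z f z = of_nat (a + b) * f z"
    using f
  proof (induction rule: bihom.induct)
    case (bihom_zmul a b f i)
    then show ?case by (simp add: pderv_zmul bihom_imp_polyf) (simp add: algebra_simps)
  next
    case (bihom_cmul a b f i)
    then show ?case by (simp add: pderv_cmul bihom_imp_polyf) (simp add: algebra_simps)
  next
    case (bihom_add a b f g)
    then show ?case by (simp add: pderv_add bihom_imp_polyf) (simp add: algebra_simps)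
  qed simp
  note lin = pderv_linear[OF polyf_differentiable[OF bihom_imp_polyf[OF f]], of z]
  have "pderv z f z = pderv (\<Sum>v\<in>Basis. (z \<bullet> v) *\<^sub>R v) f z"
    by (simp add: euclidean_representation)
  also have "\<dots> = (\<Sum>v\<in>Basis. complex_of_real (z \<bullet> v) * pderv v f z)"
    by (simp only: linear_sum[OF lin] linear_scale[OF lin] scaleR_conv_of_real[where 'a=complex])
  finally show ?thesis using degree by simp
qed

text \<open>
  Differentiate Euler's identity once more and use it again.
\<close>
lemma Euler_radial_second:
  fixes f :: "complex^'n \<Rightarrow> complex"
  assumes f: "bihom a b f"
  shows "(\<Sum>u\<in>Basis. \<Sum>v\<in>Basis. complex_of_real (z \<bullet> u) * complex_of_real (z \<bullet> v) * pderv u (pderv v f) z)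
    = of_nat (a + b) * (of_nat (a + b) - 1) * f z"
proof -
  let ?x = "\<lambda>v. complex_of_real (z \<bullet> v)" and ?B = "Basis :: (complex^'n) set" and ?d = "of_nat (a + b) :: complex"
  have pf: "polyf f" using f by (rule bihom_imp_polyf)
  have eq: "pderv u f z + (\<Sum>v\<in>?B. ?x v * pderv u (pderv v f) z) = ?d * pderv u f z" if u: "u \<in> ?B" for u
  proof -
    have "(\<lambda>z. \<Sum>v\<in>?B. complex_of_real (z \<bullet> v) * pderv v f z) = (\<lambda>z. ?d * f z)"
      using Euler_radial[OF f] by blast
    then have "pderv u (\<lambda>z. \<Sum>v\<in>?B. complex_of_real (z \<bullet> v) * pderv v f z) z = ?d * pderv u f z"
      using pf by (simp add: pderv_scale)
    moreover have "pderv u (\<lambda>z. \<Sum>v\<in>?B. complex_of_real (z \<bullet> v) * pderv v f z) z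
        = (\<Sum>v\<in>?B. ?x v * pderv u (pderv v f) z) + (\<Sum>v\<in>?B. complex_of_real (u \<bullet> v) * pderv v f z)"
      using pf by (simp add: pderv_sum pderv_mult pderv_inner polyf_mult polyf_inner polyf_pderv sum.distrib)
    moreover have "(\<Sum>v\<in>?B. complex_of_real (u \<bullet> v) * pderv v f z) = (\<Sum>v\<in>?B. if u = v then pderv v f z else 0)"
      using u by (intro sum.cong) (auto simp: inner_Basis)
    ultimately have "(\<Sum>v\<in>?B. ?x v * pderv u (pderv v f) z) + pderv u f z = ?d * pderv u f z"
      using u by simp
    then show ?thesis by (simp only: add.commute)
  qed
  have "?x u * (\<Sum>v\<in>?B. ?x v * pderv u (pderv v f) z) = (?d - 1) * (?x u * pderv u f z)" if "u \<in> ?B" for u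
  proof -
    have "(\<Sum>v\<in>?B. ?x v * pderv u (pderv v f) z) = ?d * pderv u f z - pderv u f z"
      using eq[OF that] by (simp only: eq_diff_eq add.commute)
    then show ?thesis by algebra
  qed
  then have "(\<Sum>u\<in>?B. ?x u * (\<Sum>v\<in>?B. ?x v * pderv u (pderv v f) z)) = (\<Sum>u\<in>?B. (?d - 1) * (?x u * pderv u f z))"
    by (intro sum.cong) auto
  also have "\<dots> = (?d - 1) * (?d * f z)"
    using Euler_radial[OF f, of z] by (simp flip: sum_distrib_left)
  finally show ?thesis by (simp add: sum_distrib_left mult.assoc mult.commute mult.left_commute)
qed

text \<open>Minus the eigenvalue of the spherical Laplacian on harmonic polynomials of degree \<open>d\<close>.\<close>
definition sphere_eigenvalue :: "'n::finite itself \<Rightarrow> nat \<Rightarrow> real" where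
  "sphere_eigenvalue _ d = real d * (real d + real DIM(complex^'n) - 2)"

lemma casimir_bihom:
  fixes f :: "complex^'n \<Rightarrow> complex"
  assumes f: "bihom a b f"
  shows "casimir f z = 2 * (complex_of_real ((norm z)\<^sup>2) * laplacian f z
    - complex_of_real (sphere_eigenvalue TYPE('n) (a + b)) * f z)"
  unfolding casimir_eq[OF bihom_imp_polyf[OF f]] Euler_radial_second[OF f] Euler_radial[OF f] sphere_eigenvalue_def
  by (simp only: of_real_mult of_real_add of_real_diff of_real_of_nat_eq of_real_numeral) algebra

text \<open>
  The spherical Laplacian is symmetric, and on each of the two polynomials it is the Laplacian minus a constant.
\<close>
lemma Green_sphere:
  fixes f g :: "complex^'n \<Rightarrow> complex"
  assumes f: "bihom a b f" and g: "bihom c d g"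
  shows "sphere_inner (laplacian f) g
      - complex_of_real (sphere_eigenvalue TYPE('n) (a + b)) * sphere_inner f g
    = sphere_inner f (laplacian g)
      - complex_of_real (sphere_eigenvalue TYPE('n) (c + d)) * sphere_inner f g"
proof -
  have pf: "polyf f" and pg: "polyf (\<lambda>z. cnj (g z))" and pg': "polyf g"
    using f g by (auto intro: bihom_imp_polyf polyf_cnj)
  let ?e = "\<lambda>k. complex_of_real (sphere_eigenvalue TYPE('n) k)"
  note pi = polyf_mult[OF polyf_laplacian[OF pf] pg] polyf_mult[OF pf pg]
    polyf_mult[OF pf polyf_cnj[OF polyf_laplacian[OF pg']]]
  have "(\<integral>z. casimir f z * cnj (g z) \<partial>sphere_measure)
      = (\<integral>z. 2 * (laplacian f z * cnj (g z)) - 2 * ?e (a + b) * (f z * cnj (g z)) \<partial>sphere_measure)"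
  proof (rule integral_cong_AE)
    show "AE z in sphere_measure. casimir f z * cnj (g z)
        = 2 * (laplacian f z * cnj (g z)) - 2 * ?e (a + b) * (f z * cnj (g z))"
      using AE_sphere_measure by eventually_elim (simp add: casimir_bihom[OF f] algebra_simps)
  next
    have "polyf (casimir f)" unfolding casimir_def by (intro polyf_sum polyf_lie pf)
    then show "(\<lambda>z. casimir f z * cnj (g z)) \<in> borel_measurable sphere_measure"
      using polyf_measurable[OF polyf_mult[OF _ pg]] by simp
  qed (use pi[THEN polyf_measurable] in auto)
  also have "\<dots> = 2 * (sphere_inner (laplacian f) g) - 2 * ?e (a + b) * sphere_inner f g"
    unfolding L2_inner_def using pi[THEN polyf_integrable] by simp
  finally have 1: "(\<integral>z. casimir f z * cnj (g z) \<partial>sphere_measure) = \<dots>" .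
  have "(\<integral>z. f z * casimir (\<lambda>z. cnj (g z)) z \<partial>sphere_measure)
      = (\<integral>z. 2 * (f z * cnj (laplacian g z)) - 2 * ?e (c + d) * (f z * cnj (g z)) \<partial>sphere_measure)"
  proof (rule integral_cong_AE)
    show "AE z in sphere_measure. f z * casimir (\<lambda>z. cnj (g z)) z
        = 2 * (f z * cnj (laplacian g z)) - 2 * ?e (c + d) * (f z * cnj (g z))"
      using AE_sphere_measure
      by eventually_elim
         (simp add: casimir_bihom[OF bihom_cnj[OF g]] laplacian_cnj[OF pg'] add.commute[of d c] algebra_simps)
  next
    have "polyf (casimir (\<lambda>z. cnj (g z)))" unfolding casimir_def by (intro polyf_sum polyf_lie pg)
    then show "(\<lambda>z. f z * casimir (\<lambda>z. cnj (g z)) z) \<in> borel_measurable sphere_measure"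
      using polyf_measurable[OF polyf_mult[OF pf]] by simp
  qed (use pi[THEN polyf_measurable] in auto)
  also have "\<dots> = 2 * (sphere_inner f (laplacian g)) - 2 * ?e (c + d) * sphere_inner f g"
    unfolding L2_inner_def using pi[THEN polyf_integrable] by simp
  finally have 2: "(\<integral>z. f z * casimir (\<lambda>z. cnj (g z)) z \<partial>sphere_measure) = \<dots>" .
  have half: "A - e * I = B - e' * I" if "2 * A - 2 * e * I = 2 * B - 2 * e' * I" for A B I e e' :: complex
  proof -
    have "2 * (A - e * I) = 2 * (B - e' * I)" using that by algebra
    then show ?thesis by (subst (asm) mult_cancel_left) simp
  qed
  show ?thesis by (rule half) (use casimir_symmetric[OF pf pg] in \<open>simp only: 1 2\<close>)
qed

section \<open>Harmonic polynomials\<close>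

text \<open>
  Homogeneity determines the polynomial from its values on the sphere.
\<close>
lemma bihom_zero_from_sphere:
  fixes f :: "complex^'n \<Rightarrow> complex"
  assumes f: "bihom a b f" and z: "\<And>z. norm z = 1 \<Longrightarrow> f z = 0"
  shows "f = (\<lambda>z. 0)"
proof
  fix w :: "complex^'n"
  obtain e :: "complex^'n" where e: "norm e = 1" "w = complex_of_real (norm w) *s e"
  proof (cases "w = 0")
    case True
    obtain e :: "complex^'n" where "e \<in> Basis" using nonempty_Basis by blast
    then show ?thesis using that[of e] True by simp
  next
    case False
    then show ?thesis using that[of "sgn w"]
      by (simp add: norm_sgn sgn_div_norm vec_eq_iff scaleR_conv_of_real[where 'a=complex])
  qed
  then show "f w = 0" using bihom_homogeneous[OF f, of "complex_of_real (norm w)" e] z[OF e(1)] by simp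
qed

lemma harmonics_eq: "harmonics a b = {f. bihom a b f \<and> (\<forall>z. laplacian f z = 0)}"
  by (auto simp: harmonics_def bihomogeneous_eq)

lemma harmonics_bihom: "f \<in> harmonics a b \<Longrightarrow> bihom a b f"
  by (simp add: harmonics_eq)

lemma L2_sphere_measurable: "f \<in> L2_sphere \<Longrightarrow> f \<in> borel_measurable borel"
  using L2_measurable[of f sphere_measure] by (simp add: measurable_cong_sets[OF sets_sphere_measure refl])

lemma bihom_L2: "bihom a b f \<Longrightarrow> f \<in> L2_sphere"
  by (intro polyf_L2 bihom_imp_polyf)

lemma bihom_measurable: "bihom a b f \<Longrightarrow> f \<in> borel_measurable borel"
  by (intro polyf_measurable bihom_imp_polyf)

lemma harmonics_L2: "f \<in> harmonics a b \<Longrightarrow> f \<in> L2_sphere"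
  by (intro bihom_L2 harmonics_bihom)

lemma harmonics_lincomb:
  "f \<in> harmonics a b \<Longrightarrow> g \<in> harmonics a b \<Longrightarrow> (\<lambda>z. x * f z + y * g z) \<in> harmonics a b"
  by (auto simp: harmonics_eq laplacian_lincomb bihom_imp_polyf intro!: bihom_add bihom_scale)

lemma harmonics_diff:
  "f \<in> harmonics a b \<Longrightarrow> g \<in> harmonics a b \<Longrightarrow> (\<lambda>z. f z - g z) \<in> harmonics a b"
  using harmonics_lincomb[of f a b g 1 "-1"] by simp

text \<open>
  If one of the degrees vanishes, the polynomial is holomorphic or antiholomorphic, hence harmonic.
\<close>
lemma harmonics_boundary: "bihom a b f \<Longrightarrow> a = 0 \<or> b = 0 \<Longrightarrow> f \<in> harmonics a b"
  by (auto simp: harmonics_eq bihom_laplacian_zero)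

lemma norm_sq_complex_vec:
  "complex_of_real ((norm z)\<^sup>2) = (\<Sum>i\<in>UNIV. z $ i * cnj (z $ i))" for z :: "complex^'n"
proof -
  have "(norm z)\<^sup>2 = (\<Sum>i\<in>UNIV. (cmod (z $ i))\<^sup>2)"
    by (simp add: norm_vec_def L2_set_def sum_nonneg)
  then show ?thesis by (simp only: of_real_sum complex_norm_square)
qed

lemma bihom_norm_sq_mult:
  assumes q: "bihom a b q"
  shows "bihom (Suc a) (Suc b) (\<lambda>z. complex_of_real ((norm z)\<^sup>2) * q z)"
proof -
  have "bihom (Suc a) (Suc b) (\<lambda>z. \<Sum>i\<in>UNIV. z $ i * (cnj (z $ i) * q z))"
    by (intro bihom_sum bihom_zmul bihom_cmul q)
  then show ?thesis by (simp add: norm_sq_complex_vec sum_distrib_right mult.assoc del: of_real_power)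
qed

lemma L2_inner_norm_sq_mult:
  assumes [measurable]: "F \<in> borel_measurable borel" "q \<in> borel_measurable borel"
  shows "sphere_inner F (\<lambda>z. complex_of_real ((norm z)\<^sup>2) * q z) = sphere_inner F q"
  by (rule L2_inner_sphere_cong) auto

lemma orthogonal_to_monomials:
  assumes F: "F \<in> L2_sphere"
    and o: "\<And>j. j \<in> multi_indices a \<times> multi_indices b \<Longrightarrow> sphere_inner F (zmono (fst j) (snd j)) = 0"
    and q: "bihom a b q"
  shows "sphere_inner F q = 0"
proof -
  have "q \<in> bihomogeneous a b" using q by (simp add: bihomogeneous_eq)
  then obtain c where "\<forall>z. q z = (\<Sum>p\<in>multi_indices a \<times> multi_indices b. c p * zmono (fst p) (snd p) z)"
    unfolding bihomogeneous_altdef by blast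
  then have q': "q = (\<lambda>z. \<Sum>p\<in>multi_indices a \<times> multi_indices b. c p * zmono (fst p) (snd p) z)" by auto
  show ?thesis unfolding q' using o F
    by (subst L2_inner_sum(2)) (auto intro!: L2_scale bihom_L2[OF bihom_zmono] simp: L2_inner_scale)
qed

text \<open>
  Applying Green's formula to \<open>h\<close> and \<open>\<Delta>h\<close> gives \<open>\<parallel>\<Delta>h\<parallel>\<^sup>2 = 0\<close>: all other
  terms pair \<open>h\<close> with restrictions to the sphere of polynomials of lower bidegree.
\<close>
lemma orthogonal_imp_harmonic:
  fixes h :: "complex^'n \<Rightarrow> complex"
  assumes h: "bihom (Suc a) (Suc b) h"
    and o: "\<And>q. bihom a b q \<Longrightarrow> sphere_inner h q = 0"
  shows "h \<in> harmonics (Suc a) (Suc b)"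
proof -
  have lap: "bihom a b (laplacian h)" by (rule bihom_laplacian[OF h])
  have "sphere_inner h (laplacian (laplacian h)) = 0"
  proof (cases "a = 0 \<or> b = 0")
    case True
    then have "laplacian (laplacian h) = (\<lambda>z. 0)"
      using bihom_laplacian_zero[OF lap] by blast
    then show ?thesis by simp
  next
    case False
    then obtain a' b' where ab: "a = Suc a'" "b = Suc b'" by (metis not0_implies_Suc)
    then have ll: "bihom a' b' (laplacian (laplacian h))" using bihom_laplacian lap by blast
    show ?thesis
      using o[OF bihom_norm_sq_mult[OF ll, folded ab]] h ll
      by (simp add: L2_inner_norm_sq_mult bihom_measurable del: of_real_power)
  qed
  then have "sphere_inner (laplacian h) (laplacian h) = 0"
    using Green_sphere[OF h lap] o[OF lap] by simp
  then have "sphere_sqnorm (laplacian h) = 0" by (simp add: L2_inner_self)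
  then have "laplacian h z = 0" if "norm z = 1" for z
    using continuous_sqnorm_sphere_zeroD[OF polyf_continuous[OF bihom_imp_polyf[OF lap]]] that by blast
  then have "laplacian h = (\<lambda>z. 0)" by (rule bihom_zero_from_sphere[OF lap])
  then show ?thesis using h by (simp add: harmonics_eq)
qed

lemma projection_to_bihom:
  fixes F :: "complex^'n \<Rightarrow> complex"
  assumes F: "F \<in> L2_sphere"
  obtains p where "bihom a b p" "\<And>q. bihom a b q \<Longrightarrow> sphere_inner F q = sphere_inner p q"
proof -
  let ?J = "multi_indices a \<times> multi_indices b"
  let ?v = "\<lambda>j. zmono (fst j) (snd j)"
  have v: "?v j \<in> L2_sphere" if "j \<in> ?J" for j
    using that by (auto intro!: bihom_L2[of a b] bihom_zmono)
  obtain c where c: "\<forall>i\<in>?J. sphere_inner (\<lambda>x. F x - (\<Sum>j\<in>?J. c j * ?v j x)) (?v i) = 0"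
    using orthogonal_projection_finite_span[where J = ?J and v = ?v, OF _ v F] finite_multi_indices finite_cartesian_product
    by blast
  define p where "p = (\<lambda>x. \<Sum>j\<in>?J. c j * ?v j x)"
  have p: "bihom a b p" unfolding p_def by (intro bihom_sum bihom_scale bihom_zmono) auto
  show thesis
  proof (rule that[OF p])
    fix q :: "complex^'n \<Rightarrow> complex" assume q: "bihom a b q"
    have "sphere_inner (\<lambda>x. F x - p x) q = 0"
      using c by (intro orthogonal_to_monomials[OF _ _ q] L2_diff F bihom_L2[OF p]) (auto simp: p_def)
    then show "sphere_inner F q = sphere_inner p q"
      using F p q by (simp add: L2_inner_diff bihom_L2)
  qed
qed

text \<open>
  On the sphere, subtracting from \<open>p\<close> its projection \<open>q\<close> to bidegree \<open>(a, b)\<close> leaves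
  a polynomial orthogonal to that bidegree; \<open>|z|\<^sup>2 q\<close> is the same function on the sphere, but
  has the bidegree of \<open>p\<close>.
\<close>
lemma harmonic_decomposition_step:
  fixes p :: "complex^'n \<Rightarrow> complex"
  assumes p: "bihom (Suc a) (Suc b) p"
  obtains q where "bihom a b q" "(\<lambda>z. p z - complex_of_real ((norm z)\<^sup>2) * q z) \<in> harmonics (Suc a) (Suc b)"
proof -
  obtain q where q: "bihom a b q"
    and pq: "\<And>r. bihom a b r \<Longrightarrow> sphere_inner p r = sphere_inner q r"
    using projection_to_bihom[OF bihom_L2[OF p]] by blast
  define h where "h = (\<lambda>z. p z - complex_of_real ((norm z)\<^sup>2) * q z)"
  have nq: "bihom (Suc a) (Suc b) (\<lambda>z. complex_of_real ((norm z)\<^sup>2) * q z)"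
    by (rule bihom_norm_sq_mult[OF q])
  have h: "bihom (Suc a) (Suc b) h" unfolding h_def by (intro bihom_diff p nq)
  have "sphere_inner h r = 0" if r: "bihom a b r" for r
  proof -
    have "sphere_inner h r = sphere_inner p r
        - sphere_inner (\<lambda>z. complex_of_real ((norm z)\<^sup>2) * q z) r"
      unfolding h_def using p nq r by (intro L2_inner_diff bihom_L2)
    also have "sphere_inner (\<lambda>z. complex_of_real ((norm z)\<^sup>2) * q z) r = sphere_inner q r"
      using nq q r by (intro L2_inner_sphere_cong bihom_measurable) auto
    finally show ?thesis using pq[OF r] by simp
  qed
  then have "h \<in> harmonics (Suc a) (Suc b)" by (intro orthogonal_imp_harmonic h)
  then show thesis using that[OF q] by (simp add: h_def)
qed

text \<open>
  Repeated splitting expresses \<open>p\<close> on the sphere through harmonic polynomials of at most its bidegree.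
\<close>
lemma orthogonal_to_bihom:
  fixes p :: "complex^'n \<Rightarrow> complex"
  assumes F: "F \<in> L2_sphere"
  shows "bihom a b p \<Longrightarrow>
    (\<And>c d h. c \<le> a \<Longrightarrow> d \<le> b \<Longrightarrow> h \<in> harmonics c d \<Longrightarrow> sphere_inner F h = 0) \<Longrightarrow>
    sphere_inner F p = 0"
proof (induction a arbitrary: b p)
  case 0
  then show ?case using harmonics_boundary[of 0 b p] by blast
next
  case (Suc a)
  show ?case
  proof (cases b)
    case 0
    then show ?thesis using Suc.prems harmonics_boundary[of "Suc a" b p] by blast
  next
    case (Suc b')
    then have p: "bihom (Suc a) (Suc b') p" using Suc.prems by simp
    obtain q where q: "bihom a b' q"
      and h: "(\<lambda>z. p z - complex_of_real ((norm z)\<^sup>2) * q z) \<in> harmonics (Suc a) (Suc b')"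
      using harmonic_decomposition_step[OF p] by blast
    have "sphere_inner F q = 0"
      using Suc.IH[OF q] Suc.prems(2) Suc by (meson le_SucI)
    moreover have "sphere_inner F (\<lambda>z. p z - complex_of_real ((norm z)\<^sup>2) * q z) = 0"
      using Suc.prems(2) h Suc by blast
    ultimately show ?thesis
      using F L2_inner_norm_sq_mult[OF L2_sphere_measurable[OF F] bihom_measurable[OF q]]
        bihom_L2[OF p] bihom_L2[OF bihom_norm_sq_mult[OF q]]
      by (simp add: L2_inner_diff del: of_real_power)
  qed
qed

lemma sphere_eigenvalue_strict_mono:
  assumes "d < e"
  shows "sphere_eigenvalue TYPE('n::finite) d < sphere_eigenvalue TYPE('n) e"
proof -
  have "DIM(complex^'n) \<ge> 2"
    using zero_less_card_finite[where 'a='n] by simp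
  then have "real DIM(complex^'n) \<ge> 2" by linarith
  then have "0 \<le> real d + real DIM(complex^'n) - 2" by linarith
  moreover have "real d < real e" using assms by simp
  ultimately show ?thesis unfolding sphere_eigenvalue_def
    by (intro mult_strict_mono) auto
qed

lemma harmonics_orthogonal:
  fixes f g :: "complex^'n \<Rightarrow> complex"
  assumes f: "f \<in> harmonics a b" and g: "g \<in> harmonics c d" and ne: "a + b \<noteq> c + d"
  shows "sphere_inner f g = 0"
proof -
  have "laplacian f = (\<lambda>z. 0)" "laplacian g = (\<lambda>z. 0)" using f g by (auto simp: harmonics_eq)
  then have "complex_of_real (sphere_eigenvalue TYPE('n) (a + b)) * sphere_inner f g
      = complex_of_real (sphere_eigenvalue TYPE('n) (c + d)) * sphere_inner f g"
    using Green_sphere[OF harmonics_bihom[OF f] harmonics_bihom[OF g]] by simp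
  moreover have "sphere_eigenvalue TYPE('n) (a + b) \<noteq> sphere_eigenvalue TYPE('n) (c + d)"
    using ne sphere_eigenvalue_strict_mono[where 'n='n] by (metis less_irrefl nat_neq_iff)
  ultimately show ?thesis by simp
qed

lemma harmonics_orthogonal_lower:
  fixes h q :: "complex^'n \<Rightarrow> complex"
  assumes h: "h \<in> harmonics (Suc a) (Suc b)" and q: "bihom a b q"
  shows "sphere_inner h q = 0"
  by (rule orthogonal_to_bihom[OF harmonics_L2[OF h] q]) (rule harmonics_orthogonal[OF h], assumption, simp)

text \<open>
  Project to the whole bidegree first; the harmonic part of the result is the wanted projection, because
  the remaining part comes from a lower bidegree, to which harmonic polynomials are orthogonal.
\<close>
lemma harmonic_projection_exists:
  fixes F :: "complex^'n \<Rightarrow> complex"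
  assumes F: "F \<in> L2_sphere"
  shows "\<exists>h\<in>harmonics a b. \<forall>q\<in>harmonics a b. sphere_inner F q = sphere_inner h q"
proof -
  obtain p where p: "bihom a b p"
    and Fp: "\<And>q. bihom a b q \<Longrightarrow> sphere_inner F q = sphere_inner p q"
    using projection_to_bihom[OF F] by blast
  show ?thesis
  proof (cases "a = 0 \<or> b = 0")
    case True
    then show ?thesis using Fp p harmonics_boundary harmonics_bihom by blast
  next
    case False
    then obtain a' b' where ab: "a = Suc a'" "b = Suc b'" by (metis not0_implies_Suc)
    obtain q where q: "bihom a' b' q" and h: "(\<lambda>z. p z - complex_of_real ((norm z)\<^sup>2) * q z) \<in> harmonics a b"
      using harmonic_decomposition_step[OF p[unfolded ab]] ab by blast
    show ?thesis
    proof (intro bexI[OF _ h] ballI)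
      fix g :: "complex^'n \<Rightarrow> complex" assume g: "g \<in> harmonics a b"
      have "sphere_inner (\<lambda>z. complex_of_real ((norm z)\<^sup>2) * q z) g = sphere_inner q g"
        using bihom_norm_sq_mult[OF q] q harmonics_bihom[OF g]
        by (intro L2_inner_sphere_cong bihom_measurable) auto
      also have "\<dots> = 0"
        using harmonics_orthogonal_lower[OF g[unfolded ab] q] L2_inner_commute[of _ q g] by simp
      finally show "sphere_inner F g
          = sphere_inner (\<lambda>z. p z - complex_of_real ((norm z)\<^sup>2) * q z) g"
        using Fp[OF harmonics_bihom[OF g]] p bihom_norm_sq_mult[OF q] harmonics_L2[OF g]
        by (simp add: L2_inner_diff bihom_L2 del: of_real_power)
    qed
  qed
qed

text \<open>
  The inner product of the sphere is definite on homogeneous polynomials.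
\<close>
lemma harmonic_unique:
  fixes h h' :: "complex^'n \<Rightarrow> complex"
  assumes h: "h \<in> harmonics a b" and h': "h' \<in> harmonics a b"
    and eq: "\<And>q. q \<in> harmonics a b \<Longrightarrow> sphere_inner h q = sphere_inner h' q"
  shows "h = h'"
proof -
  let ?d = "\<lambda>z. h z - h' z"
  have d: "?d \<in> harmonics a b" using h h' by (rule harmonics_diff)
  have "sphere_inner ?d ?d = 0"
    using eq[OF d] h h' d by (subst L2_inner_diff) (auto simp: harmonics_L2)
  then have "sphere_sqnorm ?d = 0" by (simp add: L2_inner_self)
  then have "?d z = 0" if "norm z = 1" for z
    using continuous_sqnorm_sphere_zeroD[OF polyf_continuous[OF bihom_imp_polyf[OF harmonics_bihom[OF d]]]] that
    by blast
  from bihom_zero_from_sphere[OF harmonics_bihom[OF d] this] show ?thesis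
    by (simp add: fun_eq_iff)
qed

definition harmonic_projection ::
  "nat \<Rightarrow> nat \<Rightarrow> (complex^'n \<Rightarrow> complex) \<Rightarrow> complex^'n \<Rightarrow> complex" where
  "harmonic_projection a b F = (THE h. h \<in> harmonics a b \<and>
     (\<forall>q\<in>harmonics a b. sphere_inner F q = sphere_inner h q))"

lemma harmonic_projection_eqI:
  fixes F h :: "complex^'n \<Rightarrow> complex"
  assumes "h \<in> harmonics a b" "\<And>q. q \<in> harmonics a b \<Longrightarrow> sphere_inner F q = sphere_inner h q"
  shows "harmonic_projection a b F = h"
  unfolding harmonic_projection_def
proof (rule the_equality)
  show "h \<in> harmonics a b \<and> (\<forall>q\<in>harmonics a b. sphere_inner F q = sphere_inner h q)"
    using assms by blast
next
  fix g assume "g \<in> harmonics a b \<and> (\<forall>q\<in>harmonics a b. sphere_inner F q = sphere_inner g q)"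
  then show "g = h" using assms by (intro harmonic_unique[of g a b h]) simp_all
qed

lemma
  fixes F :: "complex^'n \<Rightarrow> complex"
  assumes "F \<in> L2_sphere"
  shows harmonic_projection_in: "harmonic_projection a b F \<in> harmonics a b"
    and harmonic_projection_inner: "q \<in> harmonics a b \<Longrightarrow>
      sphere_inner (harmonic_projection a b F) q = sphere_inner F q"
proof -
  obtain h where h: "h \<in> harmonics a b"
    "\<And>q. q \<in> harmonics a b \<Longrightarrow> sphere_inner F q = sphere_inner h q"
    using harmonic_projection_exists[OF assms, of a b] by blast
  then have "harmonic_projection a b F = h" by (rule harmonic_projection_eqI)
  then show "harmonic_projection a b F \<in> harmonics a b"
    "q \<in> harmonics a b \<Longrightarrow>
      sphere_inner (harmonic_projection a b F) q = sphere_inner F q"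
    using h by simp_all
qed

lemma harmonic_projection_lincomb:
  fixes F G :: "complex^'n \<Rightarrow> complex"
  assumes F: "F \<in> L2_sphere" and G: "G \<in> L2_sphere"
  shows "harmonic_projection a b (\<lambda>z. x * F z + y * G z)
    = (\<lambda>z. x * harmonic_projection a b F z + y * harmonic_projection a b G z)"
proof (rule harmonic_projection_eqI)
  note in_harmonics = harmonic_projection_in[OF F, of a b] harmonic_projection_in[OF G, of a b]
  show "(\<lambda>z. x * harmonic_projection a b F z + y * harmonic_projection a b G z) \<in> harmonics a b"
    by (intro harmonics_lincomb in_harmonics)
  fix q :: "complex^'n \<Rightarrow> complex" assume q: "q \<in> harmonics a b"
  show "sphere_inner (\<lambda>z. x * F z + y * G z) q
      = sphere_inner (\<lambda>z. x * harmonic_projection a b F z + y * harmonic_projection a b G z) q"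
    unfolding L2_inner_lincomb[OF F G harmonics_L2[OF q]]
      L2_inner_lincomb[OF in_harmonics[THEN harmonics_L2] harmonics_L2[OF q]]
      harmonic_projection_inner[OF F q] harmonic_projection_inner[OF G q] ..
qed

section \<open>Completeness of the harmonic polynomials\<close>

lemma real_polynomial_function_polyf:
  "real_polynomial_function g \<Longrightarrow> polyf (\<lambda>z :: complex^'n. complex_of_real (g z))"
proof (induction rule: real_polynomial_function.induct)
  case (linear f)
  then interpret bounded_linear f .
  have rep: "f z = (\<Sum>b\<in>Basis. f b * (z \<bullet> b))" for z
  proof -
    have "f z = f (\<Sum>b\<in>Basis. (z \<bullet> b) *\<^sub>R b)" by (simp only: euclidean_representation)
    also have "\<dots> = (\<Sum>b\<in>Basis. f b * (z \<bullet> b))"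
      by (simp only: sum scaleR real_scaleR_def mult.commute)
    finally show ?thesis .
  qed
  have eq: "(\<lambda>z. complex_of_real (f z)) = (\<lambda>z. \<Sum>b\<in>Basis. complex_of_real (f b) * complex_of_real (z \<bullet> b))"
    by (subst rep) simp
  show ?case by (subst eq) (intro polyf_sum polyf_scale polyf_inner)
qed (auto intro: polyf_const polyf_add polyf_mult)

lemma orthogonal_to_polyf:
  fixes F :: "complex^'n \<Rightarrow> complex"
  assumes F: "F \<in> L2_sphere"
    and o: "\<And>a b p. bihom a b p \<Longrightarrow> sphere_inner F p = 0"
    and f: "polyf f"
  shows "sphere_inner F f = 0"
proof -
  have "\<forall>a b g. bihom a b g \<longrightarrow> sphere_inner F (\<lambda>z. g z * f z) = 0"
    using f
  proof (induction rule: polyf.induct)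
    case (polyf_const c)
    then show ?case using o[OF bihom_scale[of _ _ _ c]] by (simp add: mult.commute)
  next
    case (polyf_zmul f i)
    show ?case
    proof (intro allI impI)
      fix a b and g :: "complex^'n \<Rightarrow> complex" assume "bihom a b g"
      from polyf_zmul.IH[rule_format, OF bihom_zmul[OF this, of i]]
      show "sphere_inner F (\<lambda>z. g z * (z $ i * f z)) = 0"
        by (simp add: ac_simps)
    qed
  next
    case (polyf_cmul f i)
    show ?case
    proof (intro allI impI)
      fix a b and g :: "complex^'n \<Rightarrow> complex" assume "bihom a b g"
      from polyf_cmul.IH[rule_format, OF bihom_cmul[OF this, of i]]
      show "sphere_inner F (\<lambda>z. g z * (cnj (z $ i) * f z)) = 0"
        by (simp add: ac_simps)
    qed
  next
    case (polyf_add f h)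
    show ?case
    proof (intro allI impI)
      fix a b and g :: "complex^'n \<Rightarrow> complex" assume g: "bihom a b g"
      have "sphere_inner F (\<lambda>z. g z * f z + g z * h z) = 0"
        using polyf_add.IH g F polyf_add.hyps bihom_imp_polyf[OF g]
        by (subst L2_inner_add(2)) (auto intro!: polyf_L2 polyf_mult)
      then show "sphere_inner F (\<lambda>z. g z * (f z + h z)) = 0"
        by (simp add: distrib_left)
    qed
  qed
  from this[rule_format, OF bihom_const[of 1]] show ?thesis by simp
qed

text \<open>
  The densities given by the positive and the negative part of \<open>u\<close> agree on closed sets, which
  generate the Borel sets and are stable under intersection, so they define the same measure.
\<close>
lemma AE_zero_if_integral_closed_zero:
  fixes u :: "'a::euclidean_space \<Rightarrow> real"
  assumes int: "integrable sphere_measure u"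
    and zero: "\<And>A. closed A \<Longrightarrow> (\<integral>z. u z * indicator A z \<partial>sphere_measure) = 0"
  shows "AE z in sphere_measure. u z = 0"
proof -
  have [measurable]: "u \<in> borel_measurable borel" using int by auto
  have fin: "emeasure (density sphere_measure (\<lambda>z. ennreal (v z))) A = ennreal (\<integral>z. v z * indicator A z \<partial>sphere_measure)"
    if v: "integrable sphere_measure v" "\<And>z. v z \<ge> 0" and A[measurable]: "A \<in> sets borel" for v :: "'a \<Rightarrow> real" and A
  proof -
    have [measurable]: "v \<in> borel_measurable borel" using v by auto
    have "emeasure (density sphere_measure (\<lambda>z. ennreal (v z))) A
        = (\<integral>\<^sup>+z. ennreal (v z * indicator A z) \<partial>sphere_measure)"
      by (subst emeasure_density) (auto simp: ennreal_mult'' intro!: nn_integral_cong split: split_indicator)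
    also have "\<dots> = ennreal (\<integral>z. v z * indicator A z \<partial>sphere_measure)"
      using v by (intro nn_integral_eq_integral integrable_real_mult_indicator) (auto split: split_indicator)
    finally show ?thesis .
  qed
  let ?p = "\<lambda>z. max 0 (u z)" and ?m = "\<lambda>z. max 0 (- u z)"
  have ip: "integrable sphere_measure ?p" "integrable sphere_measure ?m" using int by auto
  have closed: "emeasure (density sphere_measure (\<lambda>z. ennreal (?p z))) A
      = emeasure (density sphere_measure (\<lambda>z. ennreal (?m z))) A" if A: "closed A" for A
  proof -
    have [measurable]: "A \<in> sets borel" using A by auto
    have "(\<integral>z. ?p z * indicator A z \<partial>sphere_measure) - (\<integral>z. ?m z * indicator A z \<partial>sphere_measure)
        = (\<integral>z. ?p z * indicator A z - ?m z * indicator A z \<partial>sphere_measure)"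
      using ip by (subst Bochner_Integration.integral_diff) (auto intro!: integrable_real_mult_indicator)
    also have "\<dots> = (\<integral>z. u z * indicator A z \<partial>sphere_measure)"
      by (intro Bochner_Integration.integral_cong) (auto split: split_indicator)
    finally show ?thesis using ip zero[OF A] by (simp add: fin)
  qed
  have "density sphere_measure (\<lambda>z. ennreal (?p z)) = density sphere_measure (\<lambda>z. ennreal (?m z))"
  proof (rule measure_eqI_generator_eq[of "Collect closed" UNIV _ _ "\<lambda>_. UNIV"])
    show "Int_stable (Collect closed :: 'a set set)" by (auto simp: Int_stable_def)
    show "sets (density sphere_measure (\<lambda>z. ennreal (?p z))) = sigma_sets UNIV (Collect closed)"
      "sets (density sphere_measure (\<lambda>z. ennreal (?m z))) = sigma_sets UNIV (Collect closed)"
      by (simp_all add: borel_eq_closed)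
    show "emeasure (density sphere_measure (\<lambda>z. ennreal (?p z))) UNIV \<noteq> \<infinity>" 
      using ip by (simp add: fin)
  qed (use closed in auto)
  then have "AE z in sphere_measure. ennreal (?p z) = ennreal (?m z)"
    by (intro sphere_measure.density_unique) auto
  then show ?thesis by eventually_elim (auto simp: max_def split: if_splits)
qed

text \<open>
  By Stone and Weierstrass \<open>F\<close> is orthogonal to the continuous functions; indicators of closed sets are
  pointwise limits of these.
\<close>
lemma orthogonal_to_polyf_imp_AE_zero:
  fixes F :: "complex^'n \<Rightarrow> complex"
  assumes F: "F \<in> L2_sphere"
    and o: "\<And>f. polyf f \<Longrightarrow> sphere_inner F f = 0"
  shows "AE z in sphere_measure. F z = 0"
proof -
  have [measurable]: "F \<in> borel_measurable borel" using F by (rule L2_sphere_measurable)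
  have intF: "integrable sphere_measure F"
    using L2_prod_integrable[OF F polyf_L2[OF polyf_const[of 1]]] by simp
  have cont: "(\<integral>z. F z * complex_of_real (\<phi> z) \<partial>sphere_measure) = 0"
    if \<phi>: "continuous_on UNIV \<phi>" for \<phi> :: "complex^'n \<Rightarrow> real"
  proof -
    define I where "I = (\<integral>z. cmod (F z) \<partial>sphere_measure)"
    have I: "I \<ge> 0" by (simp add: I_def)
    have phi_L2: "(\<lambda>z. complex_of_real (\<phi> z)) \<in> L2_sphere"
      using \<phi> by (intro continuous_L2_sphere continuous_on_of_real)
    have "cmod (\<integral>z. F z * complex_of_real (\<phi> z) \<partial>sphere_measure) \<le> e * I" if e: "e > 0" for e
    proof -
      obtain g where g: "real_polynomial_function g" "\<And>x. x \<in> sphere 0 1 \<Longrightarrow> \<bar>\<phi> x - g x\<bar> < e"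
        using Stone_Weierstrass_real_polynomial_function[OF _ continuous_on_subset[OF \<phi> subset_UNIV] e, of "sphere 0 1"] by auto
      have pg: "polyf (\<lambda>z. complex_of_real (g z))" by (rule real_polynomial_function_polyf[OF g(1)])
      let ?D = "\<lambda>z. complex_of_real (\<phi> z) - complex_of_real (g z)"
      have D: "?D \<in> L2_sphere" by (intro L2_diff phi_L2 polyf_L2 pg)
      have "(\<integral>z. F z * complex_of_real (\<phi> z) \<partial>sphere_measure)
          = sphere_inner F (\<lambda>z. complex_of_real (\<phi> z))"
        by (simp add: L2_inner_def)
      also have "\<dots> = sphere_inner F ?D"
        using o[OF pg] by (simp add: L2_inner_diff F phi_L2 polyf_L2[OF pg])
      also have "cmod \<dots> \<le> (\<integral>z. cmod (F z * cnj (?D z)) \<partial>sphere_measure)"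
        unfolding L2_inner_def by (rule integral_norm_bound)
      also have "\<dots> \<le> (\<integral>z. e * cmod (F z) \<partial>sphere_measure)"
      proof (rule integral_mono_AE)
        show "AE z in sphere_measure. cmod (F z * cnj (?D z)) \<le> e * cmod (F z)"
          using AE_sphere_measure
        proof eventually_elim
          case (elim z)
          have "cmod (?D z) \<le> e"
            using g(2)[of z] elim by (simp flip: of_real_diff)
          then show ?case
            by (metis complex_mod_cnj mult.commute mult_right_mono norm_ge_zero norm_mult)
        qed
      qed (use intF L2_prod_integrable[OF F D] in auto)
      finally show ?thesis by (simp add: I_def)
    qed
    note le = this
    have "cmod (\<integral>z. F z * complex_of_real (\<phi> z) \<partial>sphere_measure) \<le> 0"
    proof (rule field_le_epsilon)
      fix e :: real assume "e > 0"
      \<comment> \<open>The denominator is \<open>I + 1\<close> because \<open>I\<close> may vanish.\<close>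
      then have "cmod (\<integral>z. F z * complex_of_real (\<phi> z) \<partial>sphere_measure) \<le> e / (I + 1) * I"
        using I by (intro le) auto
      also have "\<dots> \<le> e" using I \<open>e > 0\<close> by (simp add: field_simps)
      finally show "cmod (\<integral>z. F z * complex_of_real (\<phi> z) \<partial>sphere_measure) \<le> 0 + e" by simp
    qed
    then show ?thesis by simp
  qed
  have closed: "(\<integral>z. F z * complex_of_real (indicator A z) \<partial>sphere_measure) = 0"
    if A: "closed A" for A
  proof (cases "A = {}")
    case False
    have [measurable]: "A \<in> sets borel" using A by auto
    \<comment> \<open>Continuous functions that decrease to the indicator of \<open>A\<close>.\<close>
    define \<phi> where "\<phi> n z = inverse (1 + real n * infdist z A)" for n z
    have pos: "1 + real n * infdist z A \<ge> 1" for n z using infdist_nonneg[of z A] by simp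
    have cphi: "continuous_on UNIV (\<phi> n)" for n
      unfolding \<phi>_def using pos by (intro continuous_intros) (metis not_one_le_zero)
    have [measurable]: "\<phi> n \<in> borel_measurable borel" for n
      using cphi by (rule borel_measurable_continuous_onI)
    have "(\<lambda>n. \<integral>z. F z * complex_of_real (\<phi> n z) \<partial>sphere_measure)
        \<longlonglongrightarrow> (\<integral>z. F z * complex_of_real (indicator A z) \<partial>sphere_measure)"
    proof (rule integral_dominated_convergence[where w = "\<lambda>z. cmod (F z)"])
      show "AE z in sphere_measure. (\<lambda>n. F z * complex_of_real (\<phi> n z)) \<longlonglongrightarrow> F z * complex_of_real (indicator A z)"
      proof (intro always_eventually allI tendsto_mult tendsto_const tendsto_of_real)
        fix z
        show "(\<lambda>n. \<phi> n z) \<longlonglongrightarrow> indicator A z"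
        proof (cases "z \<in> A")
          case True
          then show ?thesis by (simp add: \<phi>_def)
        next
          case nz: False
          then have "infdist z A > 0"
            using A False in_closed_iff_infdist_zero[of A z] infdist_nonneg[of z A] by linarith
          then have "filterlim (\<lambda>n. 1 + real n * infdist z A) at_top sequentially"
            by (intro filterlim_tendsto_add_at_top[OF tendsto_const]
                filterlim_at_top_mult_tendsto_pos[OF tendsto_const] filterlim_real_sequentially)
          then have "(\<lambda>n. \<phi> n z) \<longlonglongrightarrow> 0"
            unfolding \<phi>_def by (rule tendsto_inverse_0_at_top)
          then show ?thesis using nz by simp
        qed
      qed
      show "AE z in sphere_measure. cmod (F z * complex_of_real (\<phi> n z)) \<le> cmod (F z)" for n
      proof (intro always_eventually allI)
        fix z
        have "\<bar>\<phi> n z\<bar> \<le> 1" using pos[of n z] unfolding \<phi>_def by (simp add: inverse_le_1_iff)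
        then show "cmod (F z * complex_of_real (\<phi> n z)) \<le> cmod (F z)"
          by (simp add: norm_mult mult_left_le)
      qed
    qed (use intF in auto)
    then show ?thesis using cont[OF cphi] by (simp add: LIMSEQ_const_iff)
  qed simp
  have "AE z in sphere_measure. Re (F z) = 0"
  proof (rule AE_zero_if_integral_closed_zero)
    fix A :: "(complex^'n) set" assume A: "closed A"
    then have [measurable]: "A \<in> sets borel" by auto
    have "integrable sphere_measure (\<lambda>z. F z * complex_of_real (indicator A z))"
      by (rule Bochner_Integration.integrable_bound[OF intF]) (auto split: split_indicator)
    from integral_Re[OF this] show "(\<integral>z. Re (F z) * indicator A z \<partial>sphere_measure) = 0"
      using closed[OF A] by simp
  qed (use intF in auto)
  moreover have "AE z in sphere_measure. Im (F z) = 0"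
  proof (rule AE_zero_if_integral_closed_zero)
    fix A :: "(complex^'n) set" assume A: "closed A"
    then have [measurable]: "A \<in> sets borel" by auto
    have "integrable sphere_measure (\<lambda>z. F z * complex_of_real (indicator A z))"
      by (rule Bochner_Integration.integrable_bound[OF intF]) (auto split: split_indicator)
    from integral_Im[OF this] show "(\<integral>z. Im (F z) * indicator A z \<partial>sphere_measure) = 0"
      using closed[OF A] by simp
  qed (use intF in auto)
  ultimately show ?thesis by eventually_elim (simp add: complex_eq_iff)
qed

lemma harmonics_complete:
  fixes F :: "complex^'n \<Rightarrow> complex"
  assumes F: "F \<in> L2_sphere"
    and o: "\<And>a b h. h \<in> harmonics a b \<Longrightarrow> sphere_inner F h = 0"
  shows "AE z in sphere_measure. F z = 0"
proof (rule orthogonal_to_polyf_imp_AE_zero[OF F])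
  have "sphere_inner F p = 0" if "bihom a b p" for a b p
    by (rule orthogonal_to_bihom[OF F that o])
  then show "sphere_inner F f = 0" if "polyf f" for f
    using orthogonal_to_polyf[OF F _ that] by blast
qed

section \<open>Matrices\<close>

lemma matrix_inv_unique:
  fixes A B :: "complex^'n^'n"
  assumes "A ** B = mat 1" "B ** A = mat 1"
  shows "matrix_inv A = B"
proof -
  have "A ** matrix_inv A = mat 1 \<and> matrix_inv A ** A = mat 1"
    unfolding matrix_inv_def by (rule someI[of _ B]) (use assms in auto)
  then show ?thesis using assms
    by (metis matrix_mul_assoc matrix_mul_lid matrix_mul_rid)
qed

lemma matrix_inv_left_right:
  fixes A :: "complex^'n^'n"
  assumes "A \<in> GL"
  shows "A ** matrix_inv A = mat 1" "matrix_inv A ** A = mat 1"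
proof -
  obtain B where "A ** B = mat 1" "B ** A = mat 1"
    using assms by (auto simp: GL_def invertible_def)
  then show "A ** matrix_inv A = mat 1" "matrix_inv A ** A = mat 1"
    using matrix_inv_unique[of A B] by auto
qed

lemma GL_I: "A ** B = mat 1 \<Longrightarrow> B ** A = mat 1 \<Longrightarrow> (A :: complex^'n^'n) \<in> GL"
  by (auto simp: GL_def invertible_def)

lemma GL_mult: "A \<in> GL \<Longrightarrow> B \<in> GL \<Longrightarrow> A ** B \<in> GL"
  by (simp add: GL_def invertible_mult)

lemma GL_matrix_inv: "A \<in> GL \<Longrightarrow> matrix_inv A \<in> GL"
  by (rule GL_I[of _ A]) (simp_all add: matrix_inv_left_right)

lemma matrix_inv_mult:
  fixes A B :: "complex^'n^'n"
  assumes "A \<in> GL" "B \<in> GL"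
  shows "matrix_inv (A ** B) = matrix_inv B ** matrix_inv A"
proof (rule matrix_inv_unique)
  have "(A ** B) ** (matrix_inv B ** matrix_inv A) = A ** (B ** matrix_inv B) ** matrix_inv A"
    by (simp add: matrix_mul_assoc)
  then show "(A ** B) ** (matrix_inv B ** matrix_inv A) = mat 1"
    using assms by (simp add: matrix_inv_left_right)
  have "(matrix_inv B ** matrix_inv A) ** (A ** B) = matrix_inv B ** (matrix_inv A ** A) ** B"
    by (simp add: matrix_mul_assoc)
  then show "(matrix_inv B ** matrix_inv A) ** (A ** B) = mat 1"
    using assms by (simp add: matrix_inv_left_right)
qed

lemma conj_transpose_conj_transpose [simp]: "conj_transpose (conj_transpose u) = u"
  by (simp add: conj_transpose_def vec_eq_iff)

lemma conj_transpose_mult: "conj_transpose (u ** v) = conj_transpose v ** conj_transpose u"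
  by (simp add: conj_transpose_def matrix_matrix_mult_def vec_eq_iff mult.commute)

lemma unitary_group_conj_transpose: "u \<in> unitary_group \<Longrightarrow> conj_transpose u \<in> unitary_group"
  by (simp add: unitary_group_def)

lemma unitary_group_mult:
  assumes "u \<in> unitary_group" "v \<in> unitary_group"
  shows "u ** v \<in> unitary_group"
proof -
  have "(conj_transpose v ** conj_transpose u) ** (u ** v) = conj_transpose v ** (conj_transpose u ** u) ** v"
    "(u ** v) ** (conj_transpose v ** conj_transpose u) = u ** (v ** conj_transpose v) ** conj_transpose u"
    by (simp_all add: matrix_mul_assoc)
  then show ?thesis using assms by (simp add: unitary_group_def conj_transpose_mult)
qed

lemma unitary_group_subset_GL: "u \<in> unitary_group \<Longrightarrow> u \<in> GL"
  using GL_I[of u "conj_transpose u"] by (simp add: unitary_group_def)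

lemma matrix_inv_unitary: "u \<in> unitary_group \<Longrightarrow> matrix_inv u = conj_transpose u"
  by (rule matrix_inv_unique) (auto simp: unitary_group_def)

lemma unitary_cancel:
  assumes "u \<in> unitary_group"
  shows "conj_transpose u *v (u *v z) = z" "u *v (conj_transpose u *v z) = z"
    "conj_transpose u ** (u ** A) = A" "u ** (conj_transpose u ** A) = A"
  using assms by (auto simp: unitary_group_def matrix_vector_mul_assoc matrix_mul_assoc)

lemma norm_unitary:
  assumes u: "u \<in> unitary_group"
  shows "norm (u *v z) = norm z"
proof -
  have dot: "complex_of_real ((norm w)\<^sup>2) = (\<Sum>i\<in>UNIV. w $ i * cnj (w $ i))" for w :: "complex^'a"
    by (rule norm_sq_complex_vec)
  have uu: "(\<Sum>i\<in>UNIV. cnj (u $ i $ k) * u $ i $ j) = (if k = j then 1 else 0)" for j k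
  proof -
    have "(conj_transpose u ** u) $ k $ j = mat 1 $ k $ j" using u by (simp add: unitary_group_def)
    then show ?thesis by (simp add: matrix_matrix_mult_def conj_transpose_def mat_def)
  qed
  have "complex_of_real ((norm (u *v z))\<^sup>2)
      = (\<Sum>i\<in>UNIV. \<Sum>j\<in>UNIV. \<Sum>k\<in>UNIV. z $ j * cnj (z $ k) * (cnj (u $ i $ k) * u $ i $ j))"
    unfolding dot by (simp add: matrix_vector_mult_def sum_product cnj_sum ac_simps)
  also have "\<dots> = (\<Sum>j\<in>UNIV. \<Sum>k\<in>UNIV. \<Sum>i\<in>UNIV. z $ j * cnj (z $ k) * (cnj (u $ i $ k) * u $ i $ j))"
    by (rule trans[OF sum.swap], rule sum.cong[OF refl], rule sum.swap)
  also have "\<dots> = (\<Sum>j\<in>UNIV. \<Sum>k\<in>UNIV. z $ j * cnj (z $ k) * (if k = j then 1 else 0))"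
    by (simp only: sum_distrib_left[symmetric] uu)
  also have "\<dots> = (\<Sum>j\<in>UNIV. \<Sum>k\<in>UNIV. if k = j then z $ j * cnj (z $ k) else 0)"
    by (intro sum.cong) auto
  also have "\<dots> = complex_of_real ((norm z)\<^sup>2)"
    unfolding dot by simp
  finally have "(norm (u *v z))\<^sup>2 = (norm z)\<^sup>2" by (simp only: of_real_eq_iff)
  then show ?thesis by (simp add: power2_eq_iff_nonneg)
qed

lemma matrix_vector_linear_real: "linear ((*v) (A :: complex^'n^'n))"
proof (rule linearI)
  fix r and x :: "complex^'n"
  show "A *v (r *\<^sub>R x) = r *\<^sub>R (A *v x)"
    by (simp add: matrix_vector_mult_def vec_eq_iff scaleR_sum_right)
qed (simp add: matrix_vector_right_distrib)

lemma orthogonal_transformation_unitary: "u \<in> unitary_group \<Longrightarrow> orthogonal_transformation ((*v) u)"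
  by (simp add: orthogonal_transformation matrix_vector_linear_real norm_unitary)

lemma borel_measurable_vec_lambda:
  fixes f :: "'x \<Rightarrow> 'b::euclidean_space^'n"
  assumes "\<And>i. (\<lambda>x. f x $ i) \<in> borel_measurable M"
  shows "f \<in> borel_measurable M"
proof (rule borel_measurable_euclidean_space[THEN iffD2], rule ballI)
  fix b :: "'b^'n" assume "b \<in> Basis"
  then obtain i u where b: "b = axis i u" by (auto simp: Basis_vec_def)
  have "(\<lambda>x. f x $ i \<bullet> u) \<in> borel_measurable M"
    by (intro borel_measurable_inner assms borel_measurable_const)
  then show "(\<lambda>x. f x \<bullet> b) \<in> borel_measurable M" by (simp add: b inner_axis)
qed

lemma borel_measurable_vec_nth:
  fixes f :: "'x \<Rightarrow> 'b::euclidean_space^'n"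
  assumes "f \<in> borel_measurable M"
  shows "(\<lambda>x. f x $ i) \<in> borel_measurable M"
  by (rule borel_measurable_continuous_on[OF linear_continuous_on[OF bounded_linear_vec_nth] assms])

lemma borel_measurable_component [measurable]:
  "(\<lambda>z :: 'b::euclidean_space^'n. z $ i) \<in> borel_measurable borel"
  by (rule borel_measurable_continuous_onI[OF linear_continuous_on[OF bounded_linear_vec_nth]])

lemma borel_measurable_matrix_vector_mult [measurable (raw)]:
  fixes A :: "'x \<Rightarrow> complex^'n^'n"
  assumes [measurable]: "A \<in> borel_measurable M" "v \<in> borel_measurable M"
  shows "(\<lambda>x. A x *v v x) \<in> borel_measurable M"
proof (rule borel_measurable_vec_lambda)
  show "(\<lambda>x. (A x *v v x) $ i) \<in> borel_measurable M" for i
    unfolding matrix_vector_mult_def vec_lambda_beta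
    by (intro borel_measurable_sum borel_measurable_times borel_measurable_vec_nth assms)
qed

lemma borel_measurable_matrix_mult [measurable (raw)]:
  fixes A B :: "'x \<Rightarrow> complex^'n^'n"
  assumes [measurable]: "A \<in> borel_measurable M" "B \<in> borel_measurable M"
  shows "(\<lambda>x. A x ** B x) \<in> borel_measurable M"
proof (intro borel_measurable_vec_lambda)
  show "(\<lambda>x. (A x ** B x) $ i $ j) \<in> borel_measurable M" for i j
    unfolding matrix_matrix_mult_def vec_lambda_beta
    by (intro borel_measurable_sum borel_measurable_times borel_measurable_vec_nth assms)
qed

lemma borel_measurable_conj_transpose [measurable (raw)]:
  fixes A :: "'x \<Rightarrow> complex^'n^'n"
  assumes [measurable]: "A \<in> borel_measurable M"
  shows "(\<lambda>x. conj_transpose (A x)) \<in> borel_measurable M"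
proof (intro borel_measurable_vec_lambda)
  show "(\<lambda>x. conj_transpose (A x) $ i $ j) \<in> borel_measurable M" for i j
    unfolding conj_transpose_def vec_lambda_beta
    by (intro borel_measurable_cnj borel_measurable_vec_nth assms)
qed

lemma matrix_vector_mult_axis: "(A *v axis j 1) $ i = (A :: complex^'n^'n) $ i $ j"
proof -
  have "(\<Sum>k\<in>UNIV. A $ i $ k * axis j 1 $ k) = (\<Sum>k\<in>UNIV. if k = j then A $ i $ k else 0)"
    by (intro sum.cong) (auto simp: axis_def)
  then show ?thesis by (simp add: matrix_vector_mult_def)
qed

lemma borel_measurable_det:
  fixes A :: "'x \<Rightarrow> complex^'n^'n"
  assumes [measurable]: "\<And>i j. (\<lambda>x. A x $ i $ j) \<in> borel_measurable M"
  shows "(\<lambda>x. det (A x)) \<in> borel_measurable M"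
  unfolding det_def
  by (rule borel_measurable_sum, rule borel_measurable_times, rule borel_measurable_const,
      rule borel_measurable_prod, rule assms)

text \<open>
  Cramer's rule gives the entries of the inverse as rational functions.
\<close>
lemma borel_measurable_matrix_inv:
  "matrix_inv \<in> borel_measurable (restrict_space borel (GL :: (complex^'n^'n) set))"
proof (intro borel_measurable_vec_lambda)
  fix i j :: 'n
  let ?C = "\<lambda>A :: complex^'n^'n. det (\<chi> r s. if s = i then axis j 1 $ r else A $ r $ s) / det A"
  have "matrix_inv A $ i $ j = ?C A" if A: "A \<in> GL" for A :: "complex^'n^'n"
  proof -
    have "det A \<noteq> 0" using A by (simp add: GL_def invertible_det_nz)
    moreover have "A *v (matrix_inv A *v axis j 1) = axis j 1"
      using A by (simp add: matrix_vector_mul_assoc matrix_inv_left_right)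
    ultimately have "matrix_inv A *v axis j 1
        = (\<chi> k. det (\<chi> r s. if s = k then axis j 1 $ r else A $ r $ s) / det A)"
      by (subst (asm) cramer)
    then have "(matrix_inv A *v axis j 1) $ i = ?C A" by simp
    then show ?thesis by (simp only: matrix_vector_mult_axis)
  qed
  moreover have "?C \<in> borel_measurable (restrict_space borel GL)"
  proof (intro measurable_restrict_space1 borel_measurable_divide borel_measurable_det)
    show "(\<lambda>A :: complex^'n^'n. A $ r $ s) \<in> borel_measurable borel" for r s
      by (intro borel_measurable_vec_nth measurable_ident_sets refl)
    fix r s :: 'n
    have "(\<lambda>A :: complex^'n^'n. A $ r $ s) \<in> borel_measurable borel"
      by (intro borel_measurable_vec_nth measurable_ident_sets refl)
    then have "(\<lambda>A :: complex^'n^'n. if s = i then axis j 1 $ r else A $ r $ s) \<in> borel_measurable borel"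
      by (cases "s = i") simp_all
    then show "(\<lambda>A :: complex^'n^'n. (\<chi> r s. if s = i then axis j 1 $ r else A $ r $ s) $ r $ s) \<in> borel_measurable borel"
      by (simp only: vec_lambda_beta)
  qed
  ultimately show "(\<lambda>A. matrix_inv A $ i $ j) \<in> borel_measurable (restrict_space borel GL)"
    by (subst measurable_cong[where g = ?C]) (auto simp: space_restrict_space)
qed

section \<open>Invariance under the unitary group\<close>

lemma sphere_measure_unitary:
  "u \<in> unitary_group \<Longrightarrow> distr sphere_measure borel ((*v) u) = sphere_measure"
  by (intro sphere_measure_orthogonal_invariant orthogonal_transformation_unitary)

lemma L2_sphere_unitary:
  fixes F :: "complex^'n \<Rightarrow> complex"
  assumes u: "u \<in> unitary_group" and F: "F \<in> L2_sphere"
  shows "(\<lambda>z. F (u *v z)) \<in> L2_sphere"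
proof -
  have [measurable]: "F \<in> borel_measurable borel" by (rule L2_sphere_measurable[OF F])
  have "integrable (distr sphere_measure borel ((*v) u)) (\<lambda>x. (cmod (F x))\<^sup>2)"
    using L2_integrable[OF F] by (simp add: sphere_measure_unitary[OF u])
  then have "integrable sphere_measure (\<lambda>x. (cmod (F (u *v x)))\<^sup>2)"
    by (subst (asm) integrable_distr_eq) auto
  then show ?thesis by (simp add: L2_def)
qed

lemma L2_inner_sphere_unitary:
  fixes F G :: "complex^'n \<Rightarrow> complex"
  assumes u: "u \<in> unitary_group"
    and [measurable]: "F \<in> borel_measurable borel" "G \<in> borel_measurable borel"
  shows "sphere_inner (\<lambda>z. F (u *v z)) (\<lambda>z. G (u *v z)) = sphere_inner F G"
proof -
  have "sphere_inner F G = (\<integral>z. F z * cnj (G z) \<partial>distr sphere_measure borel ((*v) u))"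
    by (simp add: L2_inner_def sphere_measure_unitary[OF u])
  also have "\<dots> = sphere_inner (\<lambda>z. F (u *v z)) (\<lambda>z. G (u *v z))"
    unfolding L2_inner_def by (rule integral_distr) auto
  finally show ?thesis ..
qed

text \<open>
  Harmonicity within a bidegree means orthogonality to the next lower bidegree, and the unitary group preserves
  the bidegrees and the inner product of the sphere.
\<close>
lemma harmonics_unitary:
  fixes f :: "complex^'n \<Rightarrow> complex"
  assumes u: "u \<in> unitary_group" and f: "f \<in> harmonics a b"
  shows "(\<lambda>z. f (u *v z)) \<in> harmonics a b"
proof (cases "a = 0 \<or> b = 0")
  case True
  then show ?thesis using bihom_linear_substitution[OF harmonics_bihom[OF f]] harmonics_boundary by blast
next
  case False
  then obtain a' b' where ab: "a = Suc a'" "b = Suc b'" by (metis not0_implies_Suc)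
  show ?thesis unfolding ab
  proof (rule orthogonal_imp_harmonic)
    show "bihom (Suc a') (Suc b') (\<lambda>z. f (u *v z))"
      using bihom_linear_substitution[OF harmonics_bihom[OF f]] ab by simp
    fix q :: "complex^'n \<Rightarrow> complex" assume q: "bihom a' b' q"
    let ?q = "\<lambda>z. q (conj_transpose u *v z)"
    have q': "bihom a' b' ?q" by (rule bihom_linear_substitution[OF q])
    have "sphere_inner (\<lambda>z. f (u *v z)) q
        = sphere_inner (\<lambda>z. f (u *v z)) (\<lambda>z. ?q (u *v z))"
      using u by (simp add: unitary_cancel)
    also have "\<dots> = sphere_inner f ?q"
      by (intro L2_inner_sphere_unitary u bihom_measurable[OF q'] bihom_measurable[OF harmonics_bihom[OF f]])
    also have "\<dots> = 0"
      using harmonics_orthogonal_lower f q' ab by blast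
    finally show "sphere_inner (\<lambda>z. f (u *v z)) q = 0" .
  qed
qed

lemma harmonic_projection_unitary:
  fixes F :: "complex^'n \<Rightarrow> complex"
  assumes u: "u \<in> unitary_group" and F: "F \<in> L2_sphere"
  shows "harmonic_projection a b (\<lambda>z. F (u *v z)) = (\<lambda>z. harmonic_projection a b F (u *v z))"
proof (rule harmonic_projection_eqI)
  show "(\<lambda>z. harmonic_projection a b F (u *v z)) \<in> harmonics a b"
    by (intro harmonics_unitary u harmonic_projection_in F)
  fix q :: "complex^'n \<Rightarrow> complex" assume q: "q \<in> harmonics a b"
  let ?q = "\<lambda>z. q (conj_transpose u *v z)"
  have q': "?q \<in> harmonics a b"
    by (intro harmonics_unitary unitary_group_conj_transpose u q)
  note meas = L2_sphere_measurable[OF F] L2_sphere_measurable[OF harmonics_L2[OF q']]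
    L2_sphere_measurable[OF harmonics_L2[OF harmonic_projection_in[OF F]]]
  have qu: "q = (\<lambda>z. ?q (u *v z))" using u by (simp add: unitary_cancel)
  have "sphere_inner (\<lambda>z. F (u *v z)) (\<lambda>z. ?q (u *v z)) = sphere_inner F ?q"
    by (intro L2_inner_sphere_unitary u meas)
  also have "\<dots> = sphere_inner (harmonic_projection a b F) ?q"
    using harmonic_projection_inner[OF F q'] by simp
  also have "\<dots> = sphere_inner (\<lambda>z. harmonic_projection a b F (u *v z)) (\<lambda>z. ?q (u *v z))"
    by (intro L2_inner_sphere_unitary[symmetric] u meas)
  finally show "sphere_inner (\<lambda>z. F (u *v z)) q
      = sphere_inner (\<lambda>z. harmonic_projection a b F (u *v z)) q"
    unfolding qu[symmetric] .
qed

section \<open>A Borel section of the unitary group over the sphere\<close>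

text \<open>
  The value \<open>1\<close> at \<open>0\<close> keeps the result on the unit circle.
\<close>
definition phase :: "complex \<Rightarrow> complex" where
  "phase w = (if w = 0 then 1 else w / complex_of_real (cmod w))"

lemma phase_norm: "phase w * cnj (phase w) = 1"
proof (cases "w = 0")
  case False
  have "w * cnj w = complex_of_real (cmod w) * complex_of_real (cmod w)"
    using complex_norm_square[of w] by (simp add: power2_eq_square)
  moreover have "phase w * cnj (phase w) = (w * cnj w) / (complex_of_real (cmod w) * complex_of_real (cmod w))"
    using False by (simp add: phase_def)
  ultimately show ?thesis using False by simp
qed (simp add: phase_def)

lemma phase_eq: "w = phase w * complex_of_real (cmod w)"
  by (simp add: phase_def)

text \<open>
  Reflection along this vector exchanges \<open>z\<close>, a point of the sphere, with the multiple \<open>\<theta> e\<close> of the base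
  vector, where \<open>\<theta>\<close> is the phase of the coordinate of \<open>z\<close> along \<open>e\<close>. With this phase the
  inner product of \<open>z\<close> and \<open>\<theta> e\<close> is real, as a reflection requires.
\<close>
definition reflector :: "'n \<Rightarrow> complex^'n \<Rightarrow> complex^'n" where
  "reflector i0 z = (\<chi> i. (if i = i0 then phase (z $ i0) else 0) - z $ i)"

text \<open>
  The unitary matrix \<open>\<theta> (1 - 2 v v\<^sup>* / |v|\<^sup>2)\<close> for the vector \<open>v\<close> above; it maps the base vector to
  \<open>z\<close>. If \<open>v = 0\<close>, division by zero leaves the scalar matrix \<open>\<theta>\<close>, which is the right value
  since then \<open>z = \<theta> e\<close>. No continuous section exists in general, but this one is Borel.
\<close>
definition householder :: "'n \<Rightarrow> complex^'n \<Rightarrow> complex^'n^'n" where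
  "householder i0 z = (\<chi> i j. phase (z $ i0) * ((if i = j then 1 else 0)
      - 2 * reflector i0 z $ i * cnj (reflector i0 z $ j) / (\<Sum>k\<in>UNIV. reflector i0 z $ k * cnj (reflector i0 z $ k))))"

lemma householder_unitary: "householder i0 z \<in> unitary_group"
proof -
  define v where "v = reflector i0 z"
  define s where "s = (\<Sum>k\<in>UNIV. v $ k * cnj (v $ k))"
  define t where "t = inverse s"
  define H where "H = (\<lambda>i j. (if i = j then 1 else 0) - 2 * v $ i * cnj (v $ j) * t)"
  have ct: "cnj t = t" unfolding t_def s_def by (simp add: cnj_sum mult.commute)
  \<comment> \<open>By the convention for division by zero this also holds for \<open>s = 0\<close>.\<close>
  have tts: "t * t * s = t" by (cases "s = 0") (simp_all add: t_def)
  have cH: "cnj (H i j) = H j i" for i j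
    unfolding H_def by (simp add: ct ac_simps)
  have HH: "(\<Sum>k\<in>UNIV. H i k * H k j) = (if i = j then 1 else 0)" for i j
  proof -
    have "(\<Sum>k\<in>UNIV. H i k * H k j) = (\<Sum>k\<in>UNIV. (if i = k then H k j else 0)
        + (if k = j then - (2 * v $ i * cnj (v $ k) * t) else 0) + 4 * v $ i * cnj (v $ j) * t * t * (v $ k * cnj (v $ k)))"
      unfolding H_def by (intro sum.cong refl) (auto simp: algebra_simps)
    also have "\<dots> = H i j - 2 * v $ i * cnj (v $ j) * t + 4 * v $ i * cnj (v $ j) * t * t * s"
      unfolding s_def sum.distrib sum_distrib_left by simp
    also have "\<dots> = H i j - 2 * v $ i * cnj (v $ j) * t + 4 * v $ i * cnj (v $ j) * (t * t * s)"
      by (simp only: mult.assoc)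
    also have "\<dots> = (if i = j then 1 else 0)"
      unfolding tts H_def by simp
    finally show ?thesis .
  qed
  have hh: "householder i0 z $ i $ j = phase (z $ i0) * H i j" for i j
    by (simp add: householder_def H_def v_def s_def t_def divide_inverse)
  have hc: "conj_transpose (householder i0 z) $ i $ j = cnj (phase (z $ i0)) * H i j" for i j
    by (simp add: conj_transpose_def hh cH)
  have "(\<Sum>k\<in>UNIV. (cnj (phase (z $ i0)) * H i k) * (phase (z $ i0) * H k j)) = (if i = j then 1 else 0)" for i j
  proof -
    have "(\<Sum>k\<in>UNIV. (cnj (phase (z $ i0)) * H i k) * (phase (z $ i0) * H k j))
        = (phase (z $ i0) * cnj (phase (z $ i0))) * (\<Sum>k\<in>UNIV. H i k * H k j)"
      unfolding sum_distrib_left by (intro sum.cong) auto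
    then show ?thesis by (simp only: phase_norm HH mult_1_left)
  qed
  moreover have "(\<Sum>k\<in>UNIV. (phase (z $ i0) * H i k) * (cnj (phase (z $ i0)) * H k j)) = (if i = j then 1 else 0)" for i j
  proof -
    have "(\<Sum>k\<in>UNIV. (phase (z $ i0) * H i k) * (cnj (phase (z $ i0)) * H k j))
        = (phase (z $ i0) * cnj (phase (z $ i0))) * (\<Sum>k\<in>UNIV. H i k * H k j)"
      unfolding sum_distrib_left by (intro sum.cong) auto
    then show ?thesis by (simp only: phase_norm HH mult_1_left)
  qed
  ultimately show ?thesis
    by (simp add: unitary_group_def vec_eq_iff matrix_matrix_mult_def hh hc mat_def)
qed

lemma householder_column:
  assumes z: "norm z = 1"
  shows "householder i0 z *v axis i0 1 = z"
proof -
  define v where "v = reflector i0 z"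
  define s where "s = (\<Sum>k\<in>UNIV. v $ k * cnj (v $ k))"
  let ?\<theta> = "phase (z $ i0)" and ?r = "complex_of_real (cmod (z $ i0))"
  have v: "v $ i = (if i = i0 then ?\<theta> else 0) - z $ i" for i by (simp add: v_def reflector_def)
  have zr: "z $ i0 = ?\<theta> * ?r" by (rule phase_eq)
  have v0: "v $ i0 = ?\<theta> * (1 - ?r)" 
  proof -
    have "v $ i0 = ?\<theta> - z $ i0" by (simp add: v)
    also have "\<dots> = ?\<theta> - ?\<theta> * ?r" by (simp only: zr[symmetric])
    finally show ?thesis by (simp add: algebra_simps)
  qed
  have cv0: "cnj (v $ i0) = cnj ?\<theta> * (1 - ?r)" unfolding v0 by simp
  have one: "(\<Sum>k\<in>UNIV. z $ k * cnj (z $ k)) = 1" using norm_sq_complex_vec[of z] z by simp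
  have "s = (\<Sum>k\<in>UNIV. z $ k * cnj (z $ k) + (if k = i0 then ?\<theta> * cnj ?\<theta> - ?\<theta> * cnj (z $ k) - z $ k * cnj ?\<theta> else 0))"
    unfolding s_def v by (intro sum.cong) (auto simp: algebra_simps)
  also have "\<dots> = 1 + (?\<theta> * cnj ?\<theta> - ?\<theta> * cnj (z $ i0) - z $ i0 * cnj ?\<theta>)"
    by (simp add: sum.distrib one)
  also have "\<dots> = 1 + (1 - ?\<theta> * cnj ?\<theta> * ?r - ?\<theta> * cnj ?\<theta> * ?r)"
  proof -
    have "?\<theta> * cnj (z $ i0) = ?\<theta> * cnj (?\<theta> * ?r)" "z $ i0 * cnj ?\<theta> = ?\<theta> * ?r * cnj ?\<theta>"
      by (simp_all only: zr[symmetric])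
    then show ?thesis using phase_norm[of "z $ i0"]
      by (simp only: complex_cnj_mult complex_cnj_complex_of_real) algebra
  qed
  finally have s: "s = 2 - 2 * ?r" using phase_norm[of "z $ i0"] by algebra
  have col: "?\<theta> * ((if i = i0 then 1 else 0) - 2 * v $ i * cnj (v $ i0) / s) = z $ i" for i
  proof (cases "s = 0")
    case True
    have "v = 0" using norm_sq_complex_vec[of v] True by (simp add: s_def)
    then have "v $ i = 0" by simp
    then show ?thesis using v[of i] by (auto split: if_splits)
  next
    case False
    have "2 * v $ i * cnj (v $ i0) = v $ i * cnj ?\<theta> * s"
      unfolding cv0 s by (simp add: algebra_simps)
    then have "2 * v $ i * cnj (v $ i0) / s = v $ i * cnj ?\<theta>"
      using nonzero_divide_eq_eq[OF False] by blast
    then have "?\<theta> * ((if i = i0 then 1 else 0) - 2 * v $ i * cnj (v $ i0) / s)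
        = (if i = i0 then ?\<theta> else 0) - v $ i * (?\<theta> * cnj ?\<theta>)"
      by (simp add: algebra_simps)
    then show ?thesis by (simp add: phase_norm v)
  qed
  show ?thesis
    using col[unfolded s_def v_def]
    by (simp add: vec_eq_iff matrix_vector_mult_axis householder_def)
qed

lemma phase_measurable [measurable]: "phase \<in> borel_measurable borel"
  unfolding phase_def[abs_def] by measurable

lemma reflector_measurable [measurable]: "(\<lambda>z. reflector i0 z $ i) \<in> borel_measurable borel"
  unfolding reflector_def vec_lambda_beta by measurable

lemma householder_measurable [measurable]: "householder i0 \<in> borel_measurable borel"
proof (intro borel_measurable_vec_lambda)
  show "(\<lambda>z. householder i0 z $ i $ j) \<in> borel_measurable borel" for i j
    unfolding householder_def vec_lambda_beta by measurable
qed

section \<open>Haar measure and the sphere\<close>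

lemma
  assumes "haar_unitary \<mu>"
  shows sets_haar: "sets \<mu> = sets (restrict_space borel unitary_group)"
    and space_haar: "space \<mu> = unitary_group"
    and haar_total: "emeasure \<mu> unitary_group = 1"
    and haar_left: "u \<in> unitary_group \<Longrightarrow> distr \<mu> \<mu> (\<lambda>v. u ** v) = \<mu>"
proof -
  show s: "sets \<mu> = sets (restrict_space borel unitary_group)" using assms by (simp add: haar_unitary_def)
  show "space \<mu> = unitary_group"
    using sets_eq_imp_space_eq[OF s] by (simp add: space_restrict_space)
  then show "emeasure \<mu> unitary_group = 1" using assms by (simp add: haar_unitary_def)
  show "u \<in> unitary_group \<Longrightarrow> distr \<mu> \<mu> (\<lambda>v. u ** v) = \<mu>" using assms by (simp add: haar_unitary_def)
qed

lemma haar_finite: "haar_unitary \<mu> \<Longrightarrow> finite_measure \<mu>"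
  by (rule finite_measureI) (simp add: space_haar haar_total)

lemma haar_measurable:
  assumes "haar_unitary \<mu>" "f \<in> measurable borel N"
  shows "f \<in> measurable \<mu> N"
proof -
  have "f \<in> measurable (restrict_space borel unitary_group) N"
    using assms(2) by (rule measurable_restrict_space1)
  then show ?thesis
    using measurable_cong_sets[OF sets_haar[OF assms(1)] refl] by blast
qed

lemma haar_measurable_mult:
  fixes u :: "complex^'n^'n"
  assumes h: "haar_unitary \<mu>" and u: "u \<in> unitary_group"
  shows "(\<lambda>v. u ** v) \<in> measurable \<mu> \<mu>"
proof -
  have "(\<lambda>v :: complex^'n^'n. u ** v) \<in> borel_measurable borel"
    by (rule borel_measurable_matrix_mult[where A = "\<lambda>_. u" and B = "\<lambda>v. v"])
       (intro borel_measurable_const measurable_ident_sets refl)+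
  then have "(\<lambda>v. u ** v) \<in> borel_measurable \<mu>" by (rule haar_measurable[OF h])
  then have "(\<lambda>v. u ** v) \<in> measurable \<mu> (restrict_space borel unitary_group)"
    by (rule measurable_restrict_space2[rotated]) (auto simp: space_haar[OF h] intro: unitary_group_mult u)
  then show ?thesis
    using measurable_cong_sets[OF refl sets_haar[OF h]] by blast
qed

text \<open>
  Average \<open>1\<^sub>A(u\<^sup>* z)\<close> over \<open>u\<close> and \<open>z\<close>. Integrating first over \<open>z\<close> gives
  \<open>\<nu>(A)\<close>; integrating first over \<open>u\<close> gives a value independent of \<open>z\<close>, because \<open>z\<close> is the
  image of the base point under a unitary matrix and \<open>\<mu>\<close> is left invariant. Hence an invariant
  probability measure on the sphere is determined by \<open>\<mu>\<close>.
\<close>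
lemma invariant_sphere_measure_unique:
  fixes \<nu> :: "(complex^'n) measure" and i0 :: 'n
  assumes h: "haar_unitary \<mu>" and sets: "sets \<nu> = sets borel" and fin: "finite_measure \<nu>"
    and one: "emeasure \<nu> UNIV = 1" and sphere: "AE z in \<nu>. norm z = 1"
    and inv: "\<And>u. u \<in> unitary_group \<Longrightarrow> distr \<nu> borel ((*v) u) = \<nu>"
    and A: "A \<in> sets borel"
  shows "emeasure \<nu> A = (\<integral>\<^sup>+u. indicator A (conj_transpose u *v axis i0 1) \<partial>\<mu>)" (is "_ = ?m")
proof -
  interpret M: finite_measure \<mu> by (rule haar_finite[OF h])
  interpret N: finite_measure \<nu> by (rule fin)
  interpret P: pair_sigma_finite \<mu> \<nu> ..
  note sp = sets_eq_imp_space_eq[OF sets]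
  have mA: "(indicator A :: _ \<Rightarrow> ennreal) \<in> borel_measurable borel" using A by simp
  have mult: "((*v) u) \<in> measurable \<nu> borel" for u :: "complex^'n^'n"
    using measurable_cong_sets[OF sets refl]
      borel_measurable_matrix_vector_mult[OF borel_measurable_const measurable_ident_sets[OF refl]] by blast
  have joint: "(\<lambda>p. conj_transpose (fst p) *v snd p) \<in> borel_measurable (\<mu> \<Otimes>\<^sub>M \<nu>)"
  proof (intro borel_measurable_matrix_vector_mult borel_measurable_conj_transpose)
    have "(\<lambda>x :: complex^'n^'n. x) \<in> borel_measurable \<mu>" by (rule haar_measurable[OF h]) simp
    from measurable_compose[OF measurable_fst[of \<mu> \<nu>] this] show "fst \<in> borel_measurable (\<mu> \<Otimes>\<^sub>M \<nu>)" by simp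
    have "(\<lambda>x :: complex^'n. x) \<in> borel_measurable \<nu>" by (rule measurable_ident_sets[OF sets])
    from measurable_compose[OF measurable_snd[of \<mu> \<nu>] this] show "snd \<in> borel_measurable (\<mu> \<Otimes>\<^sub>M \<nu>)" by simp
  qed
  have "emeasure \<nu> A = (\<integral>\<^sup>+u. emeasure \<nu> A \<partial>\<mu>)"
    by (simp add: space_haar[OF h] haar_total[OF h])
  also have "\<dots> = (\<integral>\<^sup>+u. (\<integral>\<^sup>+z. indicator A (conj_transpose u *v z) \<partial>\<nu>) \<partial>\<mu>)"
  proof (rule nn_integral_cong)
    fix u :: "complex^'n^'n" assume "u \<in> space \<mu>"
    then have u: "conj_transpose u \<in> unitary_group"
      using space_haar[OF h] unitary_group_conj_transpose by blast
    have "emeasure \<nu> A = (\<integral>\<^sup>+z. indicator A z \<partial>distr \<nu> borel ((*v) (conj_transpose u)))"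
      using A sets by (simp add: inv[OF u])
    also have "\<dots> = (\<integral>\<^sup>+z. indicator A (conj_transpose u *v z) \<partial>\<nu>)"
      by (rule nn_integral_distr[OF mult]) (use mA in simp)
    finally show "emeasure \<nu> A = (\<integral>\<^sup>+z. indicator A (conj_transpose u *v z) \<partial>\<nu>)" .
  qed
  also have "\<dots> = (\<integral>\<^sup>+z. (\<integral>\<^sup>+u. indicator A (conj_transpose u *v z) \<partial>\<mu>) \<partial>\<nu>)"
    using measurable_compose[OF joint mA] by (intro P.Fubini'[symmetric]) (simp add: case_prod_beta')
  also have "\<dots> = (\<integral>\<^sup>+z. ?m \<partial>\<nu>)"
  proof (rule nn_integral_cong_AE)
    show "AE z in \<nu>. (\<integral>\<^sup>+u. indicator A (conj_transpose u *v z) \<partial>\<mu>) = ?m"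
      using sphere
    proof eventually_elim
      case (elim z)
      define v where "v = householder i0 z"
      have v: "v \<in> unitary_group" and ve: "v *v axis i0 1 = z"
        using householder_unitary householder_column[OF elim] by (auto simp: v_def)
      have vu: "conj_transpose (v ** u) *v z = conj_transpose u *v axis i0 1" for u
        unfolding conj_transpose_mult ve[symmetric] matrix_vector_mul_assoc[symmetric] unitary_cancel(1)[OF v] ..
      have cz: "(\<lambda>u. indicator A (conj_transpose u *v z) :: ennreal) \<in> borel_measurable \<mu>"
        by (rule haar_measurable[OF h], rule measurable_compose[OF _ mA],
            intro borel_measurable_matrix_vector_mult borel_measurable_conj_transpose borel_measurable_const
              measurable_ident_sets refl)
      have "(\<integral>\<^sup>+u. indicator A (conj_transpose u *v z) \<partial>\<mu>)
          = (\<integral>\<^sup>+u. indicator A (conj_transpose u *v z) \<partial>distr \<mu> \<mu> (\<lambda>u. v ** u))"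
        by (simp only: haar_left[OF h v])
      also have "\<dots> = (\<integral>\<^sup>+u. indicator A (conj_transpose (v ** u) *v z) \<partial>\<mu>)"
        by (rule nn_integral_distr[OF haar_measurable_mult[OF h v]]) (simp add: cz haar_left[OF h v])
      also have "\<dots> = ?m" by (simp only: vu)
      finally show ?case .
    qed
  qed
  also have "\<dots> = ?m" using one sp by simp
  finally show ?thesis .
qed

text \<open>
  Both measures are invariant probability measures on the sphere, so the previous lemma expresses both by the
  same integral over \<open>\<mu>\<close>. The integrand involves the inverse of the group element, so that only the left
  invariance of \<open>\<mu>\<close> enters.
\<close>
lemma distr_haar_sphere:
  fixes \<mu> :: "(complex^'n^'n) measure" and i0 :: 'n
  assumes h: "haar_unitary \<mu>"
  shows "distr \<mu> borel (\<lambda>u. u *v axis i0 1) = sphere_measure"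
proof -
  interpret M: finite_measure \<mu> by (rule haar_finite[OF h])
  have ev: "(\<lambda>u. u *v axis i0 1) \<in> borel_measurable \<mu>"
    by (rule haar_measurable[OF h])
       (intro borel_measurable_matrix_vector_mult borel_measurable_const measurable_ident_sets refl)
  let ?N = "distr \<mu> borel (\<lambda>u. u *v axis i0 1)"
  have n: "emeasure ?N A = (\<integral>\<^sup>+u. indicator A (conj_transpose u *v axis i0 1) \<partial>\<mu>)" if A: "A \<in> sets borel" for A
  proof (rule invariant_sphere_measure_unique[OF h _ _ _ _ _ A])
    show "finite_measure ?N" by (rule M.finite_measure_distr[OF ev])
    show "emeasure ?N UNIV = 1"
      using ev by (simp add: emeasure_distr space_haar[OF h] haar_total[OF h])
    have "AE u in \<mu>. norm (u *v axis i0 1 :: complex^'n) = 1"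
      by (rule AE_I2) (simp add: space_haar[OF h] norm_unitary)
    moreover have "{z :: complex^'n. norm z = 1} \<in> sets borel"
    proof -
      have "{z :: complex^'n. norm z = 1} = sphere 0 1" by (auto simp: dist_norm)
      then show ?thesis by simp
    qed
    ultimately show "AE z in ?N. norm z = 1"
      by (subst AE_distr_iff[OF ev]) auto
    fix w :: "complex^'n^'n" assume w: "w \<in> unitary_group"
    have mw: "((*v) w) \<in> borel_measurable borel"
      by (rule borel_measurable_matrix_vector_mult[where A = "\<lambda>_. w" and v = "\<lambda>z. z"])
         (intro borel_measurable_const measurable_ident_sets refl)+
    have "distr ?N borel ((*v) w) = distr \<mu> borel (\<lambda>u. (w ** u) *v axis i0 1)"
      by (subst distr_distr[OF mw ev]) (simp add: o_def matrix_vector_mul_assoc)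
    also have "\<dots> = distr (distr \<mu> \<mu> (\<lambda>u. w ** u)) borel (\<lambda>u. u *v axis i0 1)"
      by (subst distr_distr[OF ev haar_measurable_mult[OF h w]]) (simp add: o_def)
    finally show "distr ?N borel ((*v) w) = ?N" by (simp only: haar_left[OF h w])
  qed simp
  have s: "emeasure sphere_measure A = (\<integral>\<^sup>+u. indicator A (conj_transpose u *v axis i0 1) \<partial>\<mu>)"
    if A: "A \<in> sets borel" for A
  proof (rule invariant_sphere_measure_unique[OF h _ _ _ _ _ A])
    show "emeasure (sphere_measure :: (complex^'n) measure) UNIV = 1"
      using emeasure_unit_ball[where 'a = "complex^'n"]
      by (simp add: emeasure_sphere_measure ennreal_divide_self less_top zero_less_iff_neq_zero)
  qed (auto simp: AE_sphere_measure sphere_measure_unitary sphere_measure.finite_measure_axioms)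
  show ?thesis by (rule measure_eqI) (auto simp: n s)
qed

section \<open>Determinants over a finite index set\<close>

text \<open>
  The determinant of the square matrix \<open>A\<close> whose rows and columns are indexed by the finite set \<open>S\<close>.
\<close>
definition leibniz :: "'b set \<Rightarrow> ('b \<Rightarrow> 'b \<Rightarrow> real) \<Rightarrow> real" where
  "leibniz S A = (\<Sum>\<sigma> | \<sigma> permutes S. of_int (sign \<sigma>) * (\<Prod>b\<in>S. A b (\<sigma> b)))"

lemma leibniz_permute_rows:
  assumes S: "finite S" and p: "p permutes S"
  shows "leibniz S (\<lambda>b. A (p b)) = of_int (sign p) * leibniz S A"
proof -
  have "leibniz S (\<lambda>b. A (p b)) = (\<Sum>\<sigma> | \<sigma> permutes S. of_int (sign (\<sigma> \<circ> p)) * (\<Prod>b\<in>S. A (p b) ((\<sigma> \<circ> p) b)))"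
    unfolding leibniz_def by (rule sum_permutations_compose_right[OF p])
  also have "\<dots> = (\<Sum>\<sigma> | \<sigma> permutes S. of_int (sign p) * (of_int (sign \<sigma>) * (\<Prod>b\<in>S. A b (\<sigma> b))))"
  proof (intro sum.cong refl)
    fix \<sigma> assume "\<sigma> \<in> {\<sigma>. \<sigma> permutes S}"
    then have "sign (\<sigma> \<circ> p) = sign \<sigma> * sign p"
      using S p by (intro sign_compose permutes_imp_permutation) auto
    moreover have "(\<Prod>b\<in>S. A b (\<sigma> b)) = (\<Prod>b\<in>S. A (p b) ((\<sigma> \<circ> p) b))"
      using prod.permute[OF p, of "\<lambda>b. A b (\<sigma> b)"] by (simp add: o_def)
    ultimately show "of_int (sign (\<sigma> \<circ> p)) * (\<Prod>b\<in>S. A (p b) ((\<sigma> \<circ> p) b))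
        = of_int (sign p) * (of_int (sign \<sigma>) * (\<Prod>b\<in>S. A b (\<sigma> b)))"
      by simp
  qed
  finally show ?thesis by (simp add: leibniz_def sum_distrib_left)
qed

lemma leibniz_equal_rows:
  assumes S: "finite S" and ij: "i \<in> S" "j \<in> S" "i \<noteq> j" and eq: "A i = A j"
  shows "leibniz S A = 0"
proof -
  have p: "Transposition.transpose i j permutes S" using ij by (simp add: permutes_swap_id)
  have "(\<lambda>b. A (Transposition.transpose i j b)) = A" using eq by (auto simp: fun_eq_iff Transposition.transpose_def)
  then have "leibniz S A = - leibniz S A"
    using leibniz_permute_rows[OF S p, of A] ij by (simp add: sign_swap_id)
  then show ?thesis by simp
qed

text \<open>
  Expanding the product of the sums gives a sum over all maps \<open>f\<close> from \<open>S\<close> to itself; maps that are not injective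
  give a determinant with two equal rows, and the others are permutations of the rows of \<open>B\<close>.
\<close>
lemma leibniz_mult:
  assumes S: "finite S"
  shows "leibniz S (\<lambda>b d. \<Sum>c\<in>S. A b c * B c d) = leibniz S A * leibniz S B"
proof -
  have "leibniz S (\<lambda>b d. \<Sum>c\<in>S. A b c * B c d)
      = (\<Sum>\<sigma> | \<sigma> permutes S. of_int (sign \<sigma>) * (\<Sum>f\<in>S \<rightarrow>\<^sub>E S. \<Prod>b\<in>S. A b (f b) * B (f b) (\<sigma> b)))"
    unfolding leibniz_def by (intro sum.cong refl) (simp add: prod_sum_PiE[OF S] S)
  also have "\<dots> = (\<Sum>f\<in>S \<rightarrow>\<^sub>E S. (\<Prod>b\<in>S. A b (f b)) * leibniz S (\<lambda>b. B (f b)))"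
    unfolding leibniz_def sum_distrib_left
    by (subst sum.swap) (simp add: prod.distrib ac_simps)
  also have "\<dots> = (\<Sum>f | f \<in> S \<rightarrow>\<^sub>E S \<and> inj_on f S. (\<Prod>b\<in>S. A b (f b)) * leibniz S (\<lambda>b. B (f b)))"
  proof (rule sum.mono_neutral_right)
    show "finite (S \<rightarrow>\<^sub>E S)" using S by (intro finite_PiE) auto
    show "\<forall>f\<in>(S \<rightarrow>\<^sub>E S) - {f \<in> S \<rightarrow>\<^sub>E S. inj_on f S}. (\<Prod>b\<in>S. A b (f b)) * leibniz S (\<lambda>b. B (f b)) = 0"
    proof
      fix f assume "f \<in> (S \<rightarrow>\<^sub>E S) - {f \<in> S \<rightarrow>\<^sub>E S. inj_on f S}"
      then have "\<not> inj_on f S" by simp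
      then obtain i j where "i \<in> S" "j \<in> S" "i \<noteq> j" "f i = f j" by (auto simp: inj_on_def)
      then have "leibniz S (\<lambda>b. B (f b)) = 0" by (intro leibniz_equal_rows[OF S, of i j]) auto
      then show "(\<Prod>b\<in>S. A b (f b)) * leibniz S (\<lambda>b. B (f b)) = 0" by simp
    qed
  qed auto
  also have "\<dots> = (\<Sum>p | p permutes S. (\<Prod>b\<in>S. A b (p b)) * leibniz S (\<lambda>b. B (p b)))"
  proof (rule sum.reindex_bij_witness[of _ "\<lambda>p. restrict p S" "\<lambda>f x. if x \<in> S then f x else x"])
    fix f assume f: "f \<in> {f. f \<in> S \<rightarrow>\<^sub>E S \<and> inj_on f S}"
    then show "restrict (\<lambda>x. if x \<in> S then f x else x) S = f"
      by (auto simp: fun_eq_iff PiE_def extensional_def restrict_def)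
    have "bij_betw (\<lambda>x. if x \<in> S then f x else x) S S"
    proof -
      have "bij_betw f S S" using f S
        by (auto simp: bij_betw_def endo_inj_surj image_subset_iff PiE_def Pi_def)
      then show ?thesis by (subst bij_betw_cong[where g = f]) auto
    qed
    then show "(\<lambda>x. if x \<in> S then f x else x) \<in> {p. p permutes S}"
      by (auto intro: bij_imp_permutes)
    have "leibniz S (\<lambda>b. B (if b \<in> S then f b else b)) = leibniz S (\<lambda>b. B (f b))"
      unfolding leibniz_def by (intro sum.cong refl arg_cong2[where f = "(*)"] prod.cong) auto
    then show "(\<Prod>b\<in>S. A b (if b \<in> S then f b else b)) * leibniz S (\<lambda>b. B (if b \<in> S then f b else b))
        = (\<Prod>b\<in>S. A b (f b)) * leibniz S (\<lambda>b. B (f b))"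
      by simp
  next
    fix p assume p: "p \<in> {p. p permutes S}"
    then show "(\<lambda>x. if x \<in> S then restrict p S x else x) = p"
      by (auto simp: fun_eq_iff permutes_not_in)
    show "restrict p S \<in> {f. f \<in> S \<rightarrow>\<^sub>E S \<and> inj_on f S}"
      using p by (auto simp: permutes_in_image permutes_inj_on inj_on_restrict_eq)
  qed
  also have "\<dots> = (\<Sum>p | p permutes S. (of_int (sign p) * (\<Prod>b\<in>S. A b (p b))) * leibniz S B)"
    by (intro sum.cong refl) (simp add: leibniz_permute_rows[OF S])
  finally show ?thesis by (simp add: leibniz_def sum_distrib_right)
qed

lemma leibniz_identity:
  assumes S: "finite S"
  shows "leibniz S (\<lambda>b c. if b = c then 1 else 0) = 1"
proof -
  have "leibniz S (\<lambda>b c. if b = c then 1 else 0) = (\<Sum>\<sigma> | \<sigma> permutes S. if \<sigma> = id then 1 else 0)"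
    unfolding leibniz_def
  proof (intro sum.cong refl)
    fix \<sigma> assume "\<sigma> \<in> {\<sigma>. \<sigma> permutes S}"
    then have \<sigma>: "\<sigma> permutes S" by simp
    show "of_int (sign \<sigma>) * (\<Prod>b\<in>S. if b = \<sigma> b then 1 else (0::real)) = (if \<sigma> = id then 1 else 0)"
    proof (cases "\<sigma> = id")
      case False
      then obtain b where "\<sigma> b \<noteq> b" by (auto simp: fun_eq_iff)
      moreover from this have "b \<in> S" using \<sigma> permutes_not_in by metis
      ultimately have "(\<Prod>b\<in>S. if b = \<sigma> b then 1 else (0::real)) = 0"
        using S by (intro prod_zero bexI[of _ b]) auto
      then show ?thesis using False by simp
    qed simp
  qed
  also have "\<dots> = 1" using S by (simp add: finite_permutations permutes_id)
  finally show ?thesis .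
qed

lemma det_on_eq_leibniz: "det_on V L = leibniz (Basis \<inter> V) (\<lambda>b c. L b \<bullet> c)"
  by (simp add: det_on_def leibniz_def)

lemma det_on_compose:
  fixes L K :: "'a::euclidean_space \<Rightarrow> 'a"
  assumes L: "linear L" and V: "\<And>x. x \<in> V \<Longrightarrow> x = (\<Sum>c\<in>Basis \<inter> V. (x \<bullet> c) *\<^sub>R c)"
    and K: "\<And>x. x \<in> V \<Longrightarrow> K x \<in> V"
  shows "det_on V (\<lambda>x. L (K x)) = det_on V K * det_on V L"
proof -
  have "L (K b) \<bullet> d = (\<Sum>c\<in>Basis \<inter> V. (K b \<bullet> c) * (L c \<bullet> d))" if "b \<in> Basis \<inter> V" for b d
  proof -
    have "L (K b) = L (\<Sum>c\<in>Basis \<inter> V. (K b \<bullet> c) *\<^sub>R c)" using V[OF K] that by simp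
    then show ?thesis by (simp add: linear_sum[OF L] linear_scale[OF L] inner_sum_left)
  qed
  then have "det_on V (\<lambda>x. L (K x)) = leibniz (Basis \<inter> V) (\<lambda>b d. \<Sum>c\<in>Basis \<inter> V. (K b \<bullet> c) * (L c \<bullet> d))"
    unfolding det_on_eq_leibniz leibniz_def
    by (intro sum.cong refl arg_cong2[where f = "(*)"] prod.cong) auto
  then show ?thesis by (simp only: leibniz_mult[OF finite_Int[OF disjI1[OF finite_Basis]]] det_on_eq_leibniz)
qed

section \<open>The modulus of the parabolic subgroup\<close>

lemma nilradical_expansion:
  fixes X :: "complex^'n^'n"
  assumes X: "X \<in> nilradical i0"
  shows "X = (\<Sum>c\<in>Basis \<inter> nilradical i0. (X \<bullet> c) *\<^sub>R c)"
proof -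
  have "X \<bullet> c = 0" if c: "c \<in> Basis - nilradical i0" for c
  proof -
    obtain i j u where cu: "c = axis i (axis j u)" using c by (auto simp: Basis_vec_def)
    have "\<not> (i = i0 \<and> j \<noteq> i0)"
    proof
      assume "i = i0 \<and> j \<noteq> i0"
      then have "c \<in> nilradical i0" by (auto simp: nilradical_def cu axis_def)
      then show False using c by simp
    qed
    then have "X $ i $ j = 0" using X unfolding nilradical_def by blast
    then show ?thesis by (simp add: cu inner_axis)
  qed
  then have "(\<Sum>c\<in>Basis \<inter> nilradical i0. (X \<bullet> c) *\<^sub>R c) = (\<Sum>c\<in>Basis. (X \<bullet> c) *\<^sub>R c)"
    by (intro sum.mono_neutral_left) auto
  then show ?thesis by (simp add: euclidean_representation)
qed

text \<open>
  The parabolic subgroup is the stabilizer of the line of the base vector.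
\<close>
lemma parabolic_iff:
  fixes p :: "complex^'n^'n"
  shows "p \<in> parabolic i0 \<longleftrightarrow> p \<in> GL \<and> p *v axis i0 1 = (p $ i0 $ i0) *s axis i0 1"
  by (auto simp: parabolic_def vec_eq_iff matrix_vector_mult_axis axis_component)

lemma parabolicI:
  fixes p :: "complex^'n^'n"
  assumes "p \<in> GL" "p *v axis i0 1 = w *s axis i0 1"
  shows "p \<in> parabolic i0" "p $ i0 $ i0 = w"
proof -
  have "(p *v axis i0 1) $ i0 = (w *s axis i0 1) $ i0" using assms(2) by simp
  then show "p $ i0 $ i0 = w" by (simp add: matrix_vector_mult_axis axis_component)
  then show "p \<in> parabolic i0" using assms by (simp add: parabolic_iff)
qed

lemma GL_inj: "p \<in> GL \<Longrightarrow> p *v (x :: complex^'n) = 0 \<Longrightarrow> x = 0"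
proof -
  assume p: "p \<in> GL" and "p *v x = 0"
  then have "matrix_inv p *v (p *v x) = 0" by simp
  then show "x = 0" using p by (simp add: matrix_vector_mul_assoc matrix_inv_left_right)
qed

lemma parabolic_nonzero: "p \<in> parabolic i0 \<Longrightarrow> (p :: complex^'n^'n) $ i0 $ i0 \<noteq> 0"
proof
  assume p: "p \<in> parabolic i0" and z: "p $ i0 $ i0 = 0"
  then have "p *v axis i0 1 = 0" by (simp add: parabolic_iff)
  then have "axis i0 (1::complex) = (0 :: complex^'n)"
    using p GL_inj[of p "axis i0 1"] by (simp add: parabolic_iff)
  then have "axis i0 (1::complex) $ i0 = (0 :: complex^'n) $ i0" by simp
  then show False by (simp add: axis_component)
qed

lemma parabolic_mult:
  fixes p q :: "complex^'n^'n"
  assumes p: "p \<in> parabolic i0" and q: "q \<in> parabolic i0"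
  shows "p ** q \<in> parabolic i0" "(p ** q) $ i0 $ i0 = p $ i0 $ i0 * q $ i0 $ i0"
proof -
  have "(p ** q) *v axis i0 1 = p *v (q *v axis i0 1)" by (simp add: matrix_vector_mul_assoc)
  also have "\<dots> = q $ i0 $ i0 *s (p *v axis i0 1)"
    using q by (simp add: parabolic_iff vector_scalar_commute)
  also have "\<dots> = (p $ i0 $ i0 * q $ i0 $ i0) *s axis i0 1"
    using p by (simp add: parabolic_iff vec_eq_iff)
  finally have e: "(p ** q) *v axis i0 1 = (p $ i0 $ i0 * q $ i0 $ i0) *s axis i0 1" .
  have "p ** q \<in> GL" using p q by (intro GL_mult) (simp_all add: parabolic_def)
  from parabolicI[OF this e]
  show "p ** q \<in> parabolic i0" "(p ** q) $ i0 $ i0 = p $ i0 $ i0 * q $ i0 $ i0" .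
qed

lemma parabolic_inv:
  fixes p :: "complex^'n^'n"
  assumes p: "p \<in> parabolic i0"
  shows "matrix_inv p \<in> parabolic i0"
proof -
  have pG: "p \<in> GL" using p by (simp add: parabolic_def)
  let ?w = "p $ i0 $ i0"
  have "axis i0 1 = matrix_inv p *v (p *v axis i0 (1 :: complex))"
    by (simp add: matrix_vector_mul_assoc matrix_inv_left_right[OF pG])
  also have "p *v axis i0 (1 :: complex) = ?w *s axis i0 1" using p by (simp add: parabolic_iff)
  also have "matrix_inv p *v (?w *s axis i0 1) = ?w *s (matrix_inv p *v axis i0 1)"
    by (simp add: vector_scalar_commute)
  finally have "inverse ?w *s axis i0 1 = inverse ?w *s (?w *s (matrix_inv p *v axis i0 1))" by simp
  then have "matrix_inv p *v axis i0 1 = inverse ?w *s axis i0 1"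
    using parabolic_nonzero[OF p] by (simp add: vec_eq_iff)
  then show ?thesis using parabolicI(1) GL_matrix_inv[OF pG] by blast
qed

lemma nilradical_mult_left:
  fixes A :: "complex^'n^'n"
  assumes A: "A \<in> parabolic i0" and X: "X \<in> nilradical i0"
  shows "A ** X \<in> nilradical i0"
  unfolding nilradical_def
proof (intro CollectI allI impI)
  fix i j assume ij: "\<not> (i = i0 \<and> j \<noteq> i0)"
  have zero: "A $ i $ k * X $ k $ j = 0" for k
  proof (cases "k = i0 \<and> j \<noteq> i0")
    case True
    then have "A $ i $ k = 0" using A ij by (auto simp: parabolic_def)
    then show ?thesis by simp
  next
    case False
    then have "X $ k $ j = 0" using X unfolding nilradical_def by blast
    then show ?thesis by simp
  qed
  show "(A ** X) $ i $ j = 0"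
    by (simp only: matrix_matrix_mult_def vec_lambda_beta zero sum.neutral_const)
qed

lemma nilradical_mult_right:
  fixes A :: "complex^'n^'n"
  assumes A: "A \<in> parabolic i0" and X: "X \<in> nilradical i0"
  shows "X ** A \<in> nilradical i0"
  unfolding nilradical_def
proof (intro CollectI allI impI)
  fix i j assume ij: "\<not> (i = i0 \<and> j \<noteq> i0)"
  have zero: "X $ i $ k * A $ k $ j = 0" for k
  proof (cases "i = i0 \<and> k \<noteq> i0")
    case True
    then have "A $ k $ j = 0" using A ij by (auto simp: parabolic_def)
    then show ?thesis by simp
  next
    case False
    then have "X $ i $ k = 0" using X unfolding nilradical_def by blast
    then show ?thesis by simp
  qed
  show "(X ** A) $ i $ j = 0"
    by (simp only: matrix_matrix_mult_def vec_lambda_beta zero sum.neutral_const)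
qed

lemma Ad_nilradical: "p \<in> parabolic i0 \<Longrightarrow> X \<in> nilradical i0 \<Longrightarrow> Ad p X \<in> nilradical i0"
  unfolding Ad_def by (intro nilradical_mult_right nilradical_mult_left parabolic_inv)

lemma linear_Ad: "linear (Ad p)"
proof (rule linearI)
  show "Ad p (X + Y) = Ad p X + Ad p Y" for X Y
    by (simp add: Ad_def matrix_matrix_mult_def vec_eq_iff sum.distrib distrib_left distrib_right)
  show "Ad p (r *\<^sub>R X) = r *\<^sub>R Ad p X" for r X
    by (simp add: Ad_def matrix_matrix_mult_def vec_eq_iff scaleR_sum_right scaleR_sum_left
        sum_distrib_right sum_distrib_left)
qed

lemma modulus_mult:
  fixes p q :: "complex^'n^'n"
  assumes p: "p \<in> parabolic i0" and q: "q \<in> parabolic i0"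
  shows "modulus i0 (p ** q) = modulus i0 p * modulus i0 q"
proof -
  have G: "p \<in> GL" "q \<in> GL" using p q by (auto simp: parabolic_def)
  have "Ad (p ** q) = (\<lambda>X. Ad p (Ad q X))"
    by (simp add: Ad_def fun_eq_iff matrix_inv_mult[OF G] matrix_mul_assoc)
  then have "det_on (nilradical i0) (Ad (p ** q)) = det_on (nilradical i0) (Ad q) * det_on (nilradical i0) (Ad p)"
    using det_on_compose[OF linear_Ad nilradical_expansion Ad_nilradical[OF q]] by simp
  then show ?thesis by (simp add: modulus_def abs_mult)
qed

lemma modulus_one:
  fixes i0 :: "'n::finite"
  shows "modulus i0 (mat 1) = 1"
proof -
  have "matrix_inv (mat 1) = (mat 1 :: complex^'n^'n)" by (rule matrix_inv_unique) simp_all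
  then have Ad1: "Ad (mat 1) X = X" for X :: "complex^'n^'n" by (simp add: Ad_def)
  have "det_on (nilradical i0) (Ad (mat 1))
      = leibniz (Basis \<inter> nilradical i0) (\<lambda>b c. if b = c then 1 else 0)"
    unfolding det_on_eq_leibniz leibniz_def Ad1
  proof (intro sum.cong refl arg_cong2[where f = "(*)"] prod.cong)
    fix \<sigma> and b :: "complex^'n^'n"
    assume \<sigma>: "\<sigma> \<in> {\<sigma>. \<sigma> permutes Basis \<inter> nilradical i0}" and b: "b \<in> Basis \<inter> nilradical i0"
    then have "\<sigma> b \<in> Basis" using permutes_in_image by fastforce
    then show "b \<bullet> \<sigma> b = (if b = \<sigma> b then 1 else 0)" using b by (simp add: inner_Basis)
  qed
  then show ?thesis by (simp add: modulus_def leibniz_identity)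
qed

lemma modulus_inv:
  fixes p :: "complex^'n^'n"
  assumes "p \<in> parabolic i0"
  shows "modulus i0 p * modulus i0 (matrix_inv p) = 1"
  using modulus_mult[OF assms parabolic_inv[OF assms]] assms
  by (simp add: matrix_inv_left_right parabolic_def modulus_one)

lemma modulus_pos:
  fixes p :: "complex^'n^'n"
  assumes "p \<in> parabolic i0"
  shows "modulus i0 p > 0"
proof -
  have "modulus i0 p \<noteq> 0" using modulus_inv[OF assms] by auto
  then show ?thesis by (simp add: modulus_def)
qed

lemma unitary_entry_le_1:
  assumes "u \<in> unitary_group"
  shows "cmod (u $ i $ j) \<le> 1"
proof -
  have "cmod ((u *v axis j 1) $ i) \<le> norm (u *v axis j (1 :: complex))"
    by (rule Finite_Cartesian_Product.norm_nth_le)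
  then show ?thesis using assms by (simp add: norm_unitary matrix_vector_mult_axis)
qed

lemma matrix_mult_entry_le:
  fixes A B :: "complex^'n^'n"
  assumes "\<And>i j. cmod (A $ i $ j) \<le> a" "\<And>i j. cmod (B $ i $ j) \<le> b"
  shows "cmod ((A ** B) $ i $ j) \<le> real CARD('n) * (a * b)"
proof -
  have a0: "0 \<le> a" using assms(1)[of i i] norm_ge_zero[of "A $ i $ i"] by linarith
  have "cmod ((A ** B) $ i $ j) \<le> (\<Sum>k\<in>UNIV. cmod (A $ i $ k * B $ k $ j))"
    by (simp add: matrix_matrix_mult_def norm_sum)
  also have "\<dots> \<le> (\<Sum>k\<in>(UNIV :: 'n set). a * b)"
    by (intro sum_mono) (simp add: norm_mult mult_mono assms a0)
  finally show ?thesis by simp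
qed

text \<open>A homomorphism from a compact group to the positive reals is bounded, hence trivial.\<close>
lemma modulus_unitary:
  fixes p :: "complex^'n^'n"
  assumes p: "p \<in> parabolic i0" "p \<in> unitary_group"
  shows "modulus i0 p = 1"
proof -
  let ?S = "Basis \<inter> nilradical i0 :: (complex^'n^'n) set"
  define C where "C = real CARD('n) * (real CARD('n) * (1 * 1) * 1)"
  \<comment> \<open>The entries of unitary and of elementary matrices are at most \<open>1\<close>, which bounds those of the products.\<close>
  define K where "K = (\<Sum>\<sigma> | \<sigma> permutes ?S. \<Prod>b\<in>?S. C)"
  have C: "C \<ge> 0" by (simp add: C_def)
  have bound: "modulus i0 q \<le> K" if q: "q \<in> unitary_group" for q :: "complex^'n^'n"
  proof -
    have entry: "\<bar>Ad q b \<bullet> c\<bar> \<le> C" if b: "b \<in> Basis" and c: "c \<in> Basis" for b c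
    proof -
      have eb: "cmod (b $ i $ j) \<le> 1" for i j
      proof -
        have "cmod (b $ i $ j) \<le> norm (b $ i)" by (rule Finite_Cartesian_Product.norm_nth_le)
        also have "\<dots> \<le> norm b" by (rule Finite_Cartesian_Product.norm_nth_le)
        finally show ?thesis using b by simp
      qed
      have AC: "cmod (Ad q b $ i $ j) \<le> C" for i j
        unfolding Ad_def C_def
      proof (intro matrix_mult_entry_le)
        show "cmod (matrix_inv q $ i $ j) \<le> 1" for i j
          using q by (simp add: matrix_inv_unitary unitary_entry_le_1 unitary_group_conj_transpose)
      qed (use q eb in \<open>auto simp: unitary_entry_le_1\<close>)
      obtain i j u where cu: "c = axis i (axis j u)" "u \<in> Basis" using c by (auto simp: Basis_vec_def)
      have "\<bar>Ad q b \<bullet> c\<bar> = \<bar>Ad q b $ i $ j \<bullet> u\<bar>" by (simp add: cu inner_axis)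
      also have "\<dots> \<le> cmod (Ad q b $ i $ j)" by (rule Basis_le_norm[OF cu(2)])
      finally show ?thesis using AC[of i j] by linarith
    qed
    have "modulus i0 q \<le> (\<Sum>\<sigma> | \<sigma> permutes ?S. \<bar>of_int (sign \<sigma>) * (\<Prod>b\<in>?S. Ad q b \<bullet> \<sigma> b)\<bar>)"
      unfolding modulus_def det_on_def by (rule sum_abs)
    also have "\<dots> \<le> K" unfolding K_def
    proof (rule sum_mono)
      fix \<sigma> assume "\<sigma> \<in> {\<sigma>. \<sigma> permutes ?S}"
      then have "\<sigma> b \<in> Basis" if "b \<in> ?S" for b using that permutes_in_image by fastforce
      then have "(\<Prod>b\<in>?S. \<bar>Ad q b \<bullet> \<sigma> b\<bar>) \<le> (\<Prod>b\<in>?S. C)"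
        by (intro prod_mono conjI entry) auto
      then show "\<bar>of_int (sign \<sigma>) * (\<Prod>b\<in>?S. Ad q b \<bullet> \<sigma> b)\<bar> \<le> (\<Prod>b\<in>?S. C)"
        by (simp add: abs_mult abs_prod sign_def)
    qed
    finally show ?thesis .
  qed
  have le: "modulus i0 q \<le> 1" if q: "q \<in> parabolic i0" "q \<in> unitary_group" for q :: "complex^'n^'n"
  proof (rule ccontr)
    assume "\<not> modulus i0 q \<le> 1"
    then obtain m where m: "K < modulus i0 q ^ m" using real_arch_pow[of "modulus i0 q" K] by auto
    have "\<exists>r. r \<in> parabolic i0 \<and> r \<in> unitary_group \<and> modulus i0 r = modulus i0 q ^ m"
    proof (induction m)
      case 0
      have "mat 1 \<in> (unitary_group :: (complex^'n^'n) set) \<and> mat 1 \<in> parabolic i0"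
      proof
        have "conj_transpose (mat 1) = (mat 1 :: complex^'n^'n)"
          by (simp add: conj_transpose_def mat_def vec_eq_iff)
        then show u: "mat 1 \<in> (unitary_group :: (complex^'n^'n) set)" by (simp add: unitary_group_def)
        show "mat 1 \<in> parabolic i0"
          using unitary_group_subset_GL[OF u] by (simp add: parabolic_def mat_def)
      qed
      then show ?case by (intro exI[of _ "mat 1"]) (simp add: modulus_one)
    next
      case (Suc m)
      then obtain r where "r \<in> parabolic i0" "r \<in> unitary_group" "modulus i0 r = modulus i0 q ^ m" by blast
      then show ?case using q
        by (intro exI[of _ "q ** r"]) (simp add: parabolic_mult unitary_group_mult modulus_mult)
    qed
    then show False using bound m by (metis not_le)
  qed
  have "matrix_inv p \<in> unitary_group" using p by (simp add: matrix_inv_unitary unitary_group_conj_transpose)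
  then have inv_le: "modulus i0 (matrix_inv p) \<le> 1" by (intro le parabolic_inv p)
  have "modulus i0 p * modulus i0 (matrix_inv p) \<le> modulus i0 p * 1"
    using inv_le modulus_pos[OF p(1)] by (intro mult_left_mono) auto
  then have "1 \<le> modulus i0 p" by (simp only: modulus_inv[OF p(1)] mult_1_right)
  then show ?thesis using le[OF p] by simp
qed

lemma norm_smult: "norm (w *s x) = cmod w * norm x" for x :: "complex^'n"
proof -
  have "complex_of_real ((norm (w *s x))\<^sup>2) = (w * cnj w) * complex_of_real ((norm x)\<^sup>2)"
    unfolding norm_sq_complex_vec by (simp add: sum_distrib_left ac_simps)
  also have "\<dots> = complex_of_real ((cmod w * norm x)\<^sup>2)"
    by (simp add: complex_norm_square[symmetric] power_mult_distrib)
  finally have "(norm (w *s x))\<^sup>2 = (cmod w * norm x)\<^sup>2" by (simp only: of_real_eq_iff)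
  then show ?thesis by (simp add: power2_eq_iff_nonneg)
qed

lemma parabolic_unitary_norm:
  fixes p :: "complex^'n^'n"
  assumes p: "p \<in> parabolic i0" "p \<in> unitary_group"
  shows "cmod (p $ i0 $ i0) = 1"
proof -
  have "norm (p *v axis i0 (1 :: complex)) = 1" using p by (simp add: norm_unitary)
  moreover have "p *v axis i0 (1 :: complex) = (p $ i0 $ i0) *s axis i0 1"
    using p by (simp add: parabolic_iff)
  ultimately show ?thesis by (simp add: norm_smult)
qed

lemma parabolic_char_eq:
  assumes "p $ i0 $ i0 \<noteq> 0"
  shows "parabolic_char i0 t k p = exp (t * complex_of_real (ln (cmod (p $ i0 $ i0))))
    * (p $ i0 $ i0 / complex_of_real (cmod (p $ i0 $ i0))) powi k"
  using assms by (simp add: parabolic_char_def Let_def powr_def Ln_of_real)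

section \<open>The Iwasawa decomposition\<close>

text \<open>The parabolic factor in \<open>g = u p\<close>, where \<open>u\<close> is chosen by the section at the point \<open>g e / |g e|\<close>.\<close>
definition parabolic_part :: "'n \<Rightarrow> complex^'n^'n \<Rightarrow> complex^'n^'n" where
  "parabolic_part i0 g = conj_transpose (householder i0 (sgn (g *v axis i0 1))) ** g"

lemma norm_axis_image_pos: "g \<in> GL \<Longrightarrow> norm (g *v axis i0 (1 :: complex)) > 0"
proof -
  assume g: "g \<in> GL"
  have "axis i0 1 \<noteq> (0 :: complex^'a)" by (simp add: vec_eq_iff axis_component)
  then have "g *v axis i0 1 \<noteq> 0" using GL_inj[OF g] by blast
  then show ?thesis by simp
qed

lemma sgn_vec_eq: "sgn x = complex_of_real (inverse (norm x)) *s x" for x :: "complex^'n"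
  by (simp add: sgn_div_norm vec_eq_iff scaleR_conv_of_real[where 'a = complex])

lemma parabolic_part_props:
  fixes g :: "complex^'n^'n"
  assumes g: "g \<in> GL"
  shows "parabolic_part i0 g \<in> parabolic i0"
    and "parabolic_part i0 g $ i0 $ i0 = complex_of_real (norm (g *v axis i0 1))"
proof -
  let ?e = "axis i0 (1 :: complex)" and ?z = "sgn (g *v axis i0 1)"
  let ?n = "complex_of_real (norm (g *v ?e))"
  have n: "norm (g *v ?e) > 0" by (rule norm_axis_image_pos[OF g])
  have z: "norm ?z = 1" using n by (simp add: norm_sgn)
  have hz: "householder i0 ?z *v ?e = ?z" by (rule householder_column[OF z])
  have u: "householder i0 ?z \<in> unitary_group" by (rule householder_unitary)
  have "g *v ?e = ?n *s ?z" using n by (simp add: sgn_vec_eq vec_eq_iff)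
  then have "parabolic_part i0 g *v ?e = conj_transpose (householder i0 ?z) *v (?n *s (householder i0 ?z *v ?e))"
    by (simp add: parabolic_part_def hz flip: matrix_vector_mul_assoc)
  also have "\<dots> = ?n *s ?e"
    unfolding vector_scalar_commute[symmetric] unitary_cancel(1)[OF u] ..
  finally have e: "parabolic_part i0 g *v ?e = ?n *s ?e" .
  have "parabolic_part i0 g \<in> GL"
    unfolding parabolic_part_def by (intro GL_mult unitary_group_subset_GL unitary_group_conj_transpose u g)
  then show "parabolic_part i0 g \<in> parabolic i0" "parabolic_part i0 g $ i0 $ i0 = ?n"
    using parabolicI e by blast+
qed

text \<open>
  The equivariance on the sphere that corresponds to the character of the parabolic subgroup, of which
  only the circle component is visible on unitary matrices.
\<close>
definition phase_equivariant :: "int \<Rightarrow> (complex^'n \<Rightarrow> complex) \<Rightarrow> bool" where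
  "phase_equivariant k F \<longleftrightarrow> (\<forall>z w. norm z = 1 \<longrightarrow> cmod w = 1 \<longrightarrow> F (w *s z) = inverse (w powi k) * F z)"

text \<open>
  The extension of \<open>F\<close> from the sphere to the group that is forced by \<open>g = u p\<close>: the equivariance factor
  of \<open>p\<close> times \<open>F(u e)\<close>. Since \<open>p\<close> has the positive entry \<open>|g e|\<close> at the base
  position, its character is \<open>|g e|\<^sup>t\<close>, here written with the real logarithm.
\<close>
definition induced_function ::
  "'n \<Rightarrow> complex \<Rightarrow> (complex^'n \<Rightarrow> complex) \<Rightarrow> complex^'n^'n \<Rightarrow> complex" where
  "induced_function i0 t F g = (if g \<in> GL then
      complex_of_real (modulus i0 (parabolic_part i0 g) powr (-1/2))
      * exp (- (t * complex_of_real (ln (norm (g *v axis i0 1))))) * F (sgn (g *v axis i0 1)) else 0)"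

lemma sgn_norm_1: "norm x = 1 \<Longrightarrow> sgn x = x" for x :: "'a::real_normed_vector"
  by (simp add: sgn_div_norm)

lemma induced_function_unitary:
  assumes u: "u \<in> unitary_group"
  shows "induced_function i0 t F u = F (u *v axis i0 1)"
proof -
  have n: "norm (u *v axis i0 (1 :: complex)) = 1" using u by (simp add: norm_unitary)
  have "parabolic_part i0 u \<in> unitary_group"
    unfolding parabolic_part_def by (intro unitary_group_mult unitary_group_conj_transpose householder_unitary u)
  then have "modulus i0 (parabolic_part i0 u) = 1"
    by (intro modulus_unitary parabolic_part_props unitary_group_subset_GL u)
  then show ?thesis using unitary_group_subset_GL[OF u]
    by (simp add: induced_function_def n sgn_norm_1)
qed

text \<open>
  Replacing \<open>g\<close> by \<open>g p\<close> multiplies the point of the sphere by the phase \<open>\<theta>\<close> of \<open>w\<close>. The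
  parabolic part changes by \<open>p\<close> on the right and on the left by a unitary matrix \<open>q\<close>, which accounts for the
  change of the section between the points \<open>z\<close> and \<open>\<theta> z\<close> and has modulus \<open>1\<close>.
\<close>
lemma induced_function_equivariant:
  fixes F :: "complex^'n \<Rightarrow> complex"
  assumes F: "phase_equivariant k F" and g: "g \<in> GL" and p: "p \<in> parabolic i0"
  shows "induced_function i0 t F (g ** p)
    = complex_of_real (modulus i0 p powr (-1/2)) * inverse (parabolic_char i0 t k p) * induced_function i0 t F g"
proof -
  let ?e = "axis i0 (1 :: complex)"
  define w where "w = p $ i0 $ i0"
  define \<theta> where "\<theta> = w / complex_of_real (cmod w)"
  define z where "z = sgn (g *v ?e)"
  have w0: "w \<noteq> 0" using parabolic_nonzero[OF p] by (simp add: w_def)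
  have \<theta>: "cmod \<theta> = 1" using w0 by (simp add: \<theta>_def norm_divide)
  have pG: "p \<in> GL" using p by (simp add: parabolic_def)
  have gpG: "g ** p \<in> GL" by (rule GL_mult[OF g pG])
  have n: "norm (g *v ?e) > 0" by (rule norm_axis_image_pos[OF g])
  have z: "norm z = 1" using n by (simp add: z_def norm_sgn)
  have gpe: "(g ** p) *v ?e = w *s (g *v ?e)"
  proof -
    have "(g ** p) *v ?e = g *v (p *v ?e)" by (simp add: matrix_vector_mul_assoc)
    also have "p *v ?e = w *s ?e" using p by (simp add: parabolic_iff w_def)
    finally show ?thesis by (simp add: vector_scalar_commute)
  qed
  have norm_gp: "norm ((g ** p) *v ?e) = cmod w * norm (g *v ?e)" by (simp only: gpe norm_smult)
  have z': "sgn ((g ** p) *v ?e) = \<theta> *s z"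
    using w0 n unfolding gpe z_def sgn_vec_eq norm_smult \<theta>_def by (simp add: vec_eq_iff field_simps)
  let ?S = "householder i0 z" and ?S' = "householder i0 (\<theta> *s z)"
  have nz': "norm (\<theta> *s z) = 1"
  proof -
    have "norm (sgn ((g ** p) *v ?e)) = 1" using norm_axis_image_pos[OF gpG] by (simp add: norm_sgn)
    then show ?thesis by (simp only: z')
  qed
  define q where "q = conj_transpose ?S' ** ?S"
  have qU: "q \<in> unitary_group"
    unfolding q_def by (intro unitary_group_mult unitary_group_conj_transpose householder_unitary)
  have \<theta>0: "\<theta> \<noteq> 0" using \<theta> by auto
  have "q *v ?e = conj_transpose ?S' *v z"
    unfolding q_def matrix_vector_mul_assoc[symmetric] householder_column[OF z] ..
  moreover have "inverse \<theta> *s (conj_transpose ?S' *v (\<theta> *s z)) = conj_transpose ?S' *v (inverse \<theta> *s (\<theta> *s z))"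
    by (simp only: vector_scalar_commute)
  moreover have "inverse \<theta> *s (\<theta> *s z) = z" using \<theta>0 by (simp add: vec_eq_iff)
  moreover have "conj_transpose ?S' *v (\<theta> *s z) = ?e"
    using unitary_cancel(1)[OF householder_unitary[of i0 "\<theta> *s z"], of ?e]
    by (simp only: householder_column[OF nz'])
  ultimately have qe: "q *v ?e = inverse \<theta> *s ?e" by simp
  have qP: "q \<in> parabolic i0" using parabolicI(1)[OF unitary_group_subset_GL[OF qU] qe] .
  have "parabolic_part i0 (g ** p) = conj_transpose ?S' ** (g ** p)"
    unfolding parabolic_part_def z' ..
  also have "\<dots> = conj_transpose ?S' ** ((?S ** (conj_transpose ?S ** g)) ** p)"
    unfolding unitary_cancel(4)[OF householder_unitary] ..
  also have "\<dots> = q ** parabolic_part i0 g ** p"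
    by (simp add: q_def parabolic_part_def z_def matrix_mul_assoc)
  finally have pp: "parabolic_part i0 (g ** p) = q ** parabolic_part i0 g ** p" .
  have gP: "parabolic_part i0 g \<in> parabolic i0" by (rule parabolic_part_props[OF g])
  have mod: "modulus i0 (parabolic_part i0 (g ** p)) = modulus i0 (parabolic_part i0 g) * modulus i0 p"
    unfolding pp using gP qP p by (simp add: modulus_mult parabolic_mult modulus_unitary[OF qP qU])
  have "F (\<theta> *s z) = inverse (\<theta> powi k) * F z"
    using F z \<theta> by (simp add: phase_equivariant_def)
  moreover have "exp (- (t * complex_of_real (ln (cmod w * norm (g *v ?e)))))
      = exp (- (t * complex_of_real (ln (cmod w)))) * exp (- (t * complex_of_real (ln (norm (g *v ?e)))))"
    using w0 n by (simp add: ln_mult algebra_simps flip: exp_add)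
  moreover have "inverse (parabolic_char i0 t k p)
      = exp (- (t * complex_of_real (ln (cmod w)))) * inverse (\<theta> powi k)"
    using parabolic_char_eq[of p i0 t k] w0 by (simp add: w_def[symmetric] \<theta>_def exp_minus)
  moreover have "(modulus i0 (parabolic_part i0 g) * modulus i0 p) powr (-1/2)
      = modulus i0 (parabolic_part i0 g) powr (-1/2) * modulus i0 p powr (-1/2)"
    by (rule powr_mult)
  ultimately show ?thesis
    using g gpG by (simp add: induced_function_def mod norm_gp z' flip: z_def)
qed

lemma parabolic_part_measurable:
  "parabolic_part i0 \<in> measurable (restrict_space borel GL) (restrict_space borel (GL :: (complex^'n^'n) set))"
proof (rule measurable_restrict_space2)
  show "parabolic_part i0 \<in> space (restrict_space borel GL) \<rightarrow> (GL :: (complex^'n^'n) set)"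
    using parabolic_part_props(1) by (auto simp: space_restrict_space parabolic_def)
  have s: "(\<lambda>g. sgn (g *v axis i0 1)) \<in> borel_measurable (borel :: (complex^'n^'n) measure)"
    by (rule measurable_compose[OF _ sgn_measurable],
        intro borel_measurable_matrix_vector_mult borel_measurable_const measurable_ident_sets refl)
  show "parabolic_part i0 \<in> borel_measurable (restrict_space borel GL)"
    unfolding parabolic_part_def[abs_def]
    by (intro measurable_restrict_space1 borel_measurable_matrix_mult borel_measurable_conj_transpose
        measurable_compose[OF s householder_measurable] measurable_ident_sets refl)
qed

lemma modulus_parabolic_part_measurable:
  "(\<lambda>g. modulus i0 (parabolic_part i0 g)) \<in> borel_measurable (restrict_space borel (GL :: (complex^'n^'n) set))"
proof -
  let ?G = "restrict_space borel (GL :: (complex^'n^'n) set)"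
  have pm: "(\<lambda>g. parabolic_part i0 g) \<in> borel_measurable ?G"
    by (rule measurable_compose[OF parabolic_part_measurable
        measurable_restrict_space1[OF measurable_ident_sets[OF refl, of borel]]])
  have im: "(\<lambda>g. matrix_inv (parabolic_part i0 g)) \<in> borel_measurable ?G"
    by (rule measurable_compose[OF parabolic_part_measurable borel_measurable_matrix_inv])
  have "(\<lambda>g. parabolic_part i0 g ** b ** matrix_inv (parabolic_part i0 g)) \<in> borel_measurable ?G" for b
    by (rule borel_measurable_matrix_mult[OF borel_measurable_matrix_mult[OF pm borel_measurable_const] im])
  then have "(\<lambda>g. Ad (parabolic_part i0 g) b \<bullet> c) \<in> borel_measurable ?G" for b c
    unfolding Ad_def by (intro borel_measurable_inner borel_measurable_const)
  then show ?thesis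
    unfolding modulus_def det_on_def
    by (intro borel_measurable_abs borel_measurable_sum borel_measurable_times borel_measurable_const borel_measurable_prod)
qed

lemma induced_function_measurable:
  fixes F :: "complex^'n \<Rightarrow> complex"
  assumes F: "F \<in> borel_measurable borel"
  shows "induced_function i0 t F \<in> borel_measurable (restrict_space borel GL)"
proof -
  let ?G = "restrict_space borel (GL :: (complex^'n^'n) set)"
  have em: "(\<lambda>g. g *v axis i0 1) \<in> borel_measurable ?G"
    by (intro measurable_restrict_space1 borel_measurable_matrix_vector_mult borel_measurable_const
        measurable_ident_sets refl)
  have 1: "(\<lambda>g. F (sgn (g *v axis i0 1))) \<in> borel_measurable ?G"
    by (rule measurable_compose[OF measurable_compose[OF em sgn_measurable] F])
  have 2: "(\<lambda>g. ln (norm (g *v axis i0 (1 :: complex)))) \<in> borel_measurable ?G"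
    using em by measurable
  have 3: "(\<lambda>g. modulus i0 (parabolic_part i0 g) powr (-1/2)) \<in> borel_measurable ?G"
    using modulus_parabolic_part_measurable by measurable
  have "(\<lambda>g. complex_of_real (modulus i0 (parabolic_part i0 g) powr (-1/2))
      * exp (- (t * complex_of_real (ln (norm (g *v axis i0 1))))) * F (sgn (g *v axis i0 1))) \<in> borel_measurable ?G"
    using 1 2 3 by measurable
  then show ?thesis
    by (subst measurable_cong[where g = "\<lambda>g. complex_of_real (modulus i0 (parabolic_part i0 g) powr (-1/2))
      * exp (- (t * complex_of_real (ln (norm (g *v axis i0 1))))) * F (sgn (g *v axis i0 1))"])
       (auto simp: space_restrict_space induced_function_def)
qed

section \<open>Restriction of the principal series to the sphere\<close>

definition sphere_restriction :: "'n \<Rightarrow> (complex^'n^'n \<Rightarrow> complex) \<Rightarrow> complex^'n \<Rightarrow> complex" where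
  "sphere_restriction i0 f = (\<lambda>z. f (householder i0 z))"

lemma principal_series_equivariant:
  assumes "f \<in> principal_series \<mu> i0 t k" "g \<in> GL" "p \<in> parabolic i0"
  shows "f (g ** p) = complex_of_real (modulus i0 p powr (-1/2)) * inverse (parabolic_char i0 t k p) * f g"
  using assms unfolding principal_series_def by blast

lemma principal_series_unitary_step:
  assumes f: "f \<in> principal_series \<mu> i0 t k" and g: "g \<in> GL"
    and p: "p \<in> parabolic i0" "p \<in> unitary_group"
  shows "f (g ** p) = inverse ((p $ i0 $ i0) powi k) * f g"
  using principal_series_equivariant[OF f g p(1)] parabolic_nonzero[OF p(1)]
  by (simp add: modulus_unitary[OF p] parabolic_char_eq parabolic_unitary_norm[OF p])

text \<open>
  The unitary matrices \<open>u\<close> and \<open>householder i0 (u e)\<close> have the same value at the base vector, so they differ by an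
  element of the parabolic subgroup on which the character and the modulus are trivial.
\<close>
lemma sphere_restriction_eval:
  assumes f: "f \<in> principal_series \<mu> i0 t k" and u: "u \<in> unitary_group"
  shows "f u = sphere_restriction i0 f (u *v axis i0 1)"
proof -
  let ?z = "u *v axis i0 (1 :: complex)"
  let ?S = "householder i0 ?z"
  have S: "?S \<in> unitary_group" by (rule householder_unitary)
  define p where "p = conj_transpose ?S ** u"
  have pU: "p \<in> unitary_group"
    unfolding p_def by (intro unitary_group_mult unitary_group_conj_transpose S u)
  have Sz: "?S *v axis i0 1 = ?z"
    using u by (intro householder_column) (simp add: norm_unitary)
  have "p *v axis i0 1 = conj_transpose ?S *v ?z" by (simp add: p_def matrix_vector_mul_assoc)
  also have "\<dots> = axis i0 1" using unitary_cancel(1)[OF S, of "axis i0 1"] by (simp only: Sz)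
  finally have pe: "p *v axis i0 1 = 1 *s axis i0 1" by simp
  note pP = parabolicI[OF unitary_group_subset_GL[OF pU] pe]
  have "f (?S ** p) = f ?S"
    using principal_series_unitary_step[OF f unitary_group_subset_GL[OF S] pP(1) pU] pP(2) by simp
  then show ?thesis by (simp add: p_def unitary_cancel(4)[OF S] sphere_restriction_def)
qed

lemma sphere_restriction_phase:
  assumes f: "f \<in> principal_series \<mu> i0 t k"
  shows "phase_equivariant k (sphere_restriction i0 f)"
  unfolding phase_equivariant_def
proof (intro allI impI)
  fix z :: "complex^'a" and w :: complex assume z: "norm z = 1" and w: "cmod w = 1"
  let ?S = "householder i0 z" and ?S' = "householder i0 (w *s z)"
  have S: "?S \<in> unitary_group" and S': "?S' \<in> unitary_group" by (rule householder_unitary)+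
  define p where "p = conj_transpose ?S ** ?S'"
  have pU: "p \<in> unitary_group"
    unfolding p_def by (intro unitary_group_mult unitary_group_conj_transpose S S')
  have "p *v axis i0 1 = conj_transpose ?S *v (?S' *v axis i0 1)" by (simp add: p_def matrix_vector_mul_assoc)
  also have "?S' *v axis i0 1 = w *s z" using z w by (intro householder_column) (simp add: norm_smult)
  also have "conj_transpose ?S *v (w *s z) = w *s (conj_transpose ?S *v z)" by (simp add: vector_scalar_commute)
  also have "conj_transpose ?S *v z = axis i0 1"
    using unitary_cancel(1)[OF S, of "axis i0 1"] by (simp only: householder_column[OF z])
  finally have pe: "p *v axis i0 1 = w *s axis i0 1" .
  note pP = parabolicI[OF unitary_group_subset_GL[OF pU] pe]
  have "f (?S ** p) = inverse (w powi k) * f ?S"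
    using principal_series_unitary_step[OF f unitary_group_subset_GL[OF S] pP(1) pU] pP(2) by simp
  then show "sphere_restriction i0 f (w *s z) = inverse (w powi k) * sphere_restriction i0 f z"
    by (simp add: p_def unitary_cancel(4)[OF S] sphere_restriction_def)
qed

lemma sphere_restriction_measurable:
  assumes f: "f \<in> principal_series \<mu> i0 t k"
  shows "sphere_restriction i0 f \<in> borel_measurable borel"
proof -
  have "householder i0 \<in> measurable borel (restrict_space borel GL)"
    using householder_unitary unitary_group_subset_GL
    by (intro measurable_restrict_space2 householder_measurable) auto
  moreover have "f \<in> borel_measurable (restrict_space borel GL)" using f by (simp add: principal_series_def)
  ultimately show ?thesis unfolding sphere_restriction_def by (rule measurable_compose)
qed

lemma base_point_measurable:
  fixes \<mu> :: "(complex^'n^'n) measure" and i0 :: 'n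
  assumes "haar_unitary \<mu>"
  shows "(\<lambda>u. u *v axis i0 1) \<in> borel_measurable \<mu>"
  by (rule haar_measurable[OF assms])
     (intro borel_measurable_matrix_vector_mult borel_measurable_const measurable_ident_sets refl)

lemma integrable_haar_sphere_iff:
  fixes \<mu> :: "(complex^'n^'n) measure" and i0 :: 'n and F :: "complex^'n \<Rightarrow> 'b::{banach, second_countable_topology}"
  assumes h: "haar_unitary \<mu>" and F: "F \<in> borel_measurable borel"
  shows "integrable sphere_measure F \<longleftrightarrow> integrable \<mu> (\<lambda>u. F (u *v axis i0 1))"
  using integrable_distr_eq[OF base_point_measurable[OF h] F] by (simp only: distr_haar_sphere[OF h])

lemma integral_haar_sphere:
  fixes \<mu> :: "(complex^'n^'n) measure" and i0 :: 'n and F :: "complex^'n \<Rightarrow> 'b::{banach, second_countable_topology}"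
  assumes h: "haar_unitary \<mu>" and F: "F \<in> borel_measurable borel"
  shows "integral\<^sup>L sphere_measure F = (\<integral>u. F (u *v axis i0 1) \<partial>\<mu>)"
  using integral_distr[OF base_point_measurable[OF h] F] by (simp only: distr_haar_sphere[OF h])

lemma sphere_restriction_L2:
  assumes h: "haar_unitary \<mu>" and f: "f \<in> principal_series \<mu> i0 t k"
  shows "sphere_restriction i0 f \<in> L2_sphere"
proof -
  have m: "sphere_restriction i0 f \<in> borel_measurable borel" by (rule sphere_restriction_measurable[OF f])
  have "integrable \<mu> (\<lambda>u. (cmod (f u))\<^sup>2)" using f by (simp add: principal_series_def)
  then have "integrable \<mu> (\<lambda>u. (cmod (sphere_restriction i0 f (u *v axis i0 1)))\<^sup>2)"
    by (rule Bochner_Integration.integrable_cong[OF refl, THEN iffD1, rotated])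
       (simp add: space_haar[OF h] sphere_restriction_eval[OF f])
  then have "integrable sphere_measure (\<lambda>z. (cmod (sphere_restriction i0 f z))\<^sup>2)"
    using m by (subst integrable_haar_sphere_iff[OF h]) auto
  then show ?thesis using m by (simp add: L2_def measurable_cong_sets[OF sets_sphere_measure refl])
qed

lemma L2_inner_sphere_restriction:
  assumes h: "haar_unitary \<mu>" and f: "f \<in> principal_series \<mu> i0 t k" and g: "g \<in> principal_series \<mu> i0 t k"
  shows "L2_inner \<mu> f g = sphere_inner (sphere_restriction i0 f) (sphere_restriction i0 g)"
proof -
  note [measurable] = sphere_restriction_measurable[OF f] sphere_restriction_measurable[OF g]
  have "L2_inner \<mu> f g = (\<integral>u. sphere_restriction i0 f (u *v axis i0 1)
      * cnj (sphere_restriction i0 g (u *v axis i0 1)) \<partial>\<mu>)"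
    unfolding L2_inner_def
    by (rule Bochner_Integration.integral_cong[OF refl])
       (simp add: space_haar[OF h] sphere_restriction_eval[OF f] sphere_restriction_eval[OF g])
  also have "\<dots> = sphere_inner (sphere_restriction i0 f) (sphere_restriction i0 g)"
    unfolding L2_inner_def
    by (rule integral_haar_sphere[OF h, symmetric,
          where F = "\<lambda>z. sphere_restriction i0 f z * cnj (sphere_restriction i0 g z)"]) measurable
  finally show ?thesis .
qed

lemma induced_function_principal_series:
  fixes F :: "complex^'n \<Rightarrow> complex"
  assumes h: "haar_unitary \<mu>" and F: "F \<in> L2_sphere" and eq: "phase_equivariant k F"
  shows "induced_function i0 t F \<in> principal_series \<mu> i0 t k"
proof -
  have m: "F \<in> borel_measurable borel" by (rule L2_sphere_measurable[OF F])
  have "integrable \<mu> (\<lambda>u. (cmod (F (u *v axis i0 1)))\<^sup>2)"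
    using L2_integrable[OF F] m by (subst (asm) integrable_haar_sphere_iff[OF h]) auto
  then have "integrable \<mu> (\<lambda>u. (cmod (induced_function i0 t F u))\<^sup>2)"
    by (rule Bochner_Integration.integrable_cong[OF refl, THEN iffD1, rotated])
       (simp add: space_haar[OF h] induced_function_unitary)
  then show ?thesis
    unfolding principal_series_def
    using induced_function_measurable[OF m] induced_function_equivariant[OF eq]
    by (auto simp: induced_function_def[of _ _ _ g for g])
qed

lemma sphere_restriction_induced:
  assumes "norm z = 1"
  shows "sphere_restriction i0 (induced_function i0 t F) z = F z"
  by (simp add: sphere_restriction_def induced_function_unitary[OF householder_unitary] householder_column[OF assms])

lemma left_translate_principal_series:
  fixes f :: "complex^'n^'n \<Rightarrow> complex"
  assumes h: "haar_unitary \<mu>" and u: "u \<in> unitary_group" and f: "f \<in> principal_series \<mu> i0 t k"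
  shows "left_translate u f \<in> principal_series \<mu> i0 t k"
proof -
  let ?v = "conj_transpose u"
  have v: "?v \<in> unitary_group" by (rule unitary_group_conj_transpose[OF u])
  have vG: "?v \<in> GL" by (rule unitary_group_subset_GL[OF v])
  have lt: "left_translate u f = (\<lambda>x. f (?v ** x))" by (simp add: left_translate_def matrix_inv_unitary[OF u])
  have fm: "f \<in> borel_measurable (restrict_space borel GL)" and f0: "\<And>g. g \<notin> GL \<Longrightarrow> f g = 0"
    and fi: "integrable \<mu> (\<lambda>u. (cmod (f u))\<^sup>2)"
    using f by (auto simp: principal_series_def)
  have "(\<lambda>x :: complex^'n^'n. ?v ** x) \<in> borel_measurable borel"
    by (rule borel_measurable_matrix_mult[where A = "\<lambda>_. ?v" and B = "\<lambda>v. v"])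
       (intro borel_measurable_const measurable_ident_sets refl)+
  then have "(\<lambda>x. ?v ** x) \<in> measurable (restrict_space borel GL) (restrict_space borel GL)"
    by (intro measurable_restrict_space2 measurable_restrict_space1) (auto simp: space_restrict_space GL_mult[OF vG])
  from measurable_compose[OF this fm] have "(\<lambda>x. f (?v ** x)) \<in> borel_measurable (restrict_space borel GL)" .
  moreover have "f (?v ** g) = 0" if "g \<notin> GL" for g
  proof (rule f0, rule notI)
    assume "?v ** g \<in> GL"
    from GL_mult[OF unitary_group_subset_GL[OF u] this] show False
      using that by (simp only: unitary_cancel(4)[OF u])
  qed
  moreover have "f (?v ** (g ** p)) = complex_of_real (modulus i0 p powr (-1/2)) * inverse (parabolic_char i0 t k p) * f (?v ** g)"
    if "g \<in> GL" "p \<in> parabolic i0" for g p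
    using principal_series_equivariant[OF f GL_mult[OF vG that(1)] that(2)] by (simp only: matrix_mul_assoc)
  moreover have "integrable \<mu> (\<lambda>x. (cmod (f (?v ** x)))\<^sup>2)"
    using fi haar_left[OF h v] integrable_distr[OF haar_measurable_mult[OF h v], of "\<lambda>x. (cmod (f x))\<^sup>2"] by simp
  ultimately show ?thesis by (simp add: lt principal_series_def)
qed

lemma sphere_restriction_left_translate:
  fixes f :: "complex^'n^'n \<Rightarrow> complex"
  assumes u: "u \<in> unitary_group" and f: "f \<in> principal_series \<mu> i0 t k" and z: "norm z = 1"
  shows "sphere_restriction i0 (left_translate u f) z = sphere_restriction i0 f (conj_transpose u *v z)"
proof -
  have "sphere_restriction i0 (left_translate u f) z = f (conj_transpose u ** householder i0 z)"
    by (simp add: sphere_restriction_def left_translate_def matrix_inv_unitary[OF u])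
  also have "\<dots> = sphere_restriction i0 f ((conj_transpose u ** householder i0 z) *v axis i0 1)"
    by (intro sphere_restriction_eval[OF f] unitary_group_mult unitary_group_conj_transpose u householder_unitary)
  also have "(conj_transpose u ** householder i0 z) *v axis i0 1 = conj_transpose u *v z"
    by (simp add: householder_column[OF z] flip: matrix_vector_mul_assoc)
  finally show ?thesis .
qed

section \<open>Decomposition of the equivariant functions on the sphere\<close>

lemma orthogonal_transformation_phase:
  assumes "cmod w = 1"
  shows "orthogonal_transformation (\<lambda>z :: complex^'n. w *s z)"
  unfolding orthogonal_transformation
  using assms by (auto simp: norm_smult vec_eq_iff algebra_simps intro!: linearI)

text \<open>
  The substitution \<open>z \<mapsto> w z\<close> preserves the measure and multiplies the inner product by \<open>w\<^sup>N\<close> with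
  \<open>N = b - a - k\<close>. If \<open>N\<close> is not zero, the choice \<open>w = exp(i \<pi> / N)\<close> gives the factor \<open>-1\<close>.
\<close>
lemma orthogonal_to_other_types:
  fixes F :: "complex^'n \<Rightarrow> complex"
  assumes F: "F \<in> L2_sphere" and eq: "phase_equivariant k F"
    and q: "q \<in> harmonics a b" and ne: "int a - int b \<noteq> - k"
  shows "sphere_inner F q = 0"
proof -
  define N where "N = int b - int a - k"
  have N0: "N \<noteq> 0" using ne by (simp add: N_def)
  define w where "w = cis (pi / of_int N)"
  have w: "cmod w = 1" and w0: "w \<noteq> 0" by (simp_all add: w_def)
  have wN: "w powi N = -1" using N0 by (simp add: w_def cis_power_int)
  have mF: "F \<in> borel_measurable borel" and mq: "q \<in> borel_measurable borel"
    by (rule L2_sphere_measurable[OF F], rule L2_sphere_measurable[OF harmonics_L2[OF q]])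
  note orth = orthogonal_transformation_phase[OF w]
  have mw: "(\<lambda>z :: complex^'n. w *s z) \<in> borel_measurable borel"
    using linear_continuous_on[of "\<lambda>z :: complex^'n. w *s z" UNIV] orth
    by (intro borel_measurable_continuous_onI) (auto simp: orthogonal_transformation linear_linear)
  have "sphere_inner F q = (\<integral>z. F z * cnj (q z) \<partial>distr sphere_measure borel (\<lambda>z. w *s z))"
    by (simp add: L2_inner_def sphere_measure_orthogonal_invariant[OF orth])
  also have "\<dots> = sphere_inner (\<lambda>z. F (w *s z)) (\<lambda>z. q (w *s z))"
    unfolding L2_inner_def using mF mq mw by (intro integral_distr) auto
  also have "\<dots> = sphere_inner (\<lambda>z. inverse (w powi k) * F z) (\<lambda>z. (w ^ a * cnj w ^ b) * q z)"
  proof (rule L2_inner_sphere_cong)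
    show "(\<lambda>z. F (w *s z)) \<in> borel_measurable borel" by (rule measurable_compose[OF mw mF])
    show "(\<lambda>z. q (w *s z)) \<in> borel_measurable borel" by (rule measurable_compose[OF mw mq])
  qed (use mF mq eq w in \<open>auto simp: phase_equivariant_def bihom_homogeneous[OF harmonics_bihom[OF q]]\<close>)
  also have "\<dots> = (inverse (w powi k) * cnj (w ^ a * cnj w ^ b)) * sphere_inner F q"
    by (simp only: L2_inner_scale complex_cnj_mult mult.assoc)
  also have "inverse (w powi k) * cnj (w ^ a * cnj w ^ b) = w powi N"
  proof -
    have "cnj w = inverse w"
      unfolding w_def cis_cnj cis_inverse ..
    then have "inverse (w powi k) * cnj (w ^ a * cnj w ^ b) = w powi (-k) * (w powi (- int a) * w powi (int b))"
      by (simp add: power_int_minus power_inverse)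
    also have "\<dots> = w powi (-k + (- int a + int b))"
      by (simp only: power_int_add[OF disjI1[OF w0]])
    also have "-k + (- int a + int b) = N" by (simp add: N_def)
    finally show ?thesis .
  qed
  finally show ?thesis by (simp add: wN)
qed

text \<open>The bidegrees \<open>(\<alpha>, \<beta>)\<close> with \<open>\<alpha> - \<beta> = - k\<close> form a sequence of strictly increasing total degree.\<close>
definition bidegree :: "int \<Rightarrow> nat \<Rightarrow> nat \<times> nat" where
  "bidegree k m = (m + nat (- k), m + nat k)"

lemma bij_bidegree: "bij_betw (bidegree k) UNIV {(\<alpha>, \<beta>). int \<alpha> - int \<beta> = - k}"
proof (rule bij_betwI[where g = "\<lambda>(\<alpha>, \<beta>). min \<alpha> \<beta>"])
  show "bidegree k ((\<lambda>(\<alpha>, \<beta>). min \<alpha> \<beta>) p) = p" if "p \<in> {(\<alpha>, \<beta>). int \<alpha> - int \<beta> = - k}" for p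
    using that by (cases "k \<ge> 0") (auto simp: bidegree_def min_def)
qed (auto simp: bidegree_def min_def)

abbreviation harmonics_at :: "int \<Rightarrow> nat \<Rightarrow> (complex^'n \<Rightarrow> complex) set" where
  "harmonics_at k m \<equiv> harmonics (fst (bidegree k m)) (snd (bidegree k m))"

abbreviation projection_at :: "int \<Rightarrow> nat \<Rightarrow> (complex^'n \<Rightarrow> complex) \<Rightarrow> complex^'n \<Rightarrow> complex" where
  "projection_at k m \<equiv> harmonic_projection (fst (bidegree k m)) (snd (bidegree k m))"

lemma harmonics_at_orthogonal:
  fixes f g :: "complex^'n \<Rightarrow> complex"
  assumes "f \<in> harmonics_at k m" "g \<in> harmonics_at k n" "m \<noteq> n"
  shows "sphere_inner f g = 0"
  by (rule harmonics_orthogonal[OF assms(1,2)]) (use assms(3) in \<open>simp add: bidegree_def\<close>)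

lemma harmonics_at_phase:
  fixes v :: "complex^'n \<Rightarrow> complex"
  assumes v: "v \<in> harmonics_at k m" and w: "cmod w = 1"
  shows "v (w *s z) = inverse (w powi k) * v z"
proof -
  have w0: "w \<noteq> 0" using w by auto
  have cw: "cnj w = inverse w"
  proof -
    have "w * cnj w = 1" using w complex_norm_square[of w] by simp
    then show ?thesis using w0 by (simp add: field_simps)
  qed
  have "w ^ (m + nat (- k)) * cnj w ^ (m + nat k) = w powi (int (m + nat (-k))) * w powi (- int (m + nat k))"
    unfolding cw by (simp only: power_int_minus power_int_of_nat power_inverse)
  also have "\<dots> = w powi (int (m + nat (-k)) + (- int (m + nat k)))" using w0 by (simp only: power_int_add simp_thms)
  also have "int (m + nat (-k)) + (- int (m + nat k)) = - k" by simp
  finally show ?thesis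
    using bihom_homogeneous[OF harmonics_bihom[OF v], of w z] by (simp add: bidegree_def power_int_minus)
qed

lemma equivariant_complete:
  fixes F :: "complex^'n \<Rightarrow> complex"
  assumes F: "F \<in> L2_sphere" and eq: "phase_equivariant k F"
    and o: "\<And>m q. q \<in> harmonics_at k m \<Longrightarrow> sphere_inner F q = 0"
  shows "AE z in sphere_measure. F z = 0"
proof (rule harmonics_complete[OF F])
  fix a b and q :: "complex^'n \<Rightarrow> complex" assume q: "q \<in> harmonics a b"
  show "sphere_inner F q = 0"
  proof (cases "int a - int b = - k")
    case True
    then have "(a, b) \<in> bidegree k ` UNIV"
      using bij_betw_imp_surj_on[OF bij_bidegree, of k] by simp
    then obtain m where "(a, b) = bidegree k m" by blast
    then show ?thesis using o[of q m] q by (metis fst_conv snd_conv)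
  next
    case False
    then show ?thesis by (rule orthogonal_to_other_types[OF F eq q])
  qed
qed

text \<open>
  Every partial sum satisfies the phase equivariance at every point, hence so does the
  limit provided by \<open>orthogonal_series_converges\<close>.
\<close>
lemma harmonic_series:
  fixes v :: "nat \<Rightarrow> complex^'n \<Rightarrow> complex"
  assumes v: "\<And>m. v m \<in> harmonics_at k m" and sm: "summable (\<lambda>m. sphere_sqnorm (v m))"
  obtains F where "F \<in> L2_sphere" "phase_equivariant k F"
    "\<And>m q. q \<in> harmonics_at k m \<Longrightarrow> sphere_inner F q = sphere_inner (v m) q"
    "(\<lambda>m. sphere_sqnorm (v m)) sums sphere_sqnorm F"
proof -
  define S where "S n z = (\<Sum>m<n. v m z)" for n z
  have vL: "v m \<in> L2_sphere" for m by (rule harmonics_L2[OF v])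
  have orth: "sphere_inner (v i) (v j) = 0" if "i \<noteq> j" for i j
    by (rule harmonics_at_orthogonal[OF v v that])
  obtain r :: "nat \<Rightarrow> nat" where
    F: "(\<lambda>x. if Cauchy (\<lambda>j. S (r j) x) then lim (\<lambda>j. S (r j) x) else 0) \<in> L2_sphere" and
    lim: "(\<lambda>n. sphere_sqnorm (\<lambda>x. (if Cauchy (\<lambda>j. S (r j) x) then lim (\<lambda>j. S (r j) x) else 0) - S n x)) \<longlonglongrightarrow> 0"
    using orthogonal_series_converges[OF vL orth sm, folded S_def] by blast
  define F where "F = (\<lambda>x. if Cauchy (\<lambda>j. S (r j) x) then lim (\<lambda>j. S (r j) x) else 0)"
  have SL: "S n \<in> L2_sphere" for n unfolding S_def by (intro L2_sum vL)
  have FL: "F \<in> L2_sphere" and Flim: "(\<lambda>n. sphere_sqnorm (\<lambda>x. F x - S n x)) \<longlonglongrightarrow> 0"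
    using F lim by (simp_all add: F_def)
  show thesis
  proof (rule that[OF FL])
    show "phase_equivariant k F"
      unfolding phase_equivariant_def
    proof (intro allI impI)
      fix z :: "complex^'n" and w :: complex assume w: "cmod w = 1"
      let ?c = "inverse (w powi k)"
      have c0: "?c \<noteq> 0" using w by auto
      have Sw: "S n (w *s z) = ?c * S n z" for n
        unfolding S_def by (simp add: harmonics_at_phase[OF v w] sum_distrib_left)
      have "lim (\<lambda>j. ?c * S (r j) z) = ?c * lim (\<lambda>j. S (r j) z)" if "convergent (\<lambda>j. S (r j) z)"
        using that by (intro limI tendsto_mult tendsto_const) (simp add: convergent_LIMSEQ_iff)
      then show "F (w *s z) = ?c * F z"
        unfolding F_def Sw Cauchy_convergent_iff convergent_mult_const_iff[OF c0] by simp
    qed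
    show "sphere_inner F q = sphere_inner (v m) q" if q: "q \<in> harmonics_at k m" for m q
    proof -
      have "sphere_inner (S n) q = sphere_inner (v m) q" if "n > m" for n
      proof -
        have "sphere_inner (S n) q = (\<Sum>i<n. sphere_inner (v i) q)"
          unfolding S_def by (intro L2_inner_sum(1) vL harmonics_L2[OF q])
        also have "\<dots> = (\<Sum>i<n. if i = m then sphere_inner (v m) q else 0)"
          by (intro sum.cong) (auto simp: harmonics_at_orthogonal[OF v q])
        also have "\<dots> = sphere_inner (v m) q" using that by simp
        finally show ?thesis .
      qed
      then have "(\<lambda>n. sphere_inner (S n) q) \<longlonglongrightarrow> sphere_inner (v m) q"
        by (intro tendsto_eventually eventually_mono[OF eventually_gt_at_top[of m]])
      then show ?thesis
        using L2_inner_tendsto[OF SL FL harmonics_L2[OF q] Flim] LIMSEQ_unique by blast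
    qed
    have "sphere_sqnorm (S n) = (\<Sum>m<n. sphere_sqnorm (v m))" for n
      unfolding S_def by (intro sqnorm_orthogonal_sum vL orth) auto
    then show "(\<lambda>m. sphere_sqnorm (v m)) sums sphere_sqnorm F"
      using sqnorm_tendsto[OF SL FL Flim] by (simp add: sums_def)
  qed
qed

lemma phase_equivariant_diff:
  "phase_equivariant k F \<Longrightarrow> phase_equivariant k G \<Longrightarrow> phase_equivariant k (\<lambda>z. F z - G z)"
  by (simp add: phase_equivariant_def right_diff_distrib)

lemma phase_equivariant_lincomb:
  "phase_equivariant k F \<Longrightarrow> phase_equivariant k G \<Longrightarrow> phase_equivariant k (\<lambda>z. a * F z + b * G z)"
  by (simp add: phase_equivariant_def algebra_simps)

text \<open>
  Bessel's inequality makes the series of the projections of \<open>F\<close> converge; its sum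
  and \<open>F\<close> have the same projections, hence agree almost everywhere by completeness.
\<close>
lemma Parseval_equivariant:
  fixes F :: "complex^'n \<Rightarrow> complex"
  assumes F: "F \<in> L2_sphere" and eq: "phase_equivariant k F"
  shows "(\<lambda>m. sphere_sqnorm (projection_at k m F)) sums sphere_sqnorm F"
proof -
  let ?P = "\<lambda>m. projection_at k m F"
  have P: "?P m \<in> harmonics_at k m" for m by (rule harmonic_projection_in[OF F])
  have PL: "?P m \<in> L2_sphere" for m by (rule harmonics_L2[OF P])
  have Bessel: "(\<Sum>m<n. sphere_sqnorm (?P m)) \<le> sphere_sqnorm F" for n
  proof -
    let ?S = "\<lambda>z. \<Sum>m<n. ?P m z"
    have SL: "?S \<in> L2_sphere" by (intro L2_sum PL)
    have sq: "sphere_sqnorm ?S = (\<Sum>m<n. sphere_sqnorm (?P m))"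
      by (intro sqnorm_orthogonal_sum PL harmonics_at_orthogonal[OF P P]) auto
    have "sphere_inner F ?S = (\<Sum>m<n. sphere_inner F (?P m))"
      by (intro L2_inner_sum(2) PL F)
    also have "\<dots> = (\<Sum>m<n. complex_of_real (sphere_sqnorm (?P m)))"
      by (simp add: harmonic_projection_inner[OF F P, symmetric] L2_inner_self)
    finally have "Re (sphere_inner F ?S) = (\<Sum>m<n. sphere_sqnorm (?P m))" by simp
    then show ?thesis
      using sqnorm_diff[OF F SL] sq sqnorm_nonneg[of sphere_measure "\<lambda>z. F z - ?S z"] by linarith
  qed
  have sm: "summable (\<lambda>m. sphere_sqnorm (?P m))"
    by (rule summableI_nonneg_bounded[OF _ Bessel]) simp
  obtain G where G: "G \<in> L2_sphere" "phase_equivariant k G"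
    and GP: "\<And>m q. q \<in> harmonics_at k m \<Longrightarrow> sphere_inner G q = sphere_inner (?P m) q"
    and sums: "(\<lambda>m. sphere_sqnorm (?P m)) sums sphere_sqnorm G"
    using harmonic_series[of ?P k, OF P sm] by blast
  have "AE z in sphere_measure. F z - G z = 0"
  proof (rule equivariant_complete[OF L2_diff[OF F G(1)] phase_equivariant_diff[OF eq G(2)]])
    fix m and q :: "complex^'n \<Rightarrow> complex" assume q: "q \<in> harmonics_at k m"
    show "sphere_inner (\<lambda>z. F z - G z) q = 0"
      unfolding L2_inner_diff(1)[OF F G(1) harmonics_L2[OF q]] GP[OF q] harmonic_projection_inner[OF F q] by simp
  qed
  then have "AE z in sphere_measure. F z = G z" by eventually_elim simp
  then have "sphere_inner F F = sphere_inner G G"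
    using F G by (intro L2_inner_cong_AE) (auto simp: L2_measurable)
  then have "sphere_sqnorm F = sphere_sqnorm G" by (simp add: L2_inner_self)
  then show ?thesis using sums by simp
qed

text \<open>
  The coefficients \<open>1\<close> and \<open>-1\<close> are written out so that all four terms have the form of a linear combination,
  to which the linearity of the projections applies verbatim.
\<close>
lemma L2_inner_polarization:
  assumes f: "f \<in> L2 M" and g: "g \<in> L2 M"
  shows "4 * L2_inner M f g = complex_of_real (sqnorm M (\<lambda>x. 1 * f x + 1 * g x))
    + (-1) * complex_of_real (sqnorm M (\<lambda>x. 1 * f x + (-1) * g x))
    + \<i> * complex_of_real (sqnorm M (\<lambda>x. 1 * f x + \<i> * g x))
    + (-\<i>) * complex_of_real (sqnorm M (\<lambda>x. 1 * f x + (-\<i>) * g x))"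
proof -
  have s: "sqnorm M (\<lambda>x. 1 * f x + c * g x)
      = sqnorm M f + 2 * Re (cnj c * L2_inner M f g) + (cmod c)\<^sup>2 * sqnorm M g" for c
    using sqnorm_add[OF f L2_scale[OF g, of c]] by (simp add: L2_inner_scale sqnorm_scale)
  show ?thesis unfolding s by (simp add: complex_eq_iff)
qed

text \<open>
  Polarization of the identity for the norms.
\<close>
lemma Parseval_inner_equivariant:
  fixes F G :: "complex^'n \<Rightarrow> complex"
  assumes F: "F \<in> L2_sphere" "phase_equivariant k F"
    and G: "G \<in> L2_sphere" "phase_equivariant k G"
  shows "((\<lambda>m. sphere_inner (projection_at k m F) (projection_at k m G))
    has_sum sphere_inner F G) UNIV"
proof -
  let ?N = "\<lambda>H. complex_of_real (sphere_sqnorm H)"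
  have hs: "((\<lambda>m. ?N (\<lambda>z. 1 * projection_at k m F z + c * projection_at k m G z))
      has_sum ?N (\<lambda>z. 1 * F z + c * G z)) UNIV" for c
  proof -
    have "((\<lambda>m. sphere_sqnorm (projection_at k m (\<lambda>z. 1 * F z + c * G z)))
        has_sum sphere_sqnorm (\<lambda>z. 1 * F z + c * G z)) UNIV"
      by (intro sums_nonneg_imp_has_sum Parseval_equivariant L2_lincomb phase_equivariant_lincomb F G sqnorm_nonneg)
    then have "((\<lambda>m. sphere_sqnorm (\<lambda>z. 1 * projection_at k m F z + c * projection_at k m G z))
        has_sum sphere_sqnorm (\<lambda>z. 1 * F z + c * G z)) UNIV"
      by (simp only: harmonic_projection_lincomb[OF F(1) G(1)])
    then show ?thesis by (simp only: has_sum_of_real_iff)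
  qed
  have PL: "projection_at k m F \<in> L2_sphere" "projection_at k m G \<in> L2_sphere" for m
    by (rule harmonics_L2[OF harmonic_projection_in[OF F(1)]], rule harmonics_L2[OF harmonic_projection_in[OF G(1)]])
  have "((\<lambda>m. 4 * sphere_inner (projection_at k m F) (projection_at k m G))
      has_sum 4 * sphere_inner F G) UNIV"
    unfolding L2_inner_polarization[OF F(1) G(1)] L2_inner_polarization[OF PL]
    by (intro has_sum_add has_sum_cmult_right hs)
  from has_sum_cmult_right[OF this, of "1/4"] show ?thesis by simp
qed

lemma harmonic_projection_sphere_cong:
  fixes F G :: "complex^'n \<Rightarrow> complex"
  assumes "F \<in> borel_measurable borel" "G \<in> borel_measurable borel" "\<And>z. norm z = 1 \<Longrightarrow> F z = G z"
  shows "harmonic_projection a b F = harmonic_projection a b G"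
proof -
  have "sphere_inner F q = sphere_inner G q" if q: "q \<in> harmonics a b" for q
    using assms L2_sphere_measurable[OF harmonics_L2[OF q]] by (intro L2_inner_sphere_cong) auto
  then show ?thesis unfolding harmonic_projection_def by (intro arg_cong[where f = The]) auto
qed

theorem theorem1:
  fixes \<mu> :: "(complex^'n^'n) measure" and i0 :: 'n and l :: real and k :: int
  assumes "CARD('n) \<ge> 2"
    and "haar_unitary \<mu>"
  shows "unitarily_equivalent_to_sum unitary_group
      (principal_series \<mu> i0 (\<i> * complex_of_real l) k) (L2_inner \<mu>) left_translate
      {(\<alpha>, \<beta>). int \<alpha> - int \<beta> = - k}
      (\<lambda>(\<alpha>, \<beta>). harmonics \<alpha> \<beta> :: (complex^'n \<Rightarrow> complex) set) (L2_inner sphere_measure) poly_action"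
proof -
  note h = assms(2)
  let ?t = "\<i> * complex_of_real l" and ?I = "{(\<alpha>, \<beta>). int \<alpha> - int \<beta> = - k}"
  let ?H = "principal_series \<mu> i0 ?t k" and ?V = "\<lambda>(\<alpha>, \<beta>). harmonics \<alpha> \<beta> :: (complex^'n \<Rightarrow> complex) set"
  let ?r = "sphere_restriction i0"
  define T :: "(complex^'n^'n \<Rightarrow> complex) \<Rightarrow> nat \<times> nat \<Rightarrow> complex^'n \<Rightarrow> complex" where
    "T f p = (if p \<in> ?I then harmonic_projection (fst p) (snd p) (?r f) else (\<lambda>_. 0))" for f p
  have bI: "bidegree k m \<in> ?I" for m by (rule bspec[OF bij_betwE[OF bij_bidegree] UNIV_I])
  have Tb: "T f (bidegree k m) = projection_at k m (?r f)" for f m using bI by (simp only: T_def if_True)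
  have rL: "?r f \<in> L2_sphere" and rE: "phase_equivariant k (?r f)" and rm: "?r f \<in> borel_measurable borel"
    if "f \<in> ?H" for f
    by (rule sphere_restriction_L2[OF h that], rule sphere_restriction_phase[OF that],
        rule sphere_restriction_measurable[OF that])
  have inner: "((\<lambda>p. sphere_inner (T f p) (T g p)) has_sum L2_inner \<mu> f g) ?I"
    if f: "f \<in> ?H" and g: "g \<in> ?H" for f g
    using Parseval_inner_equivariant[OF rL[OF f] rE[OF f] rL[OF g] rE[OF g]]
      has_sum_reindex_bij_betw[OF bij_bidegree, where f = "\<lambda>p. sphere_inner (T f p) (T g p)"]
    unfolding Tb[symmetric] L2_inner_sphere_restriction[OF h f g] by blast
  have into: "T f \<in> hilbert_sum ?I ?V (sphere_inner)" if f: "f \<in> ?H" for f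
    unfolding hilbert_sum_def
  proof (intro CollectI conjI ballI allI impI)
    show "T f p \<in> ?V p" if "p \<in> ?I" for p
      using that harmonic_projection_in[OF rL[OF f]] by (cases p) (simp add: T_def)
    show "T f p = (\<lambda>_. 0)" if "p \<notin> ?I" for p using that by (simp only: T_def if_False)
    have "(\<lambda>m. sphere_sqnorm (projection_at k m (?r f))) summable_on UNIV"
      using Parseval_equivariant[OF rL[OF f] rE[OF f]]
      by (intro summable_nonneg_imp_summable_on) (auto simp: sums_iff)
    then have "(\<lambda>m. Re (sphere_inner (T f (bidegree k m)) (T f (bidegree k m)))) summable_on UNIV"
      by (simp add: Tb L2_inner_self)
    then show "(\<lambda>p. Re (sphere_inner (T f p) (T f p))) summable_on ?I"
      using summable_on_reindex_bij_betw[OF bij_bidegree,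
          where f = "\<lambda>p. Re (sphere_inner (T f p) (T f p))"] by blast
  qed
  have onto: "v \<in> T ` ?H" if v: "v \<in> hilbert_sum ?I ?V (sphere_inner)" for v
  proof -
    have vV: "v p \<in> ?V p" if "p \<in> ?I" for p using v that unfolding hilbert_sum_def by blast
    have v0: "v p = (\<lambda>_. 0)" if "p \<notin> ?I" for p using v that unfolding hilbert_sum_def by blast
    have vs: "(\<lambda>p. Re (sphere_inner (v p) (v p))) summable_on ?I" using v by (simp add: hilbert_sum_def)
    define w where "w m = v (bidegree k m)" for m
    have wb: "w m \<in> harmonics_at k m" for m
      using vV[OF bI[of m]] by (simp add: w_def case_prod_beta)
    have "(\<lambda>m. Re (sphere_inner (v (bidegree k m)) (v (bidegree k m)))) summable_on UNIV"
      using vs summable_on_reindex_bij_betw[OF bij_bidegree,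
          where f = "\<lambda>p. Re (sphere_inner (v p) (v p))"] by blast
    then have "(\<lambda>m. sphere_sqnorm (w m)) summable_on UNIV"
      by (simp add: w_def L2_inner_self)
    then have sm: "summable (\<lambda>m. sphere_sqnorm (w m))"
      using has_sum_imp_sums[OF has_sum_infsum] sums_summable by blast
    obtain F where F: "F \<in> L2_sphere" "phase_equivariant k F"
      and Fw: "\<And>m q. q \<in> harmonics_at k m \<Longrightarrow> sphere_inner F q = sphere_inner (w m) q"
      and "(\<lambda>m. sphere_sqnorm (w m)) sums sphere_sqnorm F"
    proof (rule harmonic_series[of w k, OF wb sm])
      fix F :: "complex^'n \<Rightarrow> complex"
      assume "F \<in> L2_sphere" "phase_equivariant k F"
        "\<And>m q. q \<in> harmonics_at k m \<Longrightarrow> sphere_inner F q = sphere_inner (w m) q"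
        "(\<lambda>m. sphere_sqnorm (w m)) sums sphere_sqnorm F"
      then show thesis by (rule that)
    qed
    define f where "f = induced_function i0 ?t F"
    have f: "f \<in> ?H" unfolding f_def by (rule induced_function_principal_series[OF h F])
    have "T f p = v p" for p
    proof (cases "p \<in> ?I")
      case True
      then obtain m where p: "p = bidegree k m"
        using bij_betw_imp_surj_on[OF bij_bidegree, of k] by blast
      have "projection_at k m (?r f) = projection_at k m F"
        by (rule harmonic_projection_sphere_cong[OF rm[OF f] L2_sphere_measurable[OF F(1)]])
           (simp add: f_def sphere_restriction_induced)
      also have "\<dots> = v p"
        unfolding p w_def[symmetric] by (rule harmonic_projection_eqI[OF wb Fw])
      finally show ?thesis by (simp only: p Tb)
    next
      case False
      then show ?thesis by (simp only: T_def if_False v0[OF False])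
    qed
    then have "v = T f" by (intro ext) simp
    then show ?thesis by (rule image_eqI[OF _ f])
  qed
  show ?thesis
    unfolding unitarily_equivalent_to_sum_def
  proof (intro exI[of _ T] conjI ballI allI)
    show "T ` ?H = hilbert_sum ?I ?V (sphere_inner)" using into onto by blast
    show "T (\<lambda>x. a * f x + b * g x) = (\<lambda>p z. a * T f p z + b * T g p z)" if "f \<in> ?H" "g \<in> ?H" for a b f g
    proof -
      have r: "?r (\<lambda>x. a * f x + b * g x) = (\<lambda>z. a * ?r f z + b * ?r g z)" by (simp add: sphere_restriction_def)
      have "T (\<lambda>x. a * f x + b * g x) p = (\<lambda>z. a * T f p z + b * T g p z)" for p
        unfolding T_def r harmonic_projection_lincomb[OF rL[OF that(1)] rL[OF that(2)]] by simp
      then show ?thesis by (rule ext)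
    qed
    show "hilbert_sum_inner ?I (sphere_inner) (T f) (T g) = L2_inner \<mu> f g" if "f \<in> ?H" "g \<in> ?H" for f g
      unfolding hilbert_sum_inner_def by (rule infsumI[OF inner[OF that]])
    show "left_translate u f \<in> ?H" if "u \<in> unitary_group" "f \<in> ?H" for u f
      by (rule left_translate_principal_series[OF h that])
    show "T (left_translate u f) = (\<lambda>p. poly_action u (T f p))" if u: "u \<in> unitary_group" and f: "f \<in> ?H" for u f
    proof
      fix p
      show "T (left_translate u f) p = poly_action u (T f p)"
      proof (cases "p \<in> ?I")
        case True
        have cu: "conj_transpose u \<in> unitary_group" by (rule unitary_group_conj_transpose[OF u])
        have "harmonic_projection (fst p) (snd p) (?r (left_translate u f))
            = harmonic_projection (fst p) (snd p) (\<lambda>z. ?r f (conj_transpose u *v z))"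
          by (rule harmonic_projection_sphere_cong[OF rm[OF left_translate_principal_series[OF h u f]]
                L2_sphere_measurable[OF L2_sphere_unitary[OF cu rL[OF f]]]])
             (rule sphere_restriction_left_translate[OF u f])
        then show ?thesis
          using True by (simp only: T_def if_True poly_action_def matrix_inv_unitary[OF u]
            harmonic_projection_unitary[OF cu rL[OF f]])
      next
        case False
        then show ?thesis by (simp only: T_def if_False poly_action_def)
      qed
    qed
  qed
qed

end
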